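(* Suppose that $m,n\to\infty$ and that $sm=tn=S$ for nonnegative integer functions $s=s(m,n)$, $t=t(m,n)$ and $S=S(m,n)$. If $1\le st=o(S^{2/3})$ then $$M(m,s;n,t)=\frac{S!}{(s!)^m\,(t!)^n}\exp\biggl(\frac{(s-1)(t-1)}{2}-\frac{(s-1)(t-1)(2st-s-t-10)}{12S}+O\biggl(\frac{s^3t^3}{S^2}\biggr)\biggr).$$
   Context: $M(m,s;n,t)$ is the number of $m\times n$ matrices with nonnegative integer entries in which every row sum equals $s$ and every column sum equals $t$ (where $ms=nt$). Convention for $O(\cdot)$: the condition $1\le st=o(S^{2/3})$ means that $1\le st\le f(S)$ for a fixed function $f$ with $f(S)=o(S^{2/3})$ as $S\to\infty$; then $O(\phi)$ denotes any quantity whose absolute value is at most $|c\phi|$ for some constant $c$ depending on $f$ and nothing else. *)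

theory Defs
  imports Complex_Main "HOL-Library.Landau_Symbols" "Jordan_Normal_Form.Matrix"
begin

definition margin_matrices :: "nat \<Rightarrow> nat \<Rightarrow> nat \<Rightarrow> nat \<Rightarrow> nat mat set" where
  "margin_matrices m s n t =
     {A \<in> carrier_mat m n.
        (\<forall>i<m. (\<Sum>j<n. A $$ (i, j)) = s) \<and>
        (\<forall>j<n. (\<Sum>i<m. A $$ (i, j)) = t)}"

(* M m s n t is M(m,s;n,t).  For m, n > 0 the set is finite, since every entry
   is at most s, so card is the true number of matrices. *)
definition M :: "nat \<Rightarrow> nat \<Rightarrow> nat \<Rightarrow> nat \<Rightarrow> nat" where
  "M m s n t = card (margin_matrices m s n t)"

end

theory Submission
  imports Defs "HOL-Combinatorics.Multiset_Permutations"
begin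

text \<open>
Let \<open>Q = S! / (s!\<^sup>m t!\<^sup>n)\<close>.  This is the sum over all admissible matrices of the reciprocal of
the product of the factorials of the entries, that is, the coefficient of \<open>\<Prod> x\<^sub>i\<^sup>s \<Prod> y\<^sub>j\<^sup>t\<close> in
\<open>\<Prod> exp (x\<^sub>i y\<^sub>j)\<close>.  The number of matrices is the same coefficient in
\<open>\<Prod> 1 / (1 - x\<^sub>i y\<^sub>j)\<close>, and \<open>1 / (1 - z) = exp (z + z\<^sup>2/2 + z\<^sup>3/3 + \<dots>)\<close>.  Everything rests on keeping
only three terms of this exponent.

The series \<open>exp (z + z\<^sup>2/2 + z\<^sup>3/3)\<close> has coefficients equal to 1 up to \<open>z\<^sup>3\<close> and in \<open>[0, 1]\<close> beyond.
Weighting a matrix by the product of these coefficients over its entries therefore gives a total that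
lies between the number of matrices with all entries at most 3 and the number of all matrices
(\<open>short_cycle_weight_le_1\<close>, \<open>short_cycle_weight_eq_1\<close>).  A two by two switching lowers a given
entry by one and shows that a proportion of at most \<open>256 s\<^sup>3 t\<^sup>3 / S\<^sup>2\<close> of the matrices has an entry
above 3 (\<open>tables_small_entries_ge\<close>).  So the weighted total determines \<open>M\<close> within the required
precision.

The weighted total is an explicit double sum, because the coefficient extraction separates rows from
columns once the power sums of \<open>x\<^sub>i y\<^sub>j\<close> are written as products of power sums.  Combinatorially, a
weighted matrix is a triple of words over the cells, whose letters contribute one, two or three units
to their cell; a word over cells is a pair of a word over rows and a word over columns, and the margin
conditions concern these two words separately (\<open>sum_tables_loadings\<close>).  The result is
\<open>\<Sum> \<tau>(a, b)\<close>, where \<open>\<tau>(a, b)\<close> is a row count times a column count divided by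
\<open>c! a! b! 2\<^sup>a 3\<^sup>b\<close> with \<open>c = S - 2 a - 3 b\<close>, and \<open>\<tau>(0, 0) = Q\<close>.
In terms of permutations, \<open>a\<close> and \<open>b\<close> are numbers of transpositions and 3-cycles.

Double counting gives the ratios of neighbouring terms: with \<open>\<mu> = (s-1)(t-1)/2\<close> and
\<open>\<nu> = (s-1)(s-2)(t-1)(t-2)/(3S)\<close>,
\<open>(a+1) \<tau>(a+1, 0) / \<tau>(a, 0) = \<mu> (1 + (1 + \<beta> a) / S) + O(\<mu> (a+1)\<^sup>2 / S\<^sup>2)\<close> and
\<open>(b+1) \<tau>(a, b+1) / \<tau>(a, b) = \<nu> (1 + O((a+b+1) / S))\<close>, as long as \<open>2 a + 3 b \<le> S / 2\<close>.
The first says that the polynomial \<open>F(x) = \<Sum> \<tau>(a, 0) x\<^sup>a\<close> nearly satisfies a linear differential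
equation, \<open>F' = \<mu> (1 + 1/S) F + (\<mu> \<beta> / S) x F'\<close>, with an error that is bounded by a multiple of \<open>F\<close>
itself.  Integrating \<open>F' / F\<close> over \<open>[0, 1]\<close> gives \<open>ln F(1)\<close> without any analysis of where the sum
concentrates (\<open>ln_sum_of_ratio\<close>); a second integration, in a variable that marks \<open>b\<close>, adds \<open>\<nu>\<close>
(\<open>ln_double_sum_of_ratio\<close>).  The terms with \<open>2 a + 3 b > S / 2\<close> add up to at most \<open>Q exp (-S)\<close>
(\<open>total_le_core\<close>).  The sum \<open>\<mu> + \<mu>/S + \<mu>\<^sup>2 \<beta> / (2 S) + \<nu>\<close> is the exponent of the theorem
(\<open>exponent_eq\<close>).

All this requires \<open>S\<close> large and \<open>s t \<le> \<epsilon> S\<^bsup>2/3\<^esup>\<close> for a small absolute \<open>\<epsilon>\<close>.  The finitely many remaining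
cases are absorbed into the constant, which is possible since \<open>M\<close> is positive.
\<close>

section \<open>Sums over words\<close>

definition words :: "'a set \<Rightarrow> nat \<Rightarrow> 'a list set" where
  "words E k = {xs. set xs \<subseteq> E \<and> length xs = k}"

lemma finite_words [simp]: "finite E \<Longrightarrow> finite (words E k)"
  by (simp add: words_def finite_lists_length_eq)

lemma words_0 [simp]: "words E 0 = {[]}"
  by (auto simp: words_def)

lemma sum_words_Suc:
  fixes f :: "'a list \<Rightarrow> 'b::comm_monoid_add"
  assumes "finite E"
  shows "(\<Sum>x\<in>words E (Suc k). f x) = (\<Sum>e\<in>E. \<Sum>x\<in>words E k. f (e # x))"
proof -
  have "(\<Sum>x\<in>words E (Suc k). f x) = (\<Sum>(e, x)\<in>E \<times> words E k. f (e # x))"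
    by (rule sum.reindex_bij_witness[where i = "\<lambda>(e, x). e # x" and j = "\<lambda>x. (hd x, tl x)"])
       (auto simp: words_def length_Suc_conv)
  thus ?thesis
    by (simp add: sum.cartesian_product)
qed

lemma sum_Times:
  "(\<Sum>e\<in>U \<times> V. g (fst e) (snd e)) = (\<Sum>u\<in>U. \<Sum>v\<in>V. g u v)"
  by (simp add: sum.cartesian_product split_def)

lemma sum_words_product:
  fixes f :: "'a list \<Rightarrow> 'b list \<Rightarrow> 'c::comm_monoid_add"
  assumes "finite U" "finite V"
  shows "(\<Sum>x\<in>words (U \<times> V) k. f (map fst x) (map snd x)) =
         (\<Sum>x\<in>words U k. \<Sum>y\<in>words V k. f x y)"
proof (induction k arbitrary: f)
  case (Suc k)
  have "(\<Sum>x\<in>words (U \<times> V) (Suc k). f (map fst x) (map snd x)) =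
        (\<Sum>e\<in>U \<times> V. \<Sum>x\<in>words (U \<times> V) k. f (fst e # map fst x) (snd e # map snd x))"
    using assms by (simp add: sum_words_Suc)
  also have "\<dots> = (\<Sum>e\<in>U \<times> V. \<Sum>x\<in>words U k. \<Sum>y\<in>words V k. f (fst e # x) (snd e # y))"
    by (intro sum.cong refl Suc.IH)
  also have "\<dots> = (\<Sum>u\<in>U. \<Sum>v\<in>V. \<Sum>x\<in>words U k. \<Sum>y\<in>words V k. f (u # x) (v # y))"
    by (rule sum_Times)
  also have "\<dots> = (\<Sum>u\<in>U. \<Sum>x\<in>words U k. \<Sum>v\<in>V. \<Sum>y\<in>words V k. f (u # x) (v # y))"
    by (intro sum.cong refl sum.swap)
  finally show ?case
    using assms by (simp add: sum_words_Suc)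
qed simp

primrec falling :: "real \<Rightarrow> nat \<Rightarrow> real" where
  "falling r 0 = 1"
| "falling r (Suc k) = r * falling (r - 1) k"

lemma falling_nonneg: "0 \<le> falling (real n) k"
proof (induction k arbitrary: n)
  case (Suc k)
  show ?case using Suc[of "n - 1"] by (cases n) auto
qed simp

lemma falling_mono:
  assumes "n \<le> n'"
  shows "falling (real n) k \<le> falling (real n') k"
  using assms
proof (induction k arbitrary: n n')
  case (Suc k)
  show ?case
  proof (cases n)
    case 0
    thus ?thesis using falling_nonneg[of n' "Suc k"] by simp
  next
    case (Suc l)
    then obtain l' where l': "n' = Suc l'" "l \<le> l'" using Suc.prems by (cases n') auto
    show ?thesis using Suc l' Suc.IH[of l l'] falling_nonneg[of l k]
      by (auto intro!: mult_mono)
  qed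
qed simp

text \<open>Removing one marked occurrence of \<open>e\<close> from a word gives a shorter word together with one of
\<open>k + 1\<close> places to reinsert it.  The weight may depend on the word only through its multiset of letters,
so the place does not matter.\<close>

lemma sum_words_count:
  fixes F :: "'a multiset \<Rightarrow> real"
  assumes "finite E" "e \<in> E"
  shows "(\<Sum>x\<in>words E (Suc k). F (mset x) * real (count (mset x) e)) =
         real (Suc k) * (\<Sum>x\<in>words E k. F (add_mset e (mset x)))"
proof (induction k arbitrary: F)
  case 0
  have "(\<Sum>x\<in>words E (Suc 0). F (mset x) * real (count (mset x) e)) =
        (\<Sum>f\<in>E. F {#f#} * real (count {#f#} e))"
    using assms by (subst sum_words_Suc) simp_all
  also have "\<dots> = (\<Sum>f\<in>E. if f = e then F {#e#} else 0)"
    by (intro sum.cong) auto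
  finally have "(\<Sum>x\<in>words E (Suc 0). F (mset x) * real (count (mset x) e)) = \<dots>" .
  thus ?case using assms by simp
next
  case (Suc k)
  have "(\<Sum>x\<in>words E (Suc (Suc k)). F (mset x) * real (count (mset x) e)) =
        (\<Sum>f\<in>E. \<Sum>x\<in>words E (Suc k).
           (if f = e then F (add_mset e (mset x)) else 0)
           + F (add_mset f (mset x)) * real (count (mset x) e))"
    using assms
    by (subst sum_words_Suc) (auto intro!: sum.cong simp: algebra_simps)
  also have "\<dots> = (\<Sum>f\<in>E. (if f = e then \<Sum>x\<in>words E (Suc k). F (add_mset e (mset x)) else 0)
        + real (Suc k) * (\<Sum>x\<in>words E k. F (add_mset f (add_mset e (mset x)))))"
    by (subst Suc.IH[symmetric]) (auto intro!: sum.cong simp: sum.distrib)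
  also have "\<dots> = (\<Sum>x\<in>words E (Suc k). F (add_mset e (mset x)))
        + real (Suc k) * (\<Sum>f\<in>E. \<Sum>x\<in>words E k. F (add_mset f (add_mset e (mset x))))"
    using assms by (simp add: sum.distrib sum_distrib_left)
  also have "(\<Sum>f\<in>E. \<Sum>x\<in>words E k. F (add_mset f (add_mset e (mset x)))) =
        (\<Sum>x\<in>words E (Suc k). F (add_mset e (mset x)))"
    using assms by (simp add: sum_words_Suc add_mset_commute)
  finally show ?case by (simp add: algebra_simps)
qed

text \<open>The number of ways to mark an ordered \<open>k\<close>-tuple of distinct occurrences of \<open>e\<close> is a falling factorial,
hence this iterate of \<open>sum_words_count\<close>.  It is the double counting behind all ratio estimates below.\<close>

lemma sum_words_falling:
  fixes F :: "'a multiset \<Rightarrow> real"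
  assumes "finite E" "e \<in> E"
  shows "(\<Sum>x\<in>words E (c + k). F (mset x) * falling (real (count (mset x) e)) k) =
         falling (real (c + k)) k * (\<Sum>x\<in>words E c. F (mset x + replicate_mset k e))"
proof (induction k arbitrary: F)
  case (Suc k)
  let ?F = "\<lambda>X. F X * falling (real (count X e) - 1) k"
  have "(\<Sum>x\<in>words E (c + Suc k). F (mset x) * falling (real (count (mset x) e)) (Suc k)) =
        (\<Sum>x\<in>words E (Suc (c + k)). ?F (mset x) * real (count (mset x) e))"
    by (simp add: mult_ac)
  also have "\<dots> = real (Suc (c + k)) * (\<Sum>x\<in>words E (c + k). ?F (add_mset e (mset x)))"
    using assms by (rule sum_words_count)
  also have "(\<Sum>x\<in>words E (c + k). ?F (add_mset e (mset x))) =
     (\<Sum>x\<in>words E (c + k). F (add_mset e (mset x)) * falling (real (count (mset x) e)) k)"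
    by simp
  also have "\<dots> = falling (real (c + k)) k * (\<Sum>x\<in>words E c. F (add_mset e (mset x + replicate_mset k e)))"
    by (rule Suc.IH)
  finally show ?case by (simp add: mult_ac)
qed simp

section \<open>Words that build a multiset from letters of multiplicity one, two and three\<close>

definition load :: "'a list \<Rightarrow> 'a list \<Rightarrow> 'a list \<Rightarrow> 'a multiset" where
  "load x y z = mset x + repeat_mset 2 (mset y) + repeat_mset 3 (mset z)"

text \<open>The weights \<open>\<phi>\<close> see only the multisets of the first two words; divided by \<open>loadings\<close>, this is
the mean of \<open>\<phi>\<close> over all triples of words with load \<open>T\<close>.\<close>

definition load_sum ::
  "'a set \<Rightarrow> 'a multiset \<Rightarrow> nat \<Rightarrow> nat \<Rightarrow> nat \<Rightarrow> ('a multiset \<Rightarrow> 'a multiset \<Rightarrow> real) \<Rightarrow> real" where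
  "load_sum E T c a b \<phi> = (\<Sum>x\<in>words E c. \<Sum>y\<in>words E a. \<Sum>z\<in>words E b.
      of_bool (load x y z = T) * \<phi> (mset x) (mset y))"

text \<open>Divided by \<open>c! a! b!\<close>, this number is the coefficient of
\<open>p\<^sub>1\<^sup>c p\<^sub>2\<^sup>a p\<^sub>3\<^sup>b\<close> in \<open>\<Prod>\<^sub>e [z\<^bsup>T e\<^esup>] exp (p\<^sub>1 z + p\<^sub>2 z\<^sup>2 + p\<^sub>3 z\<^sup>3)\<close>.\<close>

definition loadings :: "'a set \<Rightarrow> 'a multiset \<Rightarrow> nat \<Rightarrow> nat \<Rightarrow> nat \<Rightarrow> real" where
  "loadings E T c a b = load_sum E T c a b (\<lambda>_ _. 1)"

text \<open>An extra block of \<open>k\<close> equal letters stands beside the three words.  The block may be read as one more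
letter of the second (\<open>k = 2\<close>) or third (\<open>k = 3\<close>) word, or as \<open>k\<close> equal letters of the first word;
comparing the two readings relates \<open>loadings\<close> with different parameters.\<close>

definition loadings_plus :: "'a set \<Rightarrow> 'a multiset \<Rightarrow> nat \<Rightarrow> nat \<Rightarrow> nat \<Rightarrow> nat \<Rightarrow> real" where
  "loadings_plus E T c a b k = (\<Sum>e\<in>E. \<Sum>x\<in>words E c. \<Sum>y\<in>words E a. \<Sum>z\<in>words E b.
      of_bool (load x y z + replicate_mset k e = T))"

lemma load_sum_mono:
  assumes "\<And>x y z. x \<in> words E c \<Longrightarrow> y \<in> words E a \<Longrightarrow> z \<in> words E b \<Longrightarrow> load x y z = T
             \<Longrightarrow> \<phi> (mset x) (mset y) \<le> \<psi> (mset x) (mset y)"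
  shows "load_sum E T c a b \<phi> \<le> load_sum E T c a b \<psi>"
  unfolding load_sum_def by (intro sum_mono) (auto simp: assms)

lemma load_sum_cong:
  assumes "\<And>x y z. x \<in> words E c \<Longrightarrow> y \<in> words E a \<Longrightarrow> z \<in> words E b \<Longrightarrow> load x y z = T
             \<Longrightarrow> \<phi> (mset x) (mset y) = \<psi> (mset x) (mset y)"
  shows "load_sum E T c a b \<phi> = load_sum E T c a b \<psi>"
  by (intro antisym load_sum_mono) (auto simp: assms)

lemma load_sum_const: "load_sum E T c a b (\<lambda>_ _. r) = r * loadings E T c a b"
  by (simp add: load_sum_def loadings_def sum_distrib_left mult_ac)

lemma load_sum_add:
  "load_sum E T c a b (\<lambda>X Y. \<phi> X Y + \<psi> X Y) = load_sum E T c a b \<phi> + load_sum E T c a b \<psi>"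
  by (simp add: load_sum_def sum.distrib algebra_simps)

lemma load_sum_cmult:
  "load_sum E T c a b (\<lambda>X Y. r * \<phi> X Y) = r * load_sum E T c a b \<phi>"
  by (simp add: load_sum_def sum_distrib_left mult_ac)

lemma loadings_nonneg: "0 \<le> loadings E T c a b"
  by (auto simp: loadings_def load_sum_def intro!: sum_nonneg)

lemma load_sum_sum:
  "(\<Sum>e\<in>E'. load_sum E T c a b (\<phi> e)) = load_sum E T c a b (\<lambda>X Y. \<Sum>e\<in>E'. \<phi> e X Y)"
proof (induction E' rule: infinite_finite_induct)
  case empty thus ?case by (simp add: load_sum_def)
next
  case (infinite A) thus ?case by (simp add: load_sum_def)
qed (simp add: load_sum_add)

lemma load_Cons:
  "load (e # x) y z = load x y z + {#e#}"
  "load x (e # y) z = load x y z + replicate_mset 2 e"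
  "load x y (e # z) = load x y z + replicate_mset 3 e"
  by (simp_all add: load_def numeral_eq_Suc)

lemma size_repeat_mset' [simp]: "size (repeat_mset k A) = k * size A"
  by (induction k) auto

lemma loadings_Suc:
  assumes "finite E"
  shows "loadings E T (Suc c) a b = loadings_plus E T c a b 1"
    and "loadings E T c (Suc a) b = loadings_plus E T c a b 2"
    and "loadings E T c a (Suc b) = loadings_plus E T c a b 3"
proof -
  show "loadings E T (Suc c) a b = loadings_plus E T c a b 1"
    using assms
    by (simp add: loadings_def load_sum_def loadings_plus_def sum_words_Suc load_Cons)
  have "loadings E T c (Suc a) b = (\<Sum>x\<in>words E c. \<Sum>e\<in>E. \<Sum>y\<in>words E a. \<Sum>z\<in>words E b.
      of_bool (load x y z + replicate_mset 2 e = T))"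
    using assms
    by (simp add: loadings_def load_sum_def sum_words_Suc load_Cons del: sum_of_bool_eq)
  also have "\<dots> = loadings_plus E T c a b 2"
    unfolding loadings_plus_def by (rule sum.swap)
  finally show "loadings E T c (Suc a) b = loadings_plus E T c a b 2" .
  have "loadings E T c a (Suc b) = (\<Sum>x\<in>words E c. \<Sum>y\<in>words E a. \<Sum>e\<in>E. \<Sum>z\<in>words E b.
      of_bool (load x y z + replicate_mset 3 e = T))"
    using assms
    by (simp add: loadings_def load_sum_def sum_words_Suc load_Cons del: sum_of_bool_eq)
  also have "\<dots> = (\<Sum>x\<in>words E c. \<Sum>e\<in>E. \<Sum>y\<in>words E a. \<Sum>z\<in>words E b.
      of_bool (load x y z + replicate_mset 3 e = T))"
    by (intro sum.cong refl sum.swap)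
  also have "\<dots> = loadings_plus E T c a b 3"
    unfolding loadings_plus_def by (rule sum.swap)
  finally show "loadings E T c a (Suc b) = loadings_plus E T c a b 3" .
qed

lemma loadings_plus_eq:
  "loadings_plus E T c a b k =
     (\<Sum>e\<in>E. if k \<le> count T e then loadings E (T - replicate_mset k e) c a b else 0)"
proof -
  have *: "load x y z + replicate_mset k e = T \<longleftrightarrow>
        k \<le> count T e \<and> load x y z = T - replicate_mset k e" for x y z :: "'a list" and e
    by (metis add_diff_cancel_right' count_le_replicate_mset_subset_eq mset_subset_eq_add_right
        subset_mset.diff_add)
  show ?thesis
    unfolding loadings_plus_def loadings_def load_sum_def *
    by (intro sum.cong refl) auto
qed

lemma load_sum_falling_fst:
  assumes "finite E"
  shows "(\<Sum>e\<in>E. load_sum E T (c + k) a b (\<lambda>X _. falling (real (count X e)) k)) =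
         falling (real (c + k)) k * loadings_plus E T c a b k"
proof -
  have "load_sum E T (c + k) a b (\<lambda>X _. falling (real (count X e)) k) =
        falling (real (c + k)) k * (\<Sum>x\<in>words E c. \<Sum>y\<in>words E a. \<Sum>z\<in>words E b.
           of_bool (load x y z + replicate_mset k e = T))" if "e \<in> E" for e
  proof -
    define F where "F X = (\<Sum>y\<in>words E a. \<Sum>z\<in>words E b.
         of_bool (X + repeat_mset 2 (mset y) + repeat_mset 3 (mset z) = T) :: real)" for X
    have "load_sum E T (c + k) a b (\<lambda>X _. falling (real (count X e)) k) =
        (\<Sum>x\<in>words E (c + k). F (mset x) * falling (real (count (mset x) e)) k)"
      by (simp add: load_sum_def F_def load_def sum_distrib_right)
    also have "\<dots> = falling (real (c + k)) k * (\<Sum>x\<in>words E c. F (mset x + replicate_mset k e))"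
      using assms that by (rule sum_words_falling)
    finally show ?thesis by (simp add: F_def load_def add_ac)
  qed
  thus ?thesis by (simp add: loadings_plus_def sum_distrib_left)
qed

text \<open>Two equal letters of the second word weigh as much as a block of four, which can then be read as four
equal letters of the first word.  This turns the probability of such a repetition into a quantity that
the trivial bounds on letter counts control.\<close>

lemma load_sum_falling_snd:
  assumes "finite E"
  shows "(\<Sum>e\<in>E. load_sum E T c (a + 2) b (\<lambda>_ Y. falling (real (count Y e)) 2)) =
         falling (real (a + 2)) 2 * loadings_plus E T c a b 4"
proof -
  have "load_sum E T c (a + 2) b (\<lambda>_ Y. falling (real (count Y e)) 2) =
        falling (real (a + 2)) 2 * (\<Sum>x\<in>words E c. \<Sum>y\<in>words E a. \<Sum>z\<in>words E b.
           of_bool (load x y z + replicate_mset 4 e = T))" if "e \<in> E" for e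
  proof -
    define F where "F x Y = (\<Sum>z\<in>words E b.
         of_bool (mset x + repeat_mset 2 Y + repeat_mset 3 (mset z) = T) :: real)" for x Y
    have "load_sum E T c (a + 2) b (\<lambda>_ Y. falling (real (count Y e)) 2) =
        (\<Sum>x\<in>words E c. \<Sum>y\<in>words E (a + 2). F x (mset y) * falling (real (count (mset y) e)) 2)"
      by (simp add: load_sum_def F_def load_def sum_distrib_right)
    also have "\<dots> = (\<Sum>x\<in>words E c. falling (real (a + 2)) 2 *
                       (\<Sum>y\<in>words E a. F x (mset y + replicate_mset 2 e)))"
      using assms that by (intro sum.cong refl sum_words_falling)
    finally show ?thesis
      by (simp add: F_def load_def add_ac sum_distrib_left numeral_eq_Suc)
  qed
  thus ?thesis by (simp add: loadings_plus_def sum_distrib_left)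
qed

section \<open>The exponential series truncated after three terms\<close>

definition cycle_types :: "nat \<Rightarrow> (nat \<times> nat \<times> nat) set" where
  "cycle_types N = {(c, a, b). c + 2 * a + 3 * b = N}"

text \<open>The inverse order of the centraliser of a permutation with \<open>c\<close> fixed points, \<open>a\<close> transpositions
and \<open>b\<close> 3-cycles.\<close>

definition cycle_weight :: "nat \<Rightarrow> nat \<Rightarrow> nat \<Rightarrow> real" where
  "cycle_weight c a b = 1 / (fact c * fact a * fact b * 2 ^ a * 3 ^ b)"

text \<open>The product over all \<open>e\<close> of the coefficient of \<open>z\<^bsup>A e\<^esup>\<close> in \<open>exp (z + z\<^sup>2/2 + z\<^sup>3/3)\<close>, in the form of a
sum over words.  Equivalently, the proportion of permutations all of whose cycles have length at most
three in the Young subgroup of type \<open>A\<close>.\<close>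

definition short_cycle_weight :: "'a set \<Rightarrow> 'a multiset \<Rightarrow> real" where
  "short_cycle_weight E A = (\<Sum>(c, a, b)\<in>cycle_types (size A). loadings E A c a b * cycle_weight c a b)"

lemma finite_cycle_types [simp]: "finite (cycle_types N)"
  by (rule finite_subset[of _ "{..N} \<times> {..N} \<times> {..N}"]) (auto simp: cycle_types_def)

lemma cycle_weight_pos: "0 < cycle_weight c a b"
  by (simp add: cycle_weight_def)

lemma cycle_weight_Suc:
  "real (Suc c) * cycle_weight (Suc c) a b = cycle_weight c a b"
  "2 * real (Suc a) * cycle_weight c (Suc a) b = cycle_weight c a b"
  "3 * real (Suc b) * cycle_weight c a (Suc b) = cycle_weight c a b"
  by (simp_all add: cycle_weight_def fact_Suc field_simps del: of_nat_Suc)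

lemma sum_cycle_types_shift:
  fixes g :: "nat \<Rightarrow> nat \<Rightarrow> nat \<Rightarrow> real"
  shows "1 \<le> N \<Longrightarrow> (\<Sum>(c, a, b)\<in>cycle_types N. if c = 0 then 0 else g (c - 1) a b) =
           (\<Sum>(c, a, b)\<in>cycle_types (N - 1). g c a b)"
    and "2 \<le> N \<Longrightarrow> (\<Sum>(c, a, b)\<in>cycle_types N. if a = 0 then 0 else g c (a - 1) b) =
           (\<Sum>(c, a, b)\<in>cycle_types (N - 2). g c a b)"
    and "3 \<le> N \<Longrightarrow> (\<Sum>(c, a, b)\<in>cycle_types N. if b = 0 then 0 else g c a (b - 1)) =
           (\<Sum>(c, a, b)\<in>cycle_types (N - 3). g c a b)"
proof -
  show "(\<Sum>(c, a, b)\<in>cycle_types N. if c = 0 then 0 else g (c - 1) a b) = (\<Sum>(c, a, b)\<in>cycle_types (N - 1). g c a b)" if "1 \<le> N"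
  proof -
    have "(\<Sum>(c, a, b)\<in>cycle_types N. if c = 0 then 0 else g (c - 1) a b) =
        (\<Sum>(c, a, b)\<in>{(c, a, b). (c, a, b) \<in> cycle_types N \<and> c \<noteq> 0}. if c = 0 then 0 else g (c - 1) a b)"
      by (rule sum.mono_neutral_right) (auto split: if_split_asm)
    also have "\<dots> = (\<Sum>(c, a, b)\<in>cycle_types (N - 1). g c a b)"
      using that
      by (intro sum.reindex_bij_witness
            [where i = "\<lambda>(c, a, b). (Suc c, a, b)" and j = "\<lambda>(c, a, b). (c - 1, a, b)"])
         (auto simp: cycle_types_def)
    finally show ?thesis .
  qed
  show "(\<Sum>(c, a, b)\<in>cycle_types N. if a = 0 then 0 else g c (a - 1) b) = (\<Sum>(c, a, b)\<in>cycle_types (N - 2). g c a b)" if "2 \<le> N"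
  proof -
    have "(\<Sum>(c, a, b)\<in>cycle_types N. if a = 0 then 0 else g c (a - 1) b) =
        (\<Sum>(c, a, b)\<in>{(c, a, b). (c, a, b) \<in> cycle_types N \<and> a \<noteq> 0}. if a = 0 then 0 else g c (a - 1) b)"
      by (rule sum.mono_neutral_right) (auto split: if_split_asm)
    also have "\<dots> = (\<Sum>(c, a, b)\<in>cycle_types (N - 2). g c a b)"
      using that
      by (intro sum.reindex_bij_witness
            [where i = "\<lambda>(c, a, b). (c, Suc a, b)" and j = "\<lambda>(c, a, b). (c, a - 1, b)"])
         (auto simp: cycle_types_def)
    finally show ?thesis .
  qed
  show "(\<Sum>(c, a, b)\<in>cycle_types N. if b = 0 then 0 else g c a (b - 1)) = (\<Sum>(c, a, b)\<in>cycle_types (N - 3). g c a b)" if "3 \<le> N"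
  proof -
    have "(\<Sum>(c, a, b)\<in>cycle_types N. if b = 0 then 0 else g c a (b - 1)) =
        (\<Sum>(c, a, b)\<in>{(c, a, b). (c, a, b) \<in> cycle_types N \<and> b \<noteq> 0}. if b = 0 then 0 else g c a (b - 1))"
      by (rule sum.mono_neutral_right) (auto split: if_split_asm)
    also have "\<dots> = (\<Sum>(c, a, b)\<in>cycle_types (N - 3). g c a b)"
      using that
      by (intro sum.reindex_bij_witness
            [where i = "\<lambda>(c, a, b). (c, a, Suc b)" and j = "\<lambda>(c, a, b). (c, a, b - 1)"])
         (auto simp: cycle_types_def)
    finally show ?thesis .
  qed
qed

lemma loadings_cycle_weight_rec:
  assumes "finite E"
  shows "real c * (loadings E A c a b * cycle_weight c a b) = (\<Sum>e\<in>E. if 1 \<le> count A e then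
           (if c = 0 then 0 else loadings E (A - replicate_mset 1 e) (c - 1) a b * cycle_weight (c - 1) a b) else 0)"
    and "2 * real a * (loadings E A c a b * cycle_weight c a b) = (\<Sum>e\<in>E. if 2 \<le> count A e then
           (if a = 0 then 0 else loadings E (A - replicate_mset 2 e) c (a - 1) b * cycle_weight c (a - 1) b) else 0)"
    and "3 * real b * (loadings E A c a b * cycle_weight c a b) = (\<Sum>e\<in>E. if 3 \<le> count A e then
           (if b = 0 then 0 else loadings E (A - replicate_mset 3 e) c a (b - 1) * cycle_weight c a (b - 1)) else 0)"
proof -
  show "real c * (loadings E A c a b * cycle_weight c a b) = (\<Sum>e\<in>E. if 1 \<le> count A e then
           (if c = 0 then 0 else loadings E (A - replicate_mset 1 e) (c - 1) a b * cycle_weight (c - 1) a b) else 0)"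
  proof (cases c)
    case (Suc c')
    have "real c * (loadings E A c a b * cycle_weight c a b) = loadings E A (Suc c') a b * cycle_weight c' a b"
      unfolding Suc cycle_weight_Suc(1)[of c' a b, symmetric] by (simp only: mult_ac)
    also have "\<dots> = (\<Sum>e\<in>E. if 1 \<le> count A e then
        loadings E (A - replicate_mset 1 e) c' a b * cycle_weight c' a b else 0)"
      unfolding loadings_Suc(1)[OF assms] loadings_plus_eq sum_distrib_right
      by (intro sum.cong) auto
    finally show ?thesis by (simp add: Suc cong: if_cong)
  qed (simp cong: if_cong)
  show "2 * real a * (loadings E A c a b * cycle_weight c a b) = (\<Sum>e\<in>E. if 2 \<le> count A e then
           (if a = 0 then 0 else loadings E (A - replicate_mset 2 e) c (a - 1) b * cycle_weight c (a - 1) b) else 0)"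
  proof (cases a)
    case (Suc a')
    have "2 * real a * (loadings E A c a b * cycle_weight c a b) = loadings E A c (Suc a') b * cycle_weight c a' b"
      unfolding Suc cycle_weight_Suc(2)[of a' c b, symmetric] by (simp only: mult_ac)
    also have "\<dots> = (\<Sum>e\<in>E. if 2 \<le> count A e then
        loadings E (A - replicate_mset 2 e) c a' b * cycle_weight c a' b else 0)"
      unfolding loadings_Suc(2)[OF assms] loadings_plus_eq sum_distrib_right
      by (intro sum.cong) auto
    finally show ?thesis by (simp add: Suc cong: if_cong)
  qed (simp cong: if_cong)
  show "3 * real b * (loadings E A c a b * cycle_weight c a b) = (\<Sum>e\<in>E. if 3 \<le> count A e then
           (if b = 0 then 0 else loadings E (A - replicate_mset 3 e) c a (b - 1) * cycle_weight c a (b - 1)) else 0)"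
  proof (cases b)
    case (Suc b')
    have "3 * real b * (loadings E A c a b * cycle_weight c a b) = loadings E A c a (Suc b') * cycle_weight c a b'"
      unfolding Suc cycle_weight_Suc(3)[of b' c a, symmetric] by (simp only: mult_ac)
    also have "\<dots> = (\<Sum>e\<in>E. if 3 \<le> count A e then
        loadings E (A - replicate_mset 3 e) c a b' * cycle_weight c a b' else 0)"
      unfolding loadings_Suc(3)[OF assms] loadings_plus_eq sum_distrib_right
      by (intro sum.cong) auto
    finally show ?thesis by (simp add: Suc cong: if_cong)
  qed (simp cong: if_cong)
qed

lemma count_le_size: "count A e \<le> size A"
  by (metis count_le_replicate_mset_subset_eq le_refl size_mset_mono size_replicate_mset)

lemma size_diff_replicate: "k \<le> count A e \<Longrightarrow> size (A - replicate_mset k e) = size A - k"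
  by (simp add: count_le_replicate_mset_subset_eq size_Diff_submset)

text \<open>For \<open>w(z) = exp (z + z\<^sup>2/2 + z\<^sup>3/3)\<close> this is the differential equation \<open>z w' = (z + z\<^sup>2 + z\<^sup>3) w\<close>,
summed over all factors of the product.  In terms of words it comes from writing the size of \<open>A\<close> as
\<open>c + 2 a + 3 b\<close> and removing the first letter of one of the three words.\<close>

lemma short_cycle_weight_rec:
  assumes "finite E"
  shows "real (size A) * short_cycle_weight E A =
           (\<Sum>e\<in>E. \<Sum>k\<in>{1,2,3}. if k \<le> count A e
              then short_cycle_weight E (A - replicate_mset k e) else 0)"
proof -
  let ?N = "size A"
  define h where "h k e c a b = loadings E (A - replicate_mset k e) c a b * cycle_weight c a b" for k e c a b
  have h: "(\<Sum>(c, a, b)\<in>cycle_types (?N - k). h k e c a b) = short_cycle_weight E (A - replicate_mset k e)"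
    if "k \<le> count A e" for k e
    using that by (simp add: short_cycle_weight_def h_def size_diff_replicate)
  have N: "k \<le> ?N" if "k \<le> count A e" for k e
    using that count_le_size[of A e] by simp
  have "real ?N * short_cycle_weight E A = (\<Sum>(c, a, b)\<in>cycle_types ?N.
     real c * (loadings E A c a b * cycle_weight c a b) + 2 * real a * (loadings E A c a b * cycle_weight c a b)
     + 3 * real b * (loadings E A c a b * cycle_weight c a b))"
    unfolding short_cycle_weight_def sum_distrib_left
  proof (intro sum.cong refl, clarify)
    fix c a b assume "(c, a, b) \<in> cycle_types ?N"
    hence "real ?N = real c + 2 * real a + 3 * real b" by (auto simp: cycle_types_def)
    thus "real ?N * (loadings E A c a b * cycle_weight c a b) =
        real c * (loadings E A c a b * cycle_weight c a b) + 2 * real a * (loadings E A c a b * cycle_weight c a b)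
        + 3 * real b * (loadings E A c a b * cycle_weight c a b)"
      by (simp add: algebra_simps)
  qed
  also have "\<dots> = (\<Sum>(c, a, b)\<in>cycle_types ?N. \<Sum>e\<in>E.
      (if 1 \<le> count A e then (if c = 0 then 0 else h 1 e (c - 1) a b) else 0)
      + (if 2 \<le> count A e then (if a = 0 then 0 else h 2 e c (a - 1) b) else 0)
      + (if 3 \<le> count A e then (if b = 0 then 0 else h 3 e c a (b - 1)) else 0))"
    unfolding loadings_cycle_weight_rec[OF assms] sum.distrib h_def by simp
  also have "\<dots> = (\<Sum>e\<in>E. \<Sum>(c, a, b)\<in>cycle_types ?N.
      (if 1 \<le> count A e then (if c = 0 then 0 else h 1 e (c - 1) a b) else 0)
      + (if 2 \<le> count A e then (if a = 0 then 0 else h 2 e c (a - 1) b) else 0)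
      + (if 3 \<le> count A e then (if b = 0 then 0 else h 3 e c a (b - 1)) else 0))"
    unfolding split_def by (rule sum.swap)
  also have "\<dots> = (\<Sum>e\<in>E.
      (if 1 \<le> count A e then \<Sum>(c, a, b)\<in>cycle_types ?N. (if c = 0 then 0 else h 1 e (c - 1) a b) else 0)
      + (if 2 \<le> count A e then \<Sum>(c, a, b)\<in>cycle_types ?N. (if a = 0 then 0 else h 2 e c (a - 1) b) else 0)
      + (if 3 \<le> count A e then \<Sum>(c, a, b)\<in>cycle_types ?N. (if b = 0 then 0 else h 3 e c a (b - 1)) else 0))"
    by (intro sum.cong refl) (simp add: split_def sum.distrib)
  also have "\<dots> = (\<Sum>e\<in>E.
      (if 1 \<le> count A e then short_cycle_weight E (A - replicate_mset 1 e) else 0)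
      + (if 2 \<le> count A e then short_cycle_weight E (A - replicate_mset 2 e) else 0)
      + (if 3 \<le> count A e then short_cycle_weight E (A - replicate_mset 3 e) else 0))"
    by (intro sum.cong refl arg_cong2[where f = "(+)"] if_cong)
       (simp_all only: sum_cycle_types_shift N h)
  finally show ?thesis by (simp add: add.assoc del: One_nat_def)
qed

lemma short_cycle_weight_nonneg: "0 \<le> short_cycle_weight E A"
  unfolding short_cycle_weight_def
  by (intro sum_nonneg) (auto simp: loadings_nonneg less_imp_le[OF cycle_weight_pos])

lemma short_cycle_weight_empty: "short_cycle_weight E {#} = 1"
proof -
  have "cycle_types 0 = {(0, 0, 0)}" by (auto simp: cycle_types_def)
  thus ?thesis
    by (simp add: short_cycle_weight_def loadings_def load_sum_def load_def cycle_weight_def)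
qed

lemma sum_count_eq_size:
  assumes "finite E" "set_mset A \<subseteq> E"
  shows "(\<Sum>e\<in>E. count A e) = size A"
  unfolding size_multiset_overloaded_eq
  using assms by (intro sum.mono_neutral_right) (auto simp: not_in_iff)

lemma sum_if_le_count:
  fixes n :: nat
  shows "(\<Sum>k\<in>{1,2,3}. if k \<le> n then 1 else (0::real)) = real (min n 3)"
proof -
  consider "n = 0" | "n = 1" | "n = 2" | "n \<ge> 3" by linarith
  thus ?thesis by cases auto
qed

text \<open>By the recursion the weight times the size of \<open>A\<close> is a sum of weights of smaller multisets, with
\<open>min (A e) 3\<close> terms for each \<open>e\<close>, hence with at most as many terms as the size.\<close>

lemma short_cycle_weight_le_1:
  assumes "finite E" "set_mset A \<subseteq> E"
  shows "short_cycle_weight E A \<le> 1"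
  using assms(2)
proof (induction "size A" arbitrary: A rule: less_induct)
  case less
  show ?case
  proof (cases "A = {#}")
    case False
    hence pos: "0 < size A" by (simp add: nonempty_has_size)
    have "real (size A) * short_cycle_weight E A \<le> (\<Sum>e\<in>E. real (count A e))"
      unfolding short_cycle_weight_rec[OF assms(1)]
    proof (intro sum_mono)
      fix e
      have "(\<Sum>k\<in>{1,2,3}. if k \<le> count A e then short_cycle_weight E (A - replicate_mset k e) else 0)
         \<le> (\<Sum>k\<in>{1,2,3}. if k \<le> count A e then 1 else 0)"
      proof (intro sum_mono)
        fix k :: nat assume k: "k \<in> {1, 2, 3}"
        show "(if k \<le> count A e then short_cycle_weight E (A - replicate_mset k e) else 0)
                \<le> (if k \<le> count A e then 1 else 0)"
        proof (cases "k \<le> count A e")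
          case True
          have "size (A - replicate_mset k e) < size A"
            using True k pos by (auto simp: size_diff_replicate)
          moreover have "set_mset (A - replicate_mset k e) \<subseteq> E"
            using less.prems by (meson in_diffD subset_eq)
          ultimately show ?thesis using less.hyps True by simp
        qed simp
      qed
      also have "\<dots> \<le> real (count A e)" unfolding sum_if_le_count by simp
      finally show "(\<Sum>k\<in>{1,2,3}. if k \<le> count A e then short_cycle_weight E (A - replicate_mset k e) else 0)
         \<le> real (count A e)" .
    qed
    also have "\<dots> = real (size A)"
      using sum_count_eq_size[OF assms(1) less.prems] by (metis of_nat_sum)
    finally show ?thesis using pos mult_left_le_imp_le[of "real (size A)" _ 1] by simp
  qed (simp add: short_cycle_weight_empty)
qed

text \<open>If no multiplicity exceeds three then no term is lost in that count.\<close>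

lemma short_cycle_weight_eq_1:
  assumes "finite E" "set_mset A \<subseteq> E" "\<And>e. count A e \<le> 3"
  shows "short_cycle_weight E A = 1"
  using assms(2,3)
proof (induction "size A" arbitrary: A rule: less_induct)
  case less
  show ?case
  proof (cases "A = {#}")
    case False
    hence pos: "0 < size A" by (simp add: nonempty_has_size)
    have "real (size A) * short_cycle_weight E A = (\<Sum>e\<in>E. real (count A e))"
      unfolding short_cycle_weight_rec[OF assms(1)]
    proof (intro sum.cong refl)
      fix e
      have "(\<Sum>k\<in>{1,2,3}. if k \<le> count A e then short_cycle_weight E (A - replicate_mset k e) else 0)
         = (\<Sum>k\<in>{1,2,3}. if k \<le> count A e then 1 else 0)"
      proof (intro sum.cong refl if_cong)
        fix k :: nat assume k: "k \<in> {1, 2, 3}" and True: "k \<le> count A e"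
        have "size (A - replicate_mset k e) < size A"
          using True k pos by (auto simp: size_diff_replicate)
        moreover have "set_mset (A - replicate_mset k e) \<subseteq> E"
          using less.prems by (meson in_diffD subset_eq)
        moreover have "count (A - replicate_mset k e) f \<le> 3" for f
          using less.prems(2)[of f] by simp
        ultimately show "short_cycle_weight E (A - replicate_mset k e) = 1"
          using less.hyps by blast
      qed
      also have "\<dots> = real (count A e)" unfolding sum_if_le_count using less.prems(2)[of e] by simp
      finally show "(\<Sum>k\<in>{1,2,3}. if k \<le> count A e then short_cycle_weight E (A - replicate_mset k e) else 0)
         = real (count A e)" .
    qed
    also have "\<dots> = real (size A)"
      using sum_count_eq_size[OF assms(1) less.prems(1)] by (metis of_nat_sum)
    finally show ?thesis using False by simp
  qed (simp add: short_cycle_weight_empty)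
qed

section \<open>Matrices as multisets of cells\<close>

definition regular :: "nat \<Rightarrow> nat \<Rightarrow> nat multiset" where
  "regular m s = repeat_mset s (mset_set {..<m})"

text \<open>A matrix is a multiset of cells, the entry being the multiplicity; the margins are then images under
the projections, which behave well under maps of words.\<close>

definition tables :: "nat \<Rightarrow> nat \<Rightarrow> nat \<Rightarrow> nat \<Rightarrow> (nat \<times> nat) multiset set" where
  "tables m s n t = {A. image_mset fst A = regular m s \<and> image_mset snd A = regular n t}"

lemma count_regular [simp]: "count (regular m s) i = (if i < m then s else 0)"
  by (simp add: regular_def count_mset_set')

lemma size_regular [simp]: "size (regular m s) = s * m"
  by (simp add: regular_def)

lemma set_regular: "set_mset (regular m s) \<subseteq> {..<m}"
proof
  fix i assume "i \<in># regular m s"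
  thus "i \<in> {..<m}"
    using count_greater_zero_iff[of "regular m s" i] by (auto split: if_splits)
qed

lemma size_table: "A \<in> tables m s n t \<Longrightarrow> size A = s * m"
  unfolding tables_def by (metis (mono_tags, lifting) mem_Collect_eq size_image_mset size_regular)

lemma set_table: "A \<in> tables m s n t \<Longrightarrow> set_mset A \<subseteq> {..<m} \<times> {..<n}"
proof
  fix p assume A: "A \<in> tables m s n t" and p: "p \<in># A"
  have "image_mset fst A = regular m s" "image_mset snd A = regular n t"
    using A by (simp_all add: tables_def)
  hence "fst p \<in># regular m s" "snd p \<in># regular n t"
    using p by (metis image_eqI set_image_mset)+
  thus "p \<in> {..<m} \<times> {..<n}" using set_regular by (cases p) fastforce
qed

lemma finite_tables [simp]: "finite (tables m s n t)"
proof (rule finite_subset)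
  show "tables m s n t \<subseteq> mset ` words ({..<m} \<times> {..<n}) (s * m)"
  proof
    fix A assume A: "A \<in> tables m s n t"
    obtain xs where "mset xs = A" using ex_mset by blast
    thus "A \<in> mset ` words ({..<m} \<times> {..<n}) (s * m)"
      using size_table[OF A] set_table[OF A] unfolding words_def by (intro image_eqI[of _ _ xs]) auto
  qed
qed simp

lemma image_load: "image_mset f (load x y z) = load (map f x) (map f y) (map f z)"
proof -
  have "image_mset f (repeat_mset k A) = repeat_mset k (image_mset f A)" for k A
    by (induction k) auto
  thus ?thesis by (simp add: load_def)
qed

text \<open>A word over \<open>{..<m} \<times> {..<n}\<close> is a word over \<open>{..<m}\<close> together with a word of the same length over
\<open>{..<n}\<close>.  Summing over all admissible tables leaves one condition on the row words and one on the
column words, so that the sum factorises.\<close>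

lemma sum_tables_loadings:
  "(\<Sum>A\<in>tables m s n t. loadings ({..<m} \<times> {..<n}) A c a b) =
     loadings {..<m} (regular m s) c a b * loadings {..<n} (regular n t) c a b"
proof -
  let ?U = "{..<m}" and ?V = "{..<n}" and ?R = "regular m s" and ?C = "regular n t"
  have ind: "(\<Sum>A\<in>tables m s n t. of_bool (load x y z = A)) =
     (of_bool (load (map fst x) (map fst y) (map fst z) = ?R) *
     of_bool (load (map snd x) (map snd y) (map snd z) = ?C) :: real)" for x y z
  proof -
    have "(\<Sum>A\<in>tables m s n t. of_bool (load x y z = A) :: real) =
        (\<Sum>A\<in>tables m s n t. if A = load x y z then 1 else 0)"
      by (intro sum.cong) auto
    thus ?thesis by (simp add: tables_def image_load sum.delta[OF finite_tables[unfolded tables_def]])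
  qed
  have "(\<Sum>A\<in>tables m s n t. loadings (?U \<times> ?V) A c a b) =
     (\<Sum>x\<in>words (?U \<times> ?V) c. \<Sum>y\<in>words (?U \<times> ?V) a. \<Sum>z\<in>words (?U \<times> ?V) b.
       \<Sum>A\<in>tables m s n t. of_bool (load x y z = A))"
    unfolding loadings_def load_sum_def mult_1_right
    by (simp only: sum.swap[of _ _ "tables m s n t"])
  also have "\<dots> = (\<Sum>x\<in>words (?U \<times> ?V) c. \<Sum>y\<in>words (?U \<times> ?V) a. \<Sum>z\<in>words (?U \<times> ?V) b.
     of_bool (load (map fst x) (map fst y) (map fst z) = ?R) *
     of_bool (load (map snd x) (map snd y) (map snd z) = ?C))"
    by (simp only: ind)
  also have "\<dots> = (\<Sum>x\<in>words (?U \<times> ?V) c. \<Sum>y\<in>words (?U \<times> ?V) a. \<Sum>z1\<in>words ?U b. \<Sum>z2\<in>words ?V b.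
     of_bool (load (map fst x) (map fst y) z1 = ?R) * of_bool (load (map snd x) (map snd y) z2 = ?C))"
    by (intro sum.cong refl)
       (rule sum_words_product[where f = "\<lambda>z1 z2. of_bool (load (map fst _) (map fst _) z1 = ?R) *
          of_bool (load (map snd _) (map snd _) z2 = ?C)"], simp_all)
  also have "\<dots> = (\<Sum>x\<in>words (?U \<times> ?V) c. \<Sum>y1\<in>words ?U a. \<Sum>y2\<in>words ?V a. \<Sum>z1\<in>words ?U b. \<Sum>z2\<in>words ?V b.
     of_bool (load (map fst x) y1 z1 = ?R) * of_bool (load (map snd x) y2 z2 = ?C))"
    by (intro sum.cong refl)
       (rule sum_words_product[where f = "\<lambda>y1 y2. \<Sum>z1\<in>words ?U b. \<Sum>z2\<in>words ?V b.
          of_bool (load (map fst _) y1 z1 = ?R) * of_bool (load (map snd _) y2 z2 = ?C)"], simp_all)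
  also have "\<dots> = (\<Sum>x1\<in>words ?U c. \<Sum>x2\<in>words ?V c. \<Sum>y1\<in>words ?U a. \<Sum>y2\<in>words ?V a.
      \<Sum>z1\<in>words ?U b. \<Sum>z2\<in>words ?V b. of_bool (load x1 y1 z1 = ?R) * of_bool (load x2 y2 z2 = ?C))"
    by (rule sum_words_product[where f = "\<lambda>x1 x2. \<Sum>y1\<in>words ?U a. \<Sum>y2\<in>words ?V a.
          \<Sum>z1\<in>words ?U b. \<Sum>z2\<in>words ?V b.
          of_bool (load x1 y1 z1 = ?R) * of_bool (load x2 y2 z2 = ?C)"]) simp_all
  also have "\<dots> = (\<Sum>x1\<in>words ?U c. \<Sum>x2\<in>words ?V c. \<Sum>y1\<in>words ?U a. \<Sum>y2\<in>words ?V a.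
      (\<Sum>z1\<in>words ?U b. of_bool (load x1 y1 z1 = ?R)) * (\<Sum>z2\<in>words ?V b. of_bool (load x2 y2 z2 = ?C)))"
    by (simp only: sum_product)
  also have "\<dots> = (\<Sum>x1\<in>words ?U c. \<Sum>x2\<in>words ?V c.
      (\<Sum>y1\<in>words ?U a. \<Sum>z1\<in>words ?U b. of_bool (load x1 y1 z1 = ?R)) *
      (\<Sum>y2\<in>words ?V a. \<Sum>z2\<in>words ?V b. of_bool (load x2 y2 z2 = ?C)))"
    by (simp only: sum_product)
  also have "\<dots> = loadings ?U ?R c a b * loadings ?V ?C c a b"
    unfolding loadings_def load_sum_def mult_1_right by (simp only: sum_product)
  finally show ?thesis .
qed

lemma sum_tables_short_cycle_weight:
  "(\<Sum>A\<in>tables m s n t. short_cycle_weight ({..<m} \<times> {..<n}) A) =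
     (\<Sum>(c, a, b)\<in>cycle_types (s * m).
        loadings {..<m} (regular m s) c a b * loadings {..<n} (regular n t) c a b * cycle_weight c a b)"
proof -
  have "(\<Sum>A\<in>tables m s n t. short_cycle_weight ({..<m} \<times> {..<n}) A) =
     (\<Sum>A\<in>tables m s n t. \<Sum>p\<in>cycle_types (s * m).
        loadings ({..<m} \<times> {..<n}) A (fst p) (fst (snd p)) (snd (snd p))
          * cycle_weight (fst p) (fst (snd p)) (snd (snd p)))"
    by (intro sum.cong refl) (simp add: short_cycle_weight_def size_table split_def)
  also have "\<dots> = (\<Sum>p\<in>cycle_types (s * m).
     loadings {..<m} (regular m s) (fst p) (fst (snd p)) (snd (snd p)) *
     loadings {..<n} (regular n t) (fst p) (fst (snd p)) (snd (snd p))
          * cycle_weight (fst p) (fst (snd p)) (snd (snd p)))"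
    by (subst sum.swap) (simp add: sum_distrib_right[symmetric] sum_tables_loadings)
  finally show ?thesis by (simp add: split_def)
qed

lemma count_image_fst:
  assumes "finite V" "set_mset B \<subseteq> U \<times> V"
  shows "count (image_mset fst B) i = (\<Sum>j\<in>V. count B (i, j))"
proof -
  have "count (image_mset fst B) i = (\<Sum>q\<in>fst -` {i} \<inter> set_mset B. count B q)"
    by (rule count_image_mset)
  also have "\<dots> = (\<Sum>q\<in>Pair i ` V. count B q)"
    using assms by (intro sum.mono_neutral_left) (auto simp: not_in_iff)
  also have "\<dots> = (\<Sum>j\<in>V. count B (i, j))"
    by (subst sum.reindex) (auto simp: inj_on_def)
  finally show ?thesis .
qed

lemma count_image_snd:
  assumes "finite U" "set_mset B \<subseteq> U \<times> V"
  shows "count (image_mset snd B) j = (\<Sum>i\<in>U. count B (i, j))"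
proof -
  have "count (image_mset snd B) j = (\<Sum>q\<in>snd -` {j} \<inter> set_mset B. count B q)"
    by (rule count_image_mset)
  also have "\<dots> = (\<Sum>q\<in>(\<lambda>i. (i, j)) ` U. count B q)"
    using assms by (intro sum.mono_neutral_left) (auto simp: not_in_iff)
  also have "\<dots> = (\<Sum>i\<in>U. count B (i, j))"
    by (subst sum.reindex) (auto simp: inj_on_def)
  finally show ?thesis .
qed

lemma table_row_sum: "B \<in> tables m s n t \<Longrightarrow> i < m \<Longrightarrow> (\<Sum>j<n. count B (i, j)) = s"
  using count_image_fst[of "{..<n}" B "{..<m}" i] set_table[of B m s n t]
  by (simp add: tables_def)

lemma table_col_sum: "B \<in> tables m s n t \<Longrightarrow> j < n \<Longrightarrow> (\<Sum>i<m. count B (i, j)) = t"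
  using count_image_snd[of "{..<m}" B "{..<n}" j] set_table[of B m s n t]
  by (simp add: tables_def)

lemma table_intro:
  assumes B: "set_mset B \<subseteq> {..<m} \<times> {..<n}"
    and r: "\<And>i. i < m \<Longrightarrow> (\<Sum>j<n. count B (i, j)) = s"
    and c: "\<And>j. j < n \<Longrightarrow> (\<Sum>i<m. count B (i, j)) = t"
  shows "B \<in> tables m s n t"
proof -
  have "count (image_mset fst B) i = count (regular m s) i" for i
  proof (cases "i < m")
    case True
    thus ?thesis using count_image_fst[OF _ B, of i] r by simp
  next
    case False
    hence "count B (i, j) = 0" for j using B by (auto simp: count_eq_zero_iff)
    thus ?thesis using count_image_fst[OF _ B, of i] False by simp
  qed
  moreover have "count (image_mset snd B) j = count (regular n t) j" for j
  proof (cases "j < n")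
    case True
    thus ?thesis using count_image_snd[OF _ B, of j] c by simp
  next
    case False
    hence "count B (i, j) = 0" for i using B by (auto simp: count_eq_zero_iff)
    thus ?thesis using count_image_snd[OF _ B, of j] False by simp
  qed
  ultimately show ?thesis unfolding tables_def by (auto intro: multiset_eqI)
qed

lemma M_eq_card_tables: "M m s n t = card (tables m s n t)"
proof -
  let ?g = "\<lambda>B. mat m n (count B)"
  have "bij_betw ?g (tables m s n t) (margin_matrices m s n t)"
  proof (rule bij_betwI')
    fix A B assume A: "A \<in> tables m s n t" and B: "B \<in> tables m s n t"
    show "?g A = ?g B \<longleftrightarrow> A = B"
    proof
      assume eq: "?g A = ?g B"
      show "A = B"
      proof (rule multiset_eqI)
        fix p :: "nat \<times> nat"
        obtain i j where p: "p = (i, j)" by (cases p)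
        show "count A p = count B p"
        proof (cases "i < m \<and> j < n")
          case True
          have "?g A $$ (i, j) = ?g B $$ (i, j)" using eq by simp
          thus ?thesis using True by (simp add: p)
        next
          case False
          hence "p \<notin># A" "p \<notin># B" using set_table[OF A] set_table[OF B] by (auto simp: p)
          thus ?thesis by (simp add: not_in_iff)
        qed
      qed
    qed simp
  next
    fix B assume "B \<in> tables m s n t"
    thus "?g B \<in> margin_matrices m s n t"
      by (simp add: margin_matrices_def table_row_sum table_col_sum)
  next
    fix A assume A: "A \<in> margin_matrices m s n t"
    define B where "B = (\<Sum>p\<in>{..<m} \<times> {..<n}. replicate_mset (A $$ p) p)"
    have count_B: "count B p = (if p \<in> {..<m} \<times> {..<n} then A $$ p else 0)" for p
    proof -
      have "count B p = (\<Sum>q\<in>{..<m} \<times> {..<n}. if q = p then A $$ p else 0)"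
        unfolding B_def count_sum by (intro sum.cong) auto
      thus ?thesis by simp
    qed
    have "B \<in> tables m s n t"
    proof (rule table_intro)
      show "set_mset B \<subseteq> {..<m} \<times> {..<n}"
      proof
        fix p assume "p \<in># B"
        hence "count B p \<noteq> 0" by simp
        thus "p \<in> {..<m} \<times> {..<n}" by (metis count_B)
      qed
    qed (use A in \<open>simp_all add: count_B margin_matrices_def\<close>)
    moreover have "A = ?g B"
      using A by (intro eq_matI) (auto simp: count_B margin_matrices_def)
    ultimately show "\<exists>B\<in>tables m s n t. A = ?g B" by blast
  qed
  thus ?thesis unfolding M_def by (simp add: bij_betw_same_card)
qed

section \<open>Large entries are rare\<close>

text \<open>Take one unit from each of the cells \<open>(i, j)\<close> and \<open>(i', j')\<close> and put one unit into each of
\<open>(i, j')\<close> and \<open>(i', j)\<close>.  This preserves the margins and is injective.  Afterwards both receiving cells are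
positive, and \<open>x + 1 \<le> y (x + z)\<close> for \<open>y, z \<ge> 1\<close> puts the weight into a form that can be summed over
\<open>i'\<close> and \<open>j'\<close> by means of the margins alone.\<close>

lemma switch_cell:
  fixes i j i' j' :: nat
  assumes i: "i < m" "i' < m" "i' \<noteq> i" and j: "j < n" "j' < n" "j' \<noteq> j"
  shows "(\<Sum>A\<in>{A \<in> tables m s n t. Suc v \<le> count A (i, j)}. count A (i', j')) \<le>
         (\<Sum>A\<in>{A \<in> tables m s n t. v \<le> count A (i, j)}.
            count A (i', j) * (count A (i', j') + count A (i, j')))"
proof -
  let ?T = "{A \<in> tables m s n t. Suc v \<le> count A (i, j) \<and> (i', j') \<in># A}"
  let ?T' = "{A \<in> tables m s n t. v \<le> count A (i, j)}"
  have "(\<Sum>A\<in>{A \<in> tables m s n t. Suc v \<le> count A (i, j)}. count A (i', j')) =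
        (\<Sum>A\<in>?T. count A (i', j'))"
    by (rule sum.mono_neutral_right) (auto simp: not_in_iff)
  also have "\<dots> \<le> (\<Sum>A\<in>?T'. count A (i', j) * (count A (i', j') + count A (i, j')))"
  proof (rule sum_le_included[where i = "\<lambda>A. A - {#(i, j'), (i', j)#} + {#(i, j), (i', j')#}"])
    show "\<forall>A\<in>?T. \<exists>B\<in>?T'. B - {#(i, j'), (i', j)#} + {#(i, j), (i', j')#} = A \<and>
        count A (i', j') \<le> count B (i', j) * (count B (i', j') + count B (i, j'))"
    proof
      fix A assume A: "A \<in> ?T"
      hence "(i, j) \<in># A" "(i', j') \<in># A" by (auto simp flip: count_greater_zero_iff)
      then obtain A0 where A0: "A = add_mset (i, j) (add_mset (i', j') A0)"
        using i by (metis Pair_inject insert_DiffM insert_noteq_member)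
      define B where "B = add_mset (i, j') (add_mset (i', j) A0)"
      have "B \<in> tables m s n t"
        using A by (simp add: tables_def A0 B_def add_mset_commute)
      moreover have "v \<le> count B (i, j)"
        using A i j by (auto simp: A0 B_def)
      moreover have "B - {#(i, j'), (i', j)#} + {#(i, j), (i', j')#} = A"
        by (simp add: A0 B_def)
      moreover have "count A (i', j') \<le> count B (i', j) * (count B (i', j') + count B (i, j'))"
        using i j by (simp add: A0 B_def)
      ultimately show "\<exists>B\<in>?T'. B - {#(i, j'), (i', j)#} + {#(i, j), (i', j')#} = A \<and>
        count A (i', j') \<le> count B (i', j) * (count B (i', j') + count B (i, j'))" by blast
    qed
  qed auto
  finally show ?thesis .
qed

lemma table_outside_cross:
  assumes A: "A \<in> tables m s n t" and i: "i < m" and j: "j < n"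
  shows "s * m \<le> s + t + (\<Sum>i'\<in>{..<m} - {i}. \<Sum>j'\<in>{..<n} - {j}. count A (i', j'))"
proof -
  have "s * m = (\<Sum>i'<m. \<Sum>j'<n. count A (i', j'))"
    using table_row_sum[OF A] by simp
  also have "\<dots> = (\<Sum>j'<n. count A (i, j')) + (\<Sum>i'\<in>{..<m} - {i}. \<Sum>j'<n. count A (i', j'))"
    using i by (subst sum.remove[of _ i]) auto
  also have "(\<Sum>i'\<in>{..<m} - {i}. \<Sum>j'<n. count A (i', j')) =
      (\<Sum>i'\<in>{..<m} - {i}. count A (i', j)) + (\<Sum>i'\<in>{..<m} - {i}. \<Sum>j'\<in>{..<n} - {j}. count A (i', j'))"
    using j by (subst sum.remove[of "{..<n}" j]) (auto simp: sum.distrib)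
  also have "(\<Sum>i'\<in>{..<m} - {i}. count A (i', j)) \<le> (\<Sum>i'<m. count A (i', j))"
    by (intro sum_mono2) auto
  finally show ?thesis
    using table_row_sum[OF A i] table_col_sum[OF A j] by simp
qed

text \<open>On the left almost all units of the matrix are available as the second unit of a switching, as only
those in row \<open>i\<close> and column \<open>j\<close> are excluded; on the right the margins bound the number of ways to
reverse it.\<close>

lemma switch_entry:
  fixes m s n t :: nat
  assumes i: "i < m" and j: "j < n"
  defines "N \<equiv> \<lambda>v. card {A \<in> tables m s n t. v \<le> count A (i, j)}"
  shows "s * m * N (Suc v) \<le> (s + t) * N (Suc v) + 2 * s * t * N v"
proof -
  let ?T = "\<lambda>v. {A \<in> tables m s n t. v \<le> count A (i, j)}"
  let ?I = "{..<m} - {i}" and ?J = "{..<n} - {j}"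
  have "s * m * N (Suc v) = (\<Sum>A\<in>?T (Suc v). s * m)" by (simp add: N_def)
  also have "\<dots> \<le> (\<Sum>A\<in>?T (Suc v). s + t + (\<Sum>i'\<in>?I. \<Sum>j'\<in>?J. count A (i', j')))"
    using i j by (intro sum_mono) (auto intro: table_outside_cross)
  also have "\<dots> = (s + t) * N (Suc v) + (\<Sum>i'\<in>?I. \<Sum>j'\<in>?J. \<Sum>A\<in>?T (Suc v). count A (i', j'))"
    by (simp add: sum.distrib N_def sum.swap[of _ _ "?T (Suc v)"])
  also have "(\<Sum>i'\<in>?I. \<Sum>j'\<in>?J. \<Sum>A\<in>?T (Suc v). count A (i', j')) \<le>
      (\<Sum>i'\<in>?I. \<Sum>j'\<in>?J. \<Sum>A\<in>?T v. count A (i', j) * (count A (i', j') + count A (i, j')))"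
    using i j by (intro sum_mono switch_cell) auto
  also have "\<dots> \<le> (\<Sum>i'<m. \<Sum>j'<n. \<Sum>A\<in>?T v. count A (i', j) * (count A (i', j') + count A (i, j')))"
    by (intro order_trans[OF sum_mono sum_mono2] sum_mono2) auto
  also have "\<dots> = (\<Sum>A\<in>?T v. \<Sum>i'<m. \<Sum>j'<n. count A (i', j) * (count A (i', j') + count A (i, j')))"
    by (simp only: sum.swap[of _ "?T v"])
  also have "\<dots> = (\<Sum>A\<in>?T v. 2 * s * t)"
  proof (intro sum.cong refl)
    fix A assume "A \<in> ?T v"
    hence A: "A \<in> tables m s n t" by simp
    have "(\<Sum>i'<m. \<Sum>j'<n. count A (i', j) * (count A (i', j') + count A (i, j'))) =
        (\<Sum>i'<m. count A (i', j) * (2 * s))"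
      using table_row_sum[OF A] i
      by (intro sum.cong refl) (simp add: sum_distrib_left[symmetric] sum.distrib)
    also have "\<dots> = 2 * s * t"
      using table_col_sum[OF A j] by (simp add: sum_distrib_right[symmetric])
    finally show "(\<Sum>i'<m. \<Sum>j'<n. count A (i', j) * (count A (i', j') + count A (i, j'))) = 2 * s * t" .
  qed
  also have "\<dots> = 2 * s * t * N v" by (simp add: N_def)
  finally show ?thesis by simp
qed

lemma large_entry_tables_le:
  assumes i: "i < m" and j: "j < n" and small: "2 * (s + t) \<le> s * m" and pos: "1 \<le> s * m"
  shows "real (card {A \<in> tables m s n t. k \<le> count A (i, j)}) \<le>
           (4 * real s * real t / real (s * m)) ^ k * real (card (tables m s n t))"
proof (induction k)
  case (Suc k)
  define N where "N v = real (card {A \<in> tables m s n t. v \<le> count A (i, j)})" for v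
  define S where "S = real (s * m)"
  have S: "0 < S" unfolding S_def using pos by linarith
  have "real (s * m * card {A \<in> tables m s n t. Suc k \<le> count A (i, j)}) \<le>
        real ((s + t) * card {A \<in> tables m s n t. Suc k \<le> count A (i, j)}
         + 2 * s * t * card {A \<in> tables m s n t. k \<le> count A (i, j)})"
    using switch_entry[OF i j, of s t k] by (simp only: of_nat_le_iff)
  hence 1: "S * N (Suc k) \<le> (real s + real t) * N (Suc k) + 2 * real s * real t * N k"
    by (simp add: N_def S_def)
  have "real (2 * (s + t)) \<le> real (s * m)" using small by (simp only: of_nat_le_iff)
  hence "real s + real t \<le> S / 2" by (simp add: S_def)
  hence "(real s + real t) * N (Suc k) \<le> S / 2 * N (Suc k)"
    by (rule mult_right_mono) (simp add: N_def)
  with 1 have "S * N (Suc k) \<le> 4 * real s * real t * N k" by linarith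
  hence "N (Suc k) \<le> 4 * real s * real t / S * N k"
    using S by (simp add: field_simps)
  also have "\<dots> \<le> 4 * real s * real t / S * ((4 * real s * real t / S) ^ k * real (card (tables m s n t)))"
    using Suc S by (intro mult_left_mono) (auto simp: N_def S_def)
  finally show ?case by (simp add: N_def S_def mult_ac)
qed simp

lemma tables_small_entries_ge:
  assumes S: "s * m = S" "t * n = S" "1 \<le> S" and small: "2 * (s + t) \<le> S"
  shows "(1 - 256 * (real s ^ 3 * real t ^ 3 / real S ^ 2)) * real (card (tables m s n t)) \<le>
           real (card {A \<in> tables m s n t. \<forall>p. count A p \<le> 3})"
proof -
  let ?T = "tables m s n t" and ?q = "4 * real s * real t / real S"
  let ?B = "\<Union>p\<in>{..<m} \<times> {..<n}. {A \<in> ?T. 4 \<le> count A p}"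
  have "?T \<subseteq> {A \<in> ?T. \<forall>p. count A p \<le> 3} \<union> ?B"
  proof
    fix A assume A: "A \<in> ?T"
    show "A \<in> {A \<in> ?T. \<forall>p. count A p \<le> 3} \<union> ?B"
    proof (cases "\<forall>p. count A p \<le> 3")
      case False
      then obtain p where "\<not> count A p \<le> 3" by blast
      hence p: "4 \<le> count A p" by simp
      hence "p \<in># A" by (simp flip: count_greater_zero_iff)
      thus ?thesis using set_table[OF A] A p by blast
    qed (use A in simp)
  qed
  hence "card ?T \<le> card ({A \<in> ?T. \<forall>p. count A p \<le> 3} \<union> ?B)"
    by (intro card_mono) auto
  also have "\<dots> \<le> card {A \<in> ?T. \<forall>p. count A p \<le> 3} + card ?B" by (rule card_Un_le)
  also have "card ?B \<le> (\<Sum>p\<in>{..<m} \<times> {..<n}. card {A \<in> ?T. 4 \<le> count A p})"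
    by (rule card_UN_le) simp
  finally have "real (card ?T) \<le> real (card {A \<in> ?T. \<forall>p. count A p \<le> 3}) +
      (\<Sum>p\<in>{..<m} \<times> {..<n}. real (card {A \<in> ?T. 4 \<le> count A p}))"
    by (simp flip: of_nat_sum of_nat_add del: of_nat_le_iff add: of_nat_le_iff)
  also have "(\<Sum>p\<in>{..<m} \<times> {..<n}. real (card {A \<in> ?T. 4 \<le> count A p})) \<le>
      (\<Sum>p\<in>{..<m} \<times> {..<n}. ?q ^ 4 * real (card ?T))"
  proof (rule sum_mono)
    fix p assume "p \<in> {..<m} \<times> {..<n}"
    thus "real (card {A \<in> ?T. 4 \<le> count A p}) \<le> ?q ^ 4 * real (card ?T)"
      using large_entry_tables_le[of "fst p" m "snd p" n s t 4] S small by (auto simp: mult.commute)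
  qed
  also have "\<dots> = (real m * real n * ?q ^ 4) * real (card ?T)" by simp
  also have "real m * real n * ?q ^ 4 = 256 * (real s ^ 3 * real t ^ 3 / real S ^ 2)"
  proof -
    have s: "real s * real m = real S" "real t * real n = real S"
      using S by (metis of_nat_mult)+
    have "real m * real n * ?q ^ 4 = (real s * real m) * (real t * real n) * (256 * (real s ^ 3 * real t ^ 3)) / real S ^ 4"
      by (simp add: power_divide power_mult_distrib eval_nat_numeral)
    also have "\<dots> = 256 * (real s ^ 3 * real t ^ 3 / real S ^ 2)"
      unfolding s using S by (simp add: eval_nat_numeral)
    finally show ?thesis .
  qed
  finally show ?thesis by (simp add: algebra_simps)
qed

section \<open>Counting words with equal letter totals\<close>

abbreviation reg_loadings :: "nat \<Rightarrow> nat \<Rightarrow> nat \<Rightarrow> nat \<Rightarrow> nat \<Rightarrow> real" where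
  "reg_loadings m s \<equiv> loadings {..<m} (regular m s)"

lemma word_count_sum:
  fixes m :: nat
  assumes "x \<in> words {..<m} c"
  shows "(\<Sum>e<m. real (count (mset x) e)) = real c"
proof -
  have "(\<Sum>e<m. count (mset x) e) = size (mset x)"
    using assms by (intro sum_count_eq_size) (simp_all add: words_def)
  thus ?thesis using assms by (simp add: words_def flip: of_nat_sum)
qed

lemma load_regular_count:
  assumes "load x y z = regular m s" "e < m"
  shows "count (mset x) e + 2 * count (mset y) e + 3 * count (mset z) e = s"
  using assms by (metis (no_types, lifting) count_regular count_repeat_mset count_union load_def)

lemma falling_Suc_le:
  assumes "n \<le> s"
  shows "falling (real n) (Suc k) \<le> real n * falling (real s - 1) k"
proof (cases n)
  case (Suc l)
  have "falling (real l) k \<le> falling (real (s - 1)) k"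
    using assms Suc by (intro falling_mono) simp
  moreover have "real (s - 1) = real s - 1" using assms Suc by simp
  ultimately show ?thesis using Suc by (simp add: mult_left_mono)
qed simp

text \<open>No letter occurs more than \<open>s\<close> times in the first word, and its multiplicities add up to its length.\<close>

lemma loadings_plus_regular_le:
  assumes "k = Suc l"
  shows "falling (real (c + k)) k * loadings_plus {..<m} (regular m s) c a b k \<le>
     real (c + k) * falling (real s - 1) l * reg_loadings m s (c + k) a b"
proof -
  have "falling (real (c + k)) k * loadings_plus {..<m} (regular m s) c a b k =
     load_sum {..<m} (regular m s) (c + k) a b (\<lambda>X _. \<Sum>e<m. falling (real (count X e)) k)"
    by (simp only: load_sum_falling_fst[symmetric] finite_lessThan load_sum_sum)
  also have "\<dots> \<le> load_sum {..<m} (regular m s) (c + k) a b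
       (\<lambda>_ _. real (c + k) * falling (real s - 1) l)"
  proof (rule load_sum_mono)
    fix x y z
    assume x: "x \<in> words {..<m} (c + k)" and l: "load x y z = regular m s"
    have "(\<Sum>e<m. falling (real (count (mset x) e)) k) \<le>
          (\<Sum>e<m. real (count (mset x) e) * falling (real s - 1) l)"
    proof (rule sum_mono)
      fix e assume "e \<in> {..<m}"
      hence "count (mset x) e \<le> s" using load_regular_count[OF l, of e] by simp
      thus "falling (real (count (mset x) e)) k \<le> real (count (mset x) e) * falling (real s - 1) l"
        unfolding assms by (rule falling_Suc_le)
    qed
    also have "\<dots> = real (c + k) * falling (real s - 1) l"
      by (simp only: sum_distrib_right[symmetric] word_count_sum[OF x])
    finally show "(\<Sum>e<m. falling (real (count (mset x) e)) k) \<le>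
        real (c + k) * falling (real s - 1) l" .
  qed
  finally show ?thesis by (simp add: load_sum_const)
qed

lemma falling_1: "falling r 1 = r"
  and falling_2: "falling r 2 = r * (r - 1)"
  and falling_3: "falling r 3 = r * (r - 1) * (r - 2)"
  and falling_4: "falling r 4 = r * (r - 1) * (r - 2) * (r - 3)"
  by (simp_all add: numeral_eq_Suc algebra_simps)

lemma reg_loadings_transposition_le:
  "(real c + 1) * reg_loadings m s c (Suc a) b \<le> (real s - 1) * reg_loadings m s (c + 2) a b"
proof -
  have "(real c + 2) * ((real c + 1) * reg_loadings m s c (Suc a) b) \<le>
        (real c + 2) * ((real s - 1) * reg_loadings m s (c + 2) a b)"
    using loadings_plus_regular_le[of 2 1 c m s a b]
    unfolding loadings_Suc(2)[OF finite_lessThan] falling_2 falling_1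
    by (simp add: algebra_simps)
  thus ?thesis by (rule mult_left_le_imp_le) simp
qed

lemma reg_loadings_3cycle_le:
  "(real c + 2) * (real c + 1) * reg_loadings m s c a (Suc b) \<le>
     (real s - 1) * (real s - 2) * reg_loadings m s (c + 3) a b"
proof -
  have "(real c + 3) * ((real c + 2) * (real c + 1) * reg_loadings m s c a (Suc b)) \<le>
        (real c + 3) * ((real s - 1) * (real s - 2) * reg_loadings m s (c + 3) a b)"
    using loadings_plus_regular_le[of 3 2 c m s a b]
    unfolding loadings_Suc(3)[OF finite_lessThan] falling_2 falling_3
    by (simp add: algebra_simps)
  thus ?thesis by (rule mult_left_le_imp_le) simp
qed

text \<open>Lowering \<open>x\<close> by one lowers \<open>x (x-1) (x-2)\<close> by \<open>3 (x-1) (x-2)\<close>, which is at most its value at \<open>s\<close>.\<close>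

lemma falling_3_ge_tangent:
  assumes "d \<le> s"
  shows "(real s - 3 * real d) * (real s - 1) * (real s - 2) \<le> falling (real (s - d)) 3"
  using assms
proof (induction d)
  case 0
  thus ?case by (simp add: falling_3)
next
  case (Suc d)
  define x where "x = s - Suc d"
  have s: "s = x + Suc d" using Suc.prems by (simp add: x_def)
  have "real (x * (x - 1)) \<le> real ((s - 1) * (s - 2))"
    using Suc.prems by (intro of_nat_mono mult_mono) (auto simp: x_def)
  hence "real x * (real x - 1) \<le> (real s - 1) * (real s - 2)"
    by (cases x; cases "x = 0"; cases "d = 0") (auto simp: s algebra_simps of_nat_diff)
  moreover have "(real s - 3 * real d) * (real s - 1) * (real s - 2) \<le> falling (real (Suc x)) 3"
    using Suc.IH Suc.prems by (simp add: x_def Suc_diff_Suc)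
  ultimately show ?case
    unfolding x_def[symmetric] falling_3 by (simp add: algebra_simps)
qed

text \<open>A letter that occurs \<open>x\<close> times in the first word has spent \<open>s - x\<close> units elsewhere, and these losses add
up to \<open>2 a + 3 b\<close>.  The tangent bound is linear in the losses, so only their sum enters.\<close>

lemma reg_loadings_3cycle_ge:
  "(3 * (real c + 3) - 2 * real (s * m)) * ((real s - 1) * (real s - 2)) * reg_loadings m s (c + 3) a b
     \<le> (real c + 3) * (real c + 2) * (real c + 1) * reg_loadings m s c a (Suc b)"
proof -
  let ?q = "(real s - 1) * (real s - 2)"
  have "(3 * (real c + 3) - 2 * real (s * m)) * ?q * reg_loadings m s (c + 3) a b =
        load_sum {..<m} (regular m s) (c + 3) a b (\<lambda>_ _. (3 * (real c + 3) - 2 * real (s * m)) * ?q)"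
    by (simp add: load_sum_const)
  also have "\<dots> \<le> load_sum {..<m} (regular m s) (c + 3) a b (\<lambda>X _. \<Sum>e<m. falling (real (count X e)) 3)"
  proof (rule load_sum_mono)
    fix x y z
    assume x: "x \<in> words {..<m} (c + 3)" and l: "load x y z = regular m s"
    have "(3 * (real c + 3) - 2 * real (s * m)) * ?q =
        (3 * (\<Sum>e<m. real (count (mset x) e)) - (\<Sum>e<m. 2 * real s)) * ?q"
      by (simp add: word_count_sum[OF x])
    also have "\<dots> = (\<Sum>e<m. (3 * real (count (mset x) e) - 2 * real s) * ?q)"
      by (simp only: sum_distrib_left sum_subtractf[symmetric] sum_distrib_right)
    also have "\<dots> \<le> (\<Sum>e<m. falling (real (count (mset x) e)) 3)"
    proof (rule sum_mono)
      fix e assume "e \<in> {..<m}"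
      hence "count (mset x) e \<le> s" using load_regular_count[OF l, of e] by simp
      thus "(3 * real (count (mset x) e) - 2 * real s) * ?q \<le> falling (real (count (mset x) e)) 3"
        using falling_3_ge_tangent[of "s - count (mset x) e" s]
        by (simp add: of_nat_diff mult.assoc)
    qed
    finally show "(3 * (real c + 3) - 2 * real (s * m)) * ?q \<le>
        (\<Sum>e<m. falling (real (count (mset x) e)) 3)" .
  qed
  also have "\<dots> = falling (real (c + 3)) 3 * loadings_plus {..<m} (regular m s) c a b 3"
    by (simp only: load_sum_falling_fst[symmetric] finite_lessThan load_sum_sum)
  finally show ?thesis
    unfolding loadings_Suc(3)[OF finite_lessThan] falling_3
    by (simp add: algebra_simps)
qed

text \<open>The number of ordered pairs of positions with equal letters in the second word, added up over all words.\<close>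

definition clash :: "nat \<Rightarrow> nat \<Rightarrow> nat \<Rightarrow> nat \<Rightarrow> real" where
  "clash m s c a = load_sum {..<m} (regular m s) c a 0 (\<lambda>_ Y. \<Sum>e<m. falling (real (count Y e)) 2)"

lemma clash_nonneg: "0 \<le> clash m s c a"
  unfolding clash_def load_sum_def by (intro sum_nonneg mult_nonneg_nonneg) (auto simp: falling_nonneg)

text \<open>With no third word the multiplicities \<open>x\<close> and \<open>y\<close> of a letter in the two words satisfy \<open>x = s - 2 y\<close>,
so \<open>x (x-1)\<close> is a linear function of \<open>y\<close> plus \<open>4 y (y-1)\<close>.  The linear part sums to a constant, and
only the clashes depend on the words.\<close>

lemma reg_loadings_transposition_eq:
  "(real c + 2) * (real c + 1) * reg_loadings m s c (Suc a) 0 =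
     (real (s * m) * (real s - 1) - (4 * real s - 6) * real a) * reg_loadings m s (c + 2) a 0
     + 4 * clash m s (c + 2) a"
proof -
  let ?r = "real (s * m) * (real s - 1) - (4 * real s - 6) * real a"
  have "falling (real (c + 2)) 2 * loadings_plus {..<m} (regular m s) c a 0 2 =
    load_sum {..<m} (regular m s) (c + 2) a 0 (\<lambda>X _. \<Sum>e<m. falling (real (count X e)) 2)"
    by (simp only: load_sum_falling_fst[symmetric] finite_lessThan load_sum_sum)
  also have "\<dots> = load_sum {..<m} (regular m s) (c + 2) a 0
       (\<lambda>_ Y. ?r + 4 * (\<Sum>e<m. falling (real (count Y e)) 2))"
  proof (rule load_sum_cong)
    fix x y z
    assume x: "x \<in> words {..<m} (c + 2)" and y: "y \<in> words {..<m} a" and z: "z \<in> words {..<m} 0"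
      and l: "load x y z = regular m s"
    have "(\<Sum>e<m. falling (real (count (mset x) e)) 2) =
       (\<Sum>e<m. real s * (real s - 1) - (4 * real s - 6) * real (count (mset y) e)
             + 4 * falling (real (count (mset y) e)) 2)"
    proof (rule sum.cong[OF refl])
      fix e assume "e \<in> {..<m}"
      hence "count (mset x) e + 2 * count (mset y) e = s"
        using load_regular_count[OF l, of e] z by simp
      hence *: "real (count (mset x) e) = real s - 2 * real (count (mset y) e)" by linarith
      show "falling (real (count (mset x) e)) 2 =
         real s * (real s - 1) - (4 * real s - 6) * real (count (mset y) e)
             + 4 * falling (real (count (mset y) e)) 2"
        unfolding * falling_2 by (simp add: algebra_simps)
    qed
    also have "\<dots> = ?r + 4 * (\<Sum>e<m. falling (real (count (mset y) e)) 2)"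
      by (simp add: sum.distrib sum_subtractf sum_distrib_left[symmetric] word_count_sum[OF y])
    finally show "(\<Sum>e<m. falling (real (count (mset x) e)) 2) = \<dots>" .
  qed
  also have "\<dots> = ?r * reg_loadings m s (c + 2) a 0 + 4 * clash m s (c + 2) a"
    unfolding clash_def by (simp only: load_sum_add load_sum_cmult load_sum_const)
  finally show ?thesis
    unfolding loadings_Suc(2)[OF finite_lessThan] falling_2
    by (simp add: add.commute)
qed

lemma clash_eq_0:
  assumes "a < 2"
  shows "clash m s c a = 0"
proof -
  have "clash m s c a = load_sum {..<m} (regular m s) c a 0 (\<lambda>_ _. 0)"
    unfolding clash_def
  proof (rule load_sum_cong)
    fix x y z assume "y \<in> words {..<m} a"
    hence "size (mset y) \<le> 1" using assms by (simp add: words_def)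
    hence "count (mset y) e \<le> 1" for e using count_le_size[of "mset y" e] by linarith
    hence "count (mset y) e = 0 \<or> count (mset y) e = 1" for e by (meson le_neq_implies_less less_one)
    hence "falling (real (count (mset y) e)) 2 = 0" for e
      unfolding falling_2 by (metis diff_self mult_eq_0_iff of_nat_0 of_nat_1)
    thus "(\<Sum>e<m. falling (real (count (mset y) e)) 2) = 0" by simp
  qed
  thus ?thesis by (simp add: load_sum_const)
qed

lemma clash_le_aux:
  "(real c + 3) * (real c + 2) * (real c + 1) * clash m s c (a + 2) \<le>
     (real a + 2) * (real a + 1) * ((real s - 1) * (real s - 2) * (real s - 3)) * reg_loadings m s (c + 4) a 0"
proof -
  have eq: "clash m s c (a + 2) = (real a + 2) * (real a + 1) * loadings_plus {..<m} (regular m s) c a 0 4"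
    using load_sum_falling_snd[of "{..<m}" "regular m s" c a 0]
    unfolding clash_def load_sum_sum[symmetric] falling_2 by (simp add: falling_2 algebra_simps)
  have "(real c + 4) * ((real c + 3) * (real c + 2) * (real c + 1) * loadings_plus {..<m} (regular m s) c a 0 4) \<le>
        (real c + 4) * ((real s - 1) * (real s - 2) * (real s - 3) * reg_loadings m s (c + 4) a 0)"
    using loadings_plus_regular_le[of 4 3 c m s a 0] unfolding falling_3 falling_4
    by (simp add: algebra_simps)
  hence "(real c + 3) * (real c + 2) * (real c + 1) * loadings_plus {..<m} (regular m s) c a 0 4 \<le>
         (real s - 1) * (real s - 2) * (real s - 3) * reg_loadings m s (c + 4) a 0"
    by (rule mult_left_le_imp_le) simp
  hence "((real a + 2) * (real a + 1)) * ((real c + 3) * (real c + 2) * (real c + 1) * loadings_plus {..<m} (regular m s) c a 0 4) \<le>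
     ((real a + 2) * (real a + 1)) * ((real s - 1) * (real s - 2) * (real s - 3) * reg_loadings m s (c + 4) a 0)"
    by (rule mult_left_mono) simp
  thus ?thesis unfolding eq by (simp only: mult_ac)
qed

text \<open>Two equal letters of the second word become four equal letters of the first, and undoing two letters of
the second word costs a factor of order \<open>(s / S)\<^sup>2\<close>, because the main term of
\<open>reg_loadings_transposition_eq\<close> keeps at least half of its value for \<open>8 a \<le> S\<close>.\<close>

lemma clash_le:
  assumes S: "c + 2 * a = s * m" "8 * a \<le> s * m" "1 \<le> s * m"
  shows "real (s * m) * clash m s c a \<le> 4 * real a ^ 2 * (real s - 1) * reg_loadings m s c a 0"
proof (cases "a < 2")
  case True
  have "1 \<le> s" using S by (cases s) auto
  thus ?thesis using True by (simp add: clash_eq_0 loadings_nonneg)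
next
  case False
  define S where "S = real (s * m)"
  have s1: "1 \<le> s" using assms(3) by (cases s) auto
  have Spos: "0 < S" using assms(3) unfolding S_def by linarith
  obtain k where a: "a = k + 2" using False by (metis add.commute le_add_diff_inverse not_less)
  define X where "X = reg_loadings m s (c + 4) k 0"
  define Y where "Y = reg_loadings m s (c + 2) (Suc k) 0"
  define Z where "Z = reg_loadings m s c a 0"
  define q where "q = real s - 1"
  define p where "p = (real c + 3) * (real c + 2) * (real c + 1)"
  have q: "0 \<le> q" using s1 by (simp add: q_def)
  have ppos: "0 < p" by (simp add: p_def)
  have nn: "0 \<le> X" "0 \<le> Y" "0 \<le> Z" by (simp_all add: X_def Y_def Z_def loadings_nonneg)
  have half: "S * q / 2 \<le> S * q - (4 * real s - 6) * real j" if "j \<le> a" for j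
  proof -
    have "(4 * real s - 6) * real j \<le> 4 * q * real j"
      by (intro mult_right_mono) (simp_all add: q_def)
    also have "\<dots> \<le> 4 * q * (S / 8)"
    proof (rule mult_left_mono)
      have "8 * real j \<le> S" unfolding S_def using assms(2) that by linarith
      thus "real j \<le> S / 8" by simp
    qed (simp add: q)
    finally show ?thesis by (simp add: field_simps)
  qed
  have c4: "c + 2 + 2 = c + 4" by simp
  have XY: "S * q / 2 * X \<le> (real c + 4) * (real c + 3) * Y"
  proof -
    have "S * q / 2 * X \<le> (S * q - (4 * real s - 6) * real k) * X"
      using half[of k] nn by (intro mult_right_mono) (simp_all add: a)
    also have "\<dots> \<le> (real c + 4) * (real c + 3) * Y"
      using reg_loadings_transposition_eq[of "c + 2" m s k] clash_nonneg[of m s "c + 4" k]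
      unfolding X_def Y_def S_def q_def c4 by (simp add: add_ac)
    finally show ?thesis .
  qed
  have YZ: "S * q / 2 * Y \<le> (real c + 2) * (real c + 1) * Z"
  proof -
    have "S * q / 2 * Y \<le> (S * q - (4 * real s - 6) * real (Suc k)) * Y"
      using half[of "Suc k"] nn by (intro mult_right_mono) (simp_all add: a)
    also have "\<dots> \<le> (real c + 2) * (real c + 1) * Z"
      using reg_loadings_transposition_eq[of c m s "Suc k"] clash_nonneg[of m s "c + 2" "Suc k"]
      unfolding Z_def Y_def S_def q_def a by (simp add: add_ac)
    finally show ?thesis .
  qed
  have XZ: "(S * q / 2) ^ 2 * X \<le> (real c + 4) * p * Z"
  proof -
    have "(S * q / 2) ^ 2 * X = S * q / 2 * (S * q / 2 * X)" by (simp add: power2_eq_square)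
    also have "\<dots> \<le> S * q / 2 * ((real c + 4) * (real c + 3) * Y)"
      using XY Spos q by (intro mult_left_mono) simp_all
    also have "\<dots> = (real c + 4) * (real c + 3) * (S * q / 2 * Y)" by simp
    also have "\<dots> \<le> (real c + 4) * (real c + 3) * ((real c + 2) * (real c + 1) * Z)"
      using YZ by (intro mult_left_mono) simp_all
    finally show ?thesis by (simp add: p_def mult_ac)
  qed
  have "q * (real s - 2) * (real s - 3) \<le> q ^ 3"
  proof (cases "s = 1")
    case False
    hence "2 \<le> s" using s1 by simp
    hence "(real s - 2) * (real s - 3) \<le> q * q"
      unfolding q_def by (simp add: algebra_simps)
    hence "q * ((real s - 2) * (real s - 3)) \<le> q * (q * q)" using q by (rule mult_left_mono)
    thus ?thesis by (simp add: power3_eq_cube mult_ac)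
  qed (simp add: q_def)
  hence le: "real a * (real a - 1) * (q * (real s - 2) * (real s - 3)) * X \<le> real a * (real a - 1) * q ^ 3 * X"
    using nn by (intro mult_right_mono mult_left_mono) (simp_all add: a)
  have "p * clash m s c a \<le> real a * (real a - 1) * (q * (real s - 2) * (real s - 3)) * X"
    using clash_le_aux[of c m s k] by (simp add: p_def a X_def q_def add_ac)
  also note le
  also have "real a * (real a - 1) * q ^ 3 * X \<le> real a ^ 2 * q ^ 3 * X"
    using nn q by (intro mult_right_mono) (simp_all add: power2_eq_square algebra_simps)
  finally have "p * clash m s c a \<le> real a ^ 2 * q ^ 3 * X" .
  hence "S ^ 2 * (p * clash m s c a) \<le> S ^ 2 * (real a ^ 2 * q ^ 3 * X)"
    by (rule mult_left_mono) simp
  also have "\<dots> = 4 * real a ^ 2 * q * ((S * q / 2) ^ 2 * X)"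
    by (simp add: power2_eq_square power3_eq_cube)
  also have "\<dots> \<le> 4 * real a ^ 2 * q * ((real c + 4) * p * Z)"
    using XZ q by (intro mult_left_mono) simp_all
  also have "\<dots> \<le> 4 * real a ^ 2 * q * (S * p * Z)"
  proof -
    have "real c + 4 \<le> S" unfolding S_def assms(1)[symmetric] a by simp
    thus ?thesis using q nn ppos by (intro mult_left_mono mult_right_mono) simp_all
  qed
  finally have "(S * p) * (S * clash m s c a) \<le> (S * p) * (4 * real a ^ 2 * q * Z)"
    by (simp add: power2_eq_square mult_ac)
  hence "S * clash m s c a \<le> 4 * real a ^ 2 * q * Z"
    by (rule mult_left_le_imp_le) (use Spos ppos in simp)
  thus ?thesis by (simp add: S_def q_def Z_def)
qed

text \<open>The clashes change the normalised ratio by at most \<open>16 v\<^sup>2\<close>.  Where the denominator vanishes the clashes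
vanish as well, and any value of \<open>p\<close> would do.\<close>

lemma transposition_ratio:
  assumes c: "c + 2 + 2 * a = s * m" and a: "8 * a \<le> s * m" and s: "2 \<le> s"
  defines "l \<equiv> (4 * real s - 6) / (real s - 1)" and "v \<equiv> real a / real (s * m)"
  obtains p where "1 - l * v \<le> p" "p \<le> 1 - l * v + 16 * v ^ 2"
    "(real c + 2) * (real c + 1) * reg_loadings m s c (Suc a) 0 =
       real (s * m) * (real s - 1) * p * reg_loadings m s (c + 2) a 0"
proof -
  define S where "S = real (s * m)"
  let ?K = "reg_loadings m s (c + 2) a 0" and ?k = "clash m s (c + 2) a"
  define p where "p = (if ?K = 0 then 1 - l * v else 1 - l * v + 4 * ?k / (?K * (S * (real s - 1))))"
  have sm: "1 \<le> s * m" using c by linarith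
  have S: "0 < S" using sm unfolding S_def by linarith
  have s1: "0 < real s - 1" using s by simp
  have k: "S * ?k \<le> 4 * real a ^ 2 * (real s - 1) * ?K"
    unfolding S_def by (rule clash_le) (use c a sm in simp_all)
  have K: "0 \<le> ?K" by (rule loadings_nonneg)
  have lin: "S * (real s - 1) - (4 * real s - 6) * real a = S * (real s - 1) * (1 - l * v)"
  proof -
    have l: "l * (real s - 1) = 4 * real s - 6" using s1 by (simp add: l_def)
    have v: "v * S = real a" unfolding v_def S_def[symmetric] using S by simp
    show ?thesis unfolding l[symmetric] v[symmetric] by (simp add: algebra_simps)
  qed
  show ?thesis
  proof (rule that[of p])
    show "1 - l * v \<le> p"
      using S s1 K clash_nonneg[of m s "c + 2" a] by (simp add: p_def)
    show "p \<le> 1 - l * v + 16 * v ^ 2"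
    proof (cases "?K = 0")
      case False
      hence K': "0 < ?K" using K by simp
      have vS: "v * S = real a" unfolding v_def S_def[symmetric] using S by simp
      have eq: "S * (16 * v ^ 2 * (?K * (S * (real s - 1)))) = 4 * (4 * (v * S) ^ 2 * (real s - 1) * ?K)"
        by (simp add: power2_eq_square mult_ac)
      have "S * (4 * ?k) \<le> S * (16 * v ^ 2 * (?K * (S * (real s - 1))))"
        using k unfolding eq[unfolded vS] by linarith
      hence "4 * ?k \<le> 16 * v ^ 2 * (?K * (S * (real s - 1)))"
        by (rule mult_left_le_imp_le) (rule S)
      hence "4 * ?k / (?K * (S * (real s - 1))) \<le> 16 * v ^ 2"
        using K' S s1 by (subst pos_divide_le_eq) simp_all
      thus ?thesis using False by (simp add: p_def)
    qed (simp add: p_def)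
    have "4 * ?k = S * (real s - 1) * (p - (1 - l * v)) * ?K"
    proof (cases "?K = 0")
      case True
      hence "S * ?k \<le> 0" using k by simp
      hence "?k = 0" using S clash_nonneg[of m s "c + 2" a] by (simp add: mult_le_0_iff)
      thus ?thesis using True by simp
    next
      case False
      thus ?thesis using S s1 by (simp add: p_def)
    qed
    with reg_loadings_transposition_eq[of c m s a]
    have "(real c + 2) * (real c + 1) * reg_loadings m s c (Suc a) 0 =
        S * (real s - 1) * (1 - l * v) * ?K + S * (real s - 1) * (p - (1 - l * v)) * ?K"
      unfolding S_def[symmetric] lin by simp
    also have "\<dots> = S * (real s - 1) * p * ?K" by (simp add: algebra_simps)
    finally show "(real c + 2) * (real c + 1) * reg_loadings m s c (Suc a) 0 =
       real (s * m) * (real s - 1) * p * ?K"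
      unfolding S_def .
  qed
qed

section \<open>From ratios of coefficients to the logarithm of a sum\<close>

text \<open>The mean value theorem for \<open>ln f\<close> minus the antiderivative of \<open>p + q x\<close>.\<close>

lemma ln_increment_of_log_derivative:
  fixes f f' :: "real \<Rightarrow> real"
  assumes der: "\<And>x. 0 \<le> x \<Longrightarrow> x \<le> 1 \<Longrightarrow> (f has_real_derivative f' x) (at x)"
    and pos: "\<And>x. 0 \<le> x \<Longrightarrow> x \<le> 1 \<Longrightarrow> 0 < f x"
    and bound: "\<And>x. 0 \<le> x \<Longrightarrow> x \<le> 1 \<Longrightarrow> \<bar>f' x - (p + q * x) * f x\<bar> \<le> K * f x"
  shows "\<bar>ln (f 1) - ln (f 0) - (p + q / 2)\<bar> \<le> K"
proof -
  define h where "h x = ln (f x) - (p * x + q * x ^ 2 / 2)" for x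
  define h' where "h' x = f' x / f x - (p + q * x)" for x
  have der_h: "(h has_real_derivative h' x) (at x)" if "0 \<le> x" "x \<le> 1" for x
    unfolding h_def h'_def using der[OF that] pos[OF that]
    by (auto intro!: derivative_eq_intros simp: field_simps)
  have "\<exists>z. 0 < z \<and> z < 1 \<and> h 1 - h 0 = (1 - 0) * h' z"
    by (rule MVT2) (auto intro: der_h)
  then obtain z where z: "0 < z" "z < 1" "h 1 - h 0 = h' z" by auto
  have "h' z = (f' z - (p + q * z) * f z) / f z"
    using pos[of z] z by (simp add: h'_def field_simps)
  also have "\<bar>\<dots>\<bar> \<le> K" using bound[of z] pos[of z] z by (simp add: field_simps)
  finally show ?thesis using z(3) by (simp add: h_def algebra_simps)
qed

text \<open>For \<open>w = 1\<close> this is \<open>x f' \<le> C f\<close> for the generating polynomial \<open>f\<close> of \<open>r\<close>, and for \<open>w\<close> the identity it is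
\<open>x\<^sup>2 f'' \<le> C x f'\<close>.\<close>

lemma sum_shift_coeff_le:
  fixes r :: "nat \<Rightarrow> real"
  assumes le: "\<And>a. (real a + 1) * r (Suc a) \<le> C * r a" and nn: "\<And>a. 0 \<le> r a"
    and x: "0 \<le> x" "x \<le> 1" and w: "\<And>a. 0 \<le> w a" and C: "0 \<le> C"
  shows "(\<Sum>a\<le>L. (if a = 0 then 0 else w (a - 1)) * real a * r a * x ^ a) \<le> C * (\<Sum>a\<le>L. w a * r a * x ^ a)"
proof (cases L)
  case 0
  thus ?thesis using nn w C by simp
next
  case (Suc L')
  have "(\<Sum>a\<le>L. (if a = 0 then 0 else w (a - 1)) * real a * r a * x ^ a) =
        (\<Sum>a\<le>L'. w a * ((real a + 1) * r (Suc a)) * x ^ Suc a)"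
    unfolding Suc by (subst sum.atMost_Suc_shift) (simp add: mult_ac add_ac)
  also have "\<dots> \<le> (\<Sum>a\<le>L'. w a * (C * r a) * x ^ a)"
  proof (intro sum_mono)
    fix a
    have "w a * ((real a + 1) * r (Suc a)) \<le> w a * (C * r a)" by (intro mult_left_mono le w)
    moreover have "x ^ Suc a \<le> x ^ a" using x by (intro power_decreasing) auto
    ultimately show "w a * ((real a + 1) * r (Suc a)) * x ^ Suc a \<le> w a * (C * r a) * x ^ a"
      by (rule mult_mono) (use x w nn C in auto)
  qed
  also have "\<dots> \<le> (\<Sum>a\<le>L. w a * (C * r a) * x ^ a)"
    unfolding Suc using x w nn C by (intro sum_mono2) auto
  finally show ?thesis by (simp add: sum_distrib_left mult_ac)
qed

lemma sum_derivative_shift: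
  fixes r :: "nat \<Rightarrow> real"
  assumes "r (Suc L) = 0"
  shows "(\<Sum>a\<le>L. r a * (real a * x ^ (a - 1))) = (\<Sum>a\<le>L. ((real a + 1) * r (Suc a)) * x ^ a)"
proof -
  have "(\<Sum>a\<le>L. ((real a + 1) * r (Suc a)) * x ^ a) = (\<Sum>a<Suc L. r (Suc a) * (real (Suc a) * x ^ a))"
    unfolding lessThan_Suc_atMost by (intro sum.cong refl) (simp add: mult_ac add_ac)
  also have "\<dots> = (\<Sum>a<Suc (Suc L). r a * (real a * x ^ (a - 1)))"
    by (subst sum.lessThan_Suc_shift[of _ "Suc L"]) simp
  also have "\<dots> = (\<Sum>a\<le>L. r a * (real a * x ^ (a - 1)))"
    using assms by (simp add: lessThan_Suc_atMost)
  finally show ?thesis by simp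
qed

text \<open>Let \<open>f(x) = \<Sum> r a x\<^sup>a\<close>.  The ratio hypothesis says \<open>f' = p f + g x f' + O(e (f + 3 x f' + x\<^sup>2 f''))\<close>,
and \<open>x f' \<le> C f\<close>, \<open>x\<^sup>2 f'' \<le> C\<^sup>2 f\<close> turn the error into a multiple of \<open>f\<close>.  Inserting \<open>f' = p f + O(f)\<close> on the right
yields \<open>f' = (p + g p x) f + O(f)\<close>, which integrates to \<open>p + g p / 2\<close>.\<close>

lemma ln_sum_of_ratio:
  fixes r :: "nat \<Rightarrow> real"
  assumes r0: "0 < r 0" and nn: "\<And>a. 0 \<le> r a" and fin: "\<And>a. L < a \<Longrightarrow> r a = 0"
    and le: "\<And>a. (real a + 1) * r (Suc a) \<le> C * r a"
    and ratio: "\<And>a. \<bar>(real a + 1) * r (Suc a) - (p + g * real a) * r a\<bar> \<le> e * (real a + 1) ^ 2 * r a"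
    and C: "0 \<le> C" and e: "0 \<le> e"
  shows "\<bar>ln (\<Sum>a\<le>L. r a) - ln (r 0) - (p + g * p / 2)\<bar> \<le>
           g ^ 2 * C + (1 + \<bar>g\<bar>) * (e * (1 + 3 * C + C ^ 2))"
proof -
  define f where "f x = (\<Sum>a\<le>L. r a * x ^ a)" for x
  define f' where "f' x = (\<Sum>a\<le>L. ((real a + 1) * r (Suc a)) * x ^ a)" for x
  define K where "K = g ^ 2 * C + (1 + \<bar>g\<bar>) * (e * (1 + 3 * C + C ^ 2))"
  have "\<bar>ln (f 1) - ln (f 0) - (p + g * p / 2)\<bar> \<le> K"
  proof (rule ln_increment_of_log_derivative)
    fix x :: real assume x: "0 \<le> x" "x \<le> 1"
    have shift: "(\<Sum>a\<le>L. r a * (real a * x ^ (a - 1))) = f' x"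
      unfolding f'_def by (rule sum_derivative_shift) (simp add: fin)
    show "(f has_real_derivative f' x) (at x)"
      unfolding f_def shift[symmetric]
      by (auto intro!: derivative_eq_intros sum.cong simp: mult_ac)
    have f0: "r 0 \<le> f x"
    proof -
      have "(\<Sum>a\<in>{0}. r a * x ^ a) \<le> f x"
        unfolding f_def using x nn by (intro sum_mono2) auto
      thus ?thesis by simp
    qed
    thus fpos: "0 < f x" using r0 by simp
    have "f' x \<le> C * f x"
    proof -
      have "f' x \<le> (\<Sum>a\<le>L. (C * r a) * x ^ a)"
        unfolding f'_def using x by (intro sum_mono mult_right_mono le) auto
      thus ?thesis by (simp add: f_def sum_distrib_left mult_ac)
    qed
    have f'0: "0 \<le> f' x" unfolding f'_def using x nn by (intro sum_nonneg mult_nonneg_nonneg) auto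
    have m1: "(\<Sum>a\<le>L. real a * r a * x ^ a) = x * f' x"
    proof -
      have "x * f' x = (\<Sum>a\<le>L. r a * (real a * (x * x ^ (a - 1))))"
        unfolding shift[symmetric] by (simp add: sum_distrib_left mult_ac)
      also have "\<dots> = (\<Sum>a\<le>L. real a * r a * x ^ a)"
      proof (intro sum.cong refl)
        fix a show "r a * (real a * (x * x ^ (a - 1))) = real a * r a * x ^ a" by (cases a) auto
      qed
      finally show ?thesis by simp
    qed
    have m1_le: "(\<Sum>a\<le>L. real a * r a * x ^ a) \<le> C * f x"
      unfolding m1 using mult_right_mono[of x 1 "f' x"] x f'0 \<open>f' x \<le> C * f x\<close> by simp
    have m2_le: "(\<Sum>a\<le>L. real a * (real a - 1) * r a * x ^ a) \<le> C ^ 2 * f x"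
    proof -
      have "(\<Sum>a\<le>L. real a * (real a - 1) * r a * x ^ a) =
            (\<Sum>a\<le>L. (if a = 0 then 0 else real (a - 1)) * real a * r a * x ^ a)"
        by (intro sum.cong refl) (auto simp: of_nat_diff)
      also have "\<dots> \<le> C * (\<Sum>a\<le>L. real a * r a * x ^ a)"
        by (rule sum_shift_coeff_le[OF le nn x _ C]) simp
      also have "\<dots> \<le> C * (C * f x)" using m1_le C by (rule mult_left_mono)
      finally show ?thesis by (simp add: power2_eq_square mult_ac)
    qed
    have error_scale: "\<bar>f' x - p * f x - g * (x * f' x)\<bar> \<le> e * (1 + 3 * C + C ^ 2) * f x"
    proof -
      have "f' x - p * f x - g * (x * f' x) =
         (\<Sum>a\<le>L. ((real a + 1) * r (Suc a) - (p + g * real a) * r a) * x ^ a)"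
        unfolding m1[symmetric] unfolding f'_def f_def
        by (simp add: sum_distrib_left sum_subtractf sum.distrib algebra_simps)
      also have "\<bar>\<dots>\<bar> \<le> (\<Sum>a\<le>L. \<bar>((real a + 1) * r (Suc a) - (p + g * real a) * r a) * x ^ a\<bar>)"
        by (rule sum_abs)
      also have "\<dots> \<le> (\<Sum>a\<le>L. (e * (real a + 1) ^ 2 * r a) * x ^ a)"
        unfolding abs_mult using ratio x nn e by (intro sum_mono mult_mono) auto
      also have "\<dots> = (\<Sum>a\<le>L. e * (real a * (real a - 1) * r a * x ^ a
           + 3 * (real a * r a * x ^ a) + r a * x ^ a))"
        by (intro sum.cong refl) (simp add: power2_eq_square algebra_simps)
      also have "\<dots> = e * ((\<Sum>a\<le>L. real a * (real a - 1) * r a * x ^ a)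
           + 3 * (\<Sum>a\<le>L. real a * r a * x ^ a) + f x)"
        by (simp only: sum_distrib_left[symmetric] sum.distrib f_def)
      also have "\<dots> \<le> e * (C ^ 2 * f x + 3 * (C * f x) + f x)"
        using m1_le m2_le e by (intro mult_left_mono add_mono) auto
      finally show ?thesis by (simp add: algebra_simps)
    qed
    define E where "E = e * (1 + 3 * C + C ^ 2)"
    have E: "0 \<le> E" using e C by (simp add: E_def)
    have coarse: "\<bar>f' x - p * f x\<bar> \<le> (\<bar>g\<bar> * C + E) * f x"
    proof -
      have "\<bar>g * (x * f' x)\<bar> \<le> \<bar>g\<bar> * (C * f x)"
        unfolding abs_mult[of g] using m1 m1_le f'0 x by (intro mult_left_mono) auto
      thus ?thesis using error_scale unfolding E_def[symmetric] by (simp add: algebra_simps abs_le_iff)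
    qed
    have "f' x - (p + g * p * x) * f x =
        (f' x - p * f x - g * (x * f' x)) + (g * x) * (f' x - p * f x)"
      by (simp add: algebra_simps)
    also have "\<bar>\<dots>\<bar> \<le> \<bar>f' x - p * f x - g * (x * f' x)\<bar> + \<bar>g * x\<bar> * \<bar>f' x - p * f x\<bar>"
      by (metis abs_mult abs_triangle_ineq)
    also have "\<dots> \<le> E * f x + \<bar>g\<bar> * ((\<bar>g\<bar> * C + E) * f x)"
    proof (rule add_mono)
      have "\<bar>g * x\<bar> \<le> \<bar>g\<bar>" using x by (simp add: abs_mult mult_left_le)
      thus "\<bar>g * x\<bar> * \<bar>f' x - p * f x\<bar> \<le> \<bar>g\<bar> * ((\<bar>g\<bar> * C + E) * f x)"
        using coarse by (intro mult_mono) auto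
    qed (use error_scale E_def in simp)
    also have "\<dots> = K * f x"
      unfolding K_def E_def[symmetric] by (simp add: algebra_simps power2_eq_square)
    finally show "\<bar>f' x - (p + g * p * x) * f x\<bar> \<le> K * f x" .
  qed
  moreover have "f 1 = (\<Sum>a\<le>L. r a)" by (simp add: f_def)
  moreover have "f 0 = r 0"
    unfolding f_def by (subst sum.mono_neutral_right[where S = "{0}"]) auto
  ultimately show ?thesis by (simp add: K_def)
qed

text \<open>The same argument in a variable that marks \<open>b\<close>, the sum over \<open>a\<close> having been carried out.  The term
\<open>a\<close> in the error costs a factor \<open>C\<close> by the ratio bound in the other direction.\<close>

lemma ln_double_sum_of_ratio:
  fixes r :: "nat \<Rightarrow> nat \<Rightarrow> real"
  assumes r0: "0 < r 0 0" and nn: "\<And>a b. 0 \<le> r a b"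
    and fin: "\<And>a b. L < a \<Longrightarrow> r a b = 0" "\<And>a b. L < b \<Longrightarrow> r a b = 0"
    and lea: "\<And>a b. (real a + 1) * r (Suc a) b \<le> C * r a b"
    and leb: "\<And>a b. (real b + 1) * r a (Suc b) \<le> C' * r a b"
    and ratio: "\<And>a b. \<bar>(real b + 1) * r a (Suc b) - p * r a b\<bar> \<le> e * (real a + real b + 1) * r a b"
    and C: "0 \<le> C" "0 \<le> C'" and e: "0 \<le> e"
  shows "\<bar>ln (\<Sum>a\<le>L. \<Sum>b\<le>L. r a b) - ln (\<Sum>a\<le>L. r a 0) - p\<bar> \<le> e * (1 + C + C')"
proof -
  define q where "q b = (\<Sum>a\<le>L. r a b)" for b
  define q1 where "q1 b = (\<Sum>a\<le>L. real a * r a b)" for b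
  define f where "f x = (\<Sum>b\<le>L. q b * x ^ b)" for x
  define f' where "f' x = (\<Sum>b\<le>L. ((real b + 1) * q (Suc b)) * x ^ b)" for x
  have qnn: "0 \<le> q b" for b unfolding q_def by (intro sum_nonneg nn)
  have q0: "0 < q 0"
  proof -
    have "(\<Sum>a\<in>{0}. r a 0) \<le> q 0" unfolding q_def using nn by (intro sum_mono2) auto
    thus ?thesis using r0 by simp
  qed
  have qfin: "q (Suc L) = 0" using fin(2) by (simp add: q_def)
  have q1_le: "q1 b \<le> C * q b" for b
  proof -
    have "q1 b = (\<Sum>a\<le>L. (if a = 0 then 0 else 1) * real a * r a b * 1 ^ a)"
      unfolding q1_def by (intro sum.cong) auto
    also have "\<dots> \<le> C * (\<Sum>a\<le>L. 1 * r a b * 1 ^ a)"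
      using sum_shift_coeff_le[of "\<lambda>a. r a b" C 1 "\<lambda>_. 1" L, OF lea nn _ _ _ C(1)] by simp
    finally show ?thesis by (simp add: q_def)
  qed
  have q_le: "(real b + 1) * q (Suc b) \<le> C' * q b" for b
    unfolding q_def sum_distrib_left using leb by (intro sum_mono) auto
  have q_ratio: "\<bar>(real b + 1) * q (Suc b) - p * q b\<bar> \<le> e * (q1 b + real b * q b + q b)" for b
  proof -
    have "(real b + 1) * q (Suc b) - p * q b = (\<Sum>a\<le>L. (real b + 1) * r a (Suc b) - p * r a b)"
      by (simp only: q_def sum_distrib_left sum_subtractf)
    also have "\<bar>\<dots>\<bar> \<le> (\<Sum>a\<le>L. \<bar>(real b + 1) * r a (Suc b) - p * r a b\<bar>)" by (rule sum_abs)
    also have "\<dots> \<le> (\<Sum>a\<le>L. e * (real a + real b + 1) * r a b)" by (intro sum_mono ratio)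
    also have "\<dots> = e * (q1 b + real b * q b + q b)"
      unfolding q1_def q_def by (simp add: sum_distrib_left sum.distrib[symmetric] algebra_simps)
    finally show ?thesis .
  qed
  have "\<bar>ln (f 1) - ln (f 0) - (p + 0 / 2)\<bar> \<le> e * (1 + C + C')"
  proof (rule ln_increment_of_log_derivative)
    fix x :: real assume x: "0 \<le> x" "x \<le> 1"
    have shift: "(\<Sum>a\<le>L. q a * (real a * x ^ (a - 1))) = f' x"
      unfolding f'_def by (rule sum_derivative_shift) (rule qfin)
    show "(f has_real_derivative f' x) (at x)"
      unfolding f_def shift[symmetric]
      by (auto intro!: derivative_eq_intros sum.cong simp: mult_ac)
    have f0: "q 0 \<le> f x"
    proof -
      have "(\<Sum>a\<in>{0}. q a * x ^ a) \<le> f x"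
        unfolding f_def using x qnn by (intro sum_mono2) auto
      thus ?thesis by simp
    qed
    thus "0 < f x" using q0 by simp
    have m1: "(\<Sum>b\<le>L. real b * q b * x ^ b) \<le> C' * f x"
    proof -
      have "(\<Sum>b\<le>L. real b * q b * x ^ b) =
         (\<Sum>b\<le>L. (if b = 0 then 0 else 1) * real b * q b * x ^ b)"
        by (intro sum.cong) auto
      also have "\<dots> \<le> C' * (\<Sum>b\<le>L. 1 * q b * x ^ b)"
        using sum_shift_coeff_le[of q C' x "\<lambda>_. 1" L, OF q_le qnn x _ C(2)] by simp
      finally show ?thesis by (simp add: f_def)
    qed
    have "f' x - (p + 0 * x) * f x = (\<Sum>b\<le>L. ((real b + 1) * q (Suc b) - p * q b) * x ^ b)"
      unfolding f'_def f_def by (simp add: sum_distrib_left sum_subtractf algebra_simps)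
    also have "\<bar>\<dots>\<bar> \<le> (\<Sum>b\<le>L. \<bar>((real b + 1) * q (Suc b) - p * q b) * x ^ b\<bar>)" by (rule sum_abs)
    also have "\<dots> \<le> (\<Sum>b\<le>L. e * (C * q b + real b * q b + q b) * x ^ b)"
      unfolding abs_mult
    proof (intro sum_mono mult_mono)
      fix b
      show "\<bar>(real b + 1) * q (Suc b) - p * q b\<bar> \<le> e * (C * q b + real b * q b + q b)"
        using q_ratio[of b] q1_le[of b] e mult_left_mono[of "q1 b + real b * q b + q b" "C * q b + real b * q b + q b" e]
        by simp
      thus "0 \<le> e * (C * q b + real b * q b + q b)" by linarith
    qed (use x in auto)
    also have "\<dots> = e * (C * f x + (\<Sum>b\<le>L. real b * q b * x ^ b) + f x)"
      unfolding f_def by (simp add: sum_distrib_left sum.distrib[symmetric] algebra_simps)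
    also have "\<dots> \<le> e * (C * f x + C' * f x + f x)"
      using m1 e by (intro mult_left_mono) auto
    finally show "\<bar>f' x - (p + 0 * x) * f x\<bar> \<le> e * (1 + C + C') * f x"
      by (simp add: algebra_simps)
  qed
  moreover have "f 1 = (\<Sum>a\<le>L. \<Sum>b\<le>L. r a b)"
    unfolding f_def q_def by (subst sum.swap) simp
  moreover have "f 0 = (\<Sum>a\<le>L. r a 0)"
    unfolding f_def by (subst sum.mono_neutral_right[where S = "{0}"]) (auto simp: q_def)
  ultimately show ?thesis by simp
qed

section \<open>Elementary estimates\<close>

lemma partial_exp_sum_le:
  fixes z :: real
  assumes "0 \<le> z"
  shows "(\<Sum>a\<le>L. z ^ a / fact a) \<le> exp z"
proof -
  have "(\<Sum>a\<le>L. z ^ a /\<^sub>R fact a) \<le> (\<Sum>a. z ^ a /\<^sub>R fact a)"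
    using assms by (intro sum_le_suminf summable_exp_generic) auto
  thus ?thesis by (simp add: exp_def divide_inverse mult.commute)
qed

lemma falling_add: "falling r (k + j) = falling r k * falling (r - real k) j"
  by (induction k arbitrary: r) (simp_all add: algebra_simps)

lemma falling_eq_binomial: "falling (real n) k = fact k * real (n choose k)"
proof (induction k arbitrary: n)
  case (Suc k)
  show ?case
  proof (cases n)
    case (Suc l)
    have "real (Suc k) * real (Suc l choose Suc k) = real (Suc l) * real (l choose k)"
      by (metis Suc_times_binomial_eq mult.commute of_nat_mult)
    hence "fact (Suc k) * real (n choose Suc k) = real n * (fact k * real (l choose k))"
      unfolding Suc fact_Suc by (simp only: of_nat_mult of_nat_fact mult_ac)
    thus ?thesis using Suc.IH[of l] by (simp add: Suc)
  qed simp
qed simp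

text \<open>Combine \<open>(n/k)\<^sup>k \<le> n choose k\<close> with \<open>k\<^sup>k / k! \<le> exp k\<close>.\<close>

lemma power_le_exp_falling:
  assumes "k \<le> n"
  shows "real n ^ k \<le> exp (real k) * falling (real n) k"
proof (cases "k = 0")
  case False
  hence k: "0 < real k" by simp
  have "real k ^ k / fact k \<le> (\<Sum>a\<le>k. real k ^ a / fact a)"
    by (rule member_le_sum) auto
  also have "\<dots> \<le> exp (real k)" by (rule partial_exp_sum_le) simp
  finally have 1: "real k ^ k \<le> exp (real k) * fact k" by (simp add: field_simps)
  have "(real n / real k) ^ k \<le> real (n choose k)"
    using binomial_ge_n_over_k_pow_k[OF assms] .
  hence "real n ^ k \<le> real k ^ k * real (n choose k)"
    using k by (simp add: power_divide field_simps)
  also have "\<dots> \<le> (exp (real k) * fact k) * real (n choose k)"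
    using 1 by (rule mult_right_mono) simp
  finally show ?thesis by (simp add: falling_eq_binomial)
qed simp

lemma power_over_fact_Suc:
  fixes z :: real
  shows "z ^ Suc a / fact (Suc a) * (real a + 1) = z * (z ^ a / fact a)"
proof -
  define k where "k = real a + 1"
  have "fact (Suc a) = k * fact a" by (simp add: fact_Suc k_def add.commute)
  moreover have "k \<noteq> 0" unfolding k_def by linarith
  ultimately show ?thesis unfolding k_def[symmetric] by simp
qed

text \<open>Here \<open>v = a / S\<close> and \<open>w = 1 / S\<close>; the factor \<open>(1 - 2 v) (1 - 2 v - w)\<close> stands for
\<open>(S - 2 a) (S - 2 a - 1) / S\<^sup>2\<close>.  Both sides agree to first order in \<open>v\<close> and \<open>w\<close>.\<close>

lemma ratio_expansion:
  fixes v w l1 l2 p1 p2 :: real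
  assumes v: "0 \<le> v" "v \<le> 1 / 8" and w: "0 \<le> w" "w \<le> 1 / 8"
    and l: "2 \<le> l1" "l1 \<le> 4" "2 \<le> l2" "l2 \<le> 4"
    and p1: "1 - l1 * v \<le> p1" "p1 \<le> 1 - l1 * v + 16 * v ^ 2"
    and p2: "1 - l2 * v \<le> p2" "p2 \<le> 1 - l2 * v + 16 * v ^ 2"
  shows "\<bar>p1 * p2 - (1 - 2 * v) * (1 - 2 * v - w) * (1 + w + (4 - l1 - l2) * v)\<bar> \<le> 80 * (v + w) ^ 2"
proof -
  define d1 d2 where "d1 = p1 - (1 - l1 * v)" and "d2 = p2 - (1 - l2 * v)"
  have d: "0 \<le> d1" "d1 \<le> 16 * v ^ 2" "0 \<le> d2" "d2 \<le> 16 * v ^ 2"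
    using p1 p2 by (simp_all add: d1_def d2_def)
  define r where "r = 4 * v ^ 2 + 2 * v * w"
  define \<beta> where "\<beta> = 4 - l1 - l2"
  have \<beta>: "\<bar>\<beta>\<bar> \<le> 4" using l by (simp add: \<beta>_def)
  have vw: "v ^ 2 \<le> (v + w) ^ 2" using v w by (intro power_mono) auto
  have lv: "\<bar>1 - l1 * v\<bar> \<le> 1" "\<bar>1 - l2 * v\<bar> \<le> 1"
    using mult_mono[of l1 4 v "1/8"] mult_mono[of l2 4 v "1/8"] v l by auto
  have "\<bar>d1 * (1 - l2 * v)\<bar> \<le> 16 * v ^ 2"
    using d lv mult_mono[of "\<bar>d1\<bar>" "16 * v ^ 2" "\<bar>1 - l2 * v\<bar>" 1] by (simp add: abs_mult)
  moreover have "\<bar>d2 * p1\<bar> \<le> 20 * v ^ 2"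
  proof -
    have "v ^ 2 \<le> (1 / 8) ^ 2" using v by (intro power_mono) auto
    hence "\<bar>p1\<bar> \<le> 5 / 4" using p1 lv by (simp add: power2_eq_square)
    thus ?thesis
      using d mult_mono[of "\<bar>d2\<bar>" "16 * v ^ 2" "\<bar>p1\<bar>" "5 / 4"] by (simp add: abs_mult)
  qed
  moreover have "\<bar>l1 * l2 * v ^ 2\<bar> \<le> 16 * v ^ 2"
    using l mult_mono[of l1 4 l2 4] by (simp add: abs_mult mult_right_mono)
  moreover have "\<bar>(4 * v + w) * (w + \<beta> * v)\<bar> \<le> 16 * (v + w) ^ 2"
  proof -
    have "\<bar>\<beta> * v\<bar> \<le> 4 * v" unfolding abs_mult using \<beta> v by (simp add: mult_right_mono)
    hence "\<beta> * v \<le> 4 * v" "- (\<beta> * v) \<le> 4 * v" by linarith+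
    hence "\<bar>w + \<beta> * v\<bar> \<le> 4 * (v + w)" using v w by (intro abs_leI) auto
    hence "\<bar>4 * v + w\<bar> * \<bar>w + \<beta> * v\<bar> \<le> (4 * (v + w)) * (4 * (v + w))"
      using v w by (intro mult_mono) auto
    thus ?thesis unfolding abs_mult by (simp add: power2_eq_square algebra_simps)
  qed
  moreover have "\<bar>r * (1 + w + \<beta> * v)\<bar> \<le> 8 * (v + w) ^ 2"
  proof -
    have "\<bar>\<beta> * v\<bar> \<le> 4 * (1 / 8)" unfolding abs_mult using \<beta> v by (intro mult_mono) auto
    hence "\<bar>1 + w + \<beta> * v\<bar> \<le> 2" using w by (simp add: abs_le_iff)
    moreover have "0 \<le> r" "r \<le> 4 * (v + w) ^ 2"
      using v w by (simp_all add: r_def power2_eq_square algebra_simps)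
    ultimately have "\<bar>r\<bar> * \<bar>1 + w + \<beta> * v\<bar> \<le> (4 * (v + w) ^ 2) * 2" by (intro mult_mono) auto
    thus ?thesis by (simp add: abs_mult)
  qed
  moreover have "p1 * p2 - (1 - 2 * v) * (1 - 2 * v - w) * (1 + w + (4 - l1 - l2) * v) =
     d1 * (1 - l2 * v) + d2 * p1 + l1 * l2 * v ^ 2 + (4 * v + w) * (w + \<beta> * v) - r * (1 + w + \<beta> * v)"
    unfolding d1_def d2_def r_def \<beta>_def by (simp add: power2_eq_square algebra_simps)
  ultimately show ?thesis using vw by linarith
qed

section \<open>The double sum and the ratios of its terms\<close>

locale margins =
  fixes m s n t S :: nat
  assumes rows: "s * m = S" and cols: "t * n = S" and S_pos: "1 \<le> S"
begin

text \<open>The contribution to the weighted total of the triples whose second word has length \<open>a\<close> and whose third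
word has length \<open>b\<close>; the length of the first word is then determined.\<close>

definition tau :: "nat \<Rightarrow> nat \<Rightarrow> real" where
  "tau a b = (if 2 * a + 3 * b \<le> S
     then reg_loadings m s (S - 2 * a - 3 * b) a b * reg_loadings n t (S - 2 * a - 3 * b) a b
            * cycle_weight (S - 2 * a - 3 * b) a b
     else 0)"

definition mu :: real where "mu = (real s - 1) * (real t - 1) / 2"

definition nu :: real where
  "nu = (real s - 1) * (real s - 2) * ((real t - 1) * (real t - 2)) / (3 * real S)"

lemma s_pos: "1 \<le> s" and t_pos: "1 \<le> t"
  using rows cols S_pos by (metis One_nat_def Suc_leI mult_0 not_gr_zero not_one_le_zero)+

lemma mu_nonneg: "0 \<le> mu"
  using s_pos t_pos by (simp add: mu_def)

lemma pred_pred_nonneg: "1 \<le> k \<Longrightarrow> 0 \<le> (real k - 1) * (real k - 2)"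
  by (cases "k = 1") (auto intro!: mult_nonneg_nonneg)

lemma nu_nonneg: "0 \<le> nu"
  unfolding nu_def using s_pos t_pos by (intro divide_nonneg_nonneg mult_nonneg_nonneg pred_pred_nonneg) auto

lemma tau_nonneg: "0 \<le> tau a b"
  by (simp add: tau_def loadings_nonneg less_imp_le[OF cycle_weight_pos])

lemma tau_eq:
  "c + 2 * a + 3 * b = S \<Longrightarrow> tau a b = reg_loadings m s c a b * reg_loadings n t c a b * cycle_weight c a b"
  by (auto simp: tau_def)

lemma cycle_weight_Suc': "cycle_weight c a b = (real c + 1) * cycle_weight (c + 1) a b"
  using cycle_weight_Suc(1)[of c a b] by (simp add: add.commute)

lemma cycle_weight_transposition: "2 * (real a + 1) * cycle_weight c (Suc a) b = (real c + 1) * (real c + 2) * cycle_weight (c + 2) a b"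
proof -
  have "2 * (real a + 1) * cycle_weight c (Suc a) b = cycle_weight c a b"
    using cycle_weight_Suc(2)[of a c b] by (simp add: add.commute)
  also have "\<dots> = (real c + 1) * (real c + 2) * cycle_weight (c + 2) a b"
    using cycle_weight_Suc'[of c a b] cycle_weight_Suc'[of "c + 1" a b] by (simp add: add_ac)
  finally show ?thesis .
qed

lemma cycle_weight_3cycle:
  "3 * (real b + 1) * cycle_weight c a (Suc b) = (real c + 1) * (real c + 2) * (real c + 3) * cycle_weight (c + 3) a b"
proof -
  have "3 * (real b + 1) * cycle_weight c a (Suc b) = cycle_weight c a b"
    using cycle_weight_Suc(3)[of b c a] by (simp add: add.commute)
  also have "\<dots> = (real c + 1) * (real c + 2) * (real c + 3) * cycle_weight (c + 3) a b"
    using cycle_weight_Suc'[of c a b] cycle_weight_Suc'[of "c + 1" a b] cycle_weight_Suc'[of "c + 2" a b]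
    by (simp add: add_ac numeral_3_eq_3)
  finally show ?thesis .
qed

lemma tau_transposition:
  assumes "c + 2 + 2 * a + 3 * b = S"
  shows "2 * ((real a + 1) * tau (Suc a) b) = (real c + 1) * (real c + 2) *
           (reg_loadings m s c (Suc a) b * reg_loadings n t c (Suc a) b) * cycle_weight (c + 2) a b"
proof -
  have "2 * ((real a + 1) * tau (Suc a) b) = (2 * (real a + 1) * cycle_weight c (Suc a) b) *
      (reg_loadings m s c (Suc a) b * reg_loadings n t c (Suc a) b)"
    using tau_eq[of c "Suc a" b] assms by simp
  thus ?thesis unfolding cycle_weight_transposition by (simp only: mult_ac)
qed

lemma tau_3cycle:
  assumes "c + 3 + 2 * a + 3 * b = S"
  shows "3 * ((real b + 1) * tau a (Suc b)) = (real c + 1) * (real c + 2) * (real c + 3) *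
           (reg_loadings m s c a (Suc b) * reg_loadings n t c a (Suc b)) * cycle_weight (c + 3) a b"
proof -
  have "3 * ((real b + 1) * tau a (Suc b)) = (3 * (real b + 1) * cycle_weight c a (Suc b)) *
      (reg_loadings m s c a (Suc b) * reg_loadings n t c a (Suc b))"
    using tau_eq[of c a "Suc b"] assms by simp
  thus ?thesis unfolding cycle_weight_3cycle by (simp only: mult_ac)
qed

lemma tau_transposition_le:
  assumes c: "c + 2 + 2 * a + 3 * b = S"
  shows "(real c + 1) * ((real a + 1) * tau (Suc a) b) \<le> (real c + 2) * (mu * tau a b)"
proof -
  let ?L = "reg_loadings m s c (Suc a) b" and ?L' = "reg_loadings n t c (Suc a) b"
  let ?K = "reg_loadings m s (c + 2) a b" and ?K' = "reg_loadings n t (c + 2) a b"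
  have "((real c + 1) * ?L) * ((real c + 1) * ?L') \<le>
        ((real s - 1) * ?K) * ((real t - 1) * ?K')"
    using s_pos by (intro mult_mono reg_loadings_transposition_le) (simp_all add: loadings_nonneg)
  hence "((real c + 2) * cycle_weight (c + 2) a b) * (((real c + 1) * ?L) * ((real c + 1) * ?L')) \<le>
        ((real c + 2) * cycle_weight (c + 2) a b) * (((real s - 1) * ?K) * ((real t - 1) * ?K'))"
    by (rule mult_left_mono) (simp add: less_imp_le[OF cycle_weight_pos])
  moreover have "2 * ((real c + 1) * ((real a + 1) * tau (Suc a) b)) =
     ((real c + 2) * cycle_weight (c + 2) a b) * (((real c + 1) * ?L) * ((real c + 1) * ?L'))"
  proof -
    have "2 * ((real c + 1) * ((real a + 1) * tau (Suc a) b)) = (real c + 1) * (2 * ((real a + 1) * tau (Suc a) b))"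
      by simp
    thus ?thesis unfolding tau_transposition[OF c] by (simp only: mult_ac)
  qed
  moreover have "2 * ((real c + 2) * (mu * tau a b)) =
     ((real c + 2) * cycle_weight (c + 2) a b) * (((real s - 1) * ?K) * ((real t - 1) * ?K'))"
    using tau_eq[of "c + 2" a b] c by (simp add: mu_def)
  ultimately show ?thesis by linarith
qed

lemma tau_3cycle_le:
  assumes c: "c + 3 + 2 * a + 3 * b = S"
  shows "(real c + 1) * (real c + 2) * ((real b + 1) * tau a (Suc b)) \<le>
           (real c + 3) * real S * (nu * tau a b)"
proof -
  let ?L = "reg_loadings m s c a (Suc b)" and ?L' = "reg_loadings n t c a (Suc b)"
  let ?K = "reg_loadings m s (c + 3) a b" and ?K' = "reg_loadings n t (c + 3) a b"
  define p where "p = (real c + 2) * (real c + 1)"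
  define qs qt where "qs = (real s - 1) * (real s - 2)" and "qt = (real t - 1) * (real t - 2)"
  have q: "0 \<le> qs" "0 \<le> qt" using s_pos t_pos by (simp_all add: qs_def qt_def pred_pred_nonneg)
  have "(p * ?L) * (p * ?L') \<le> (qs * ?K) * (qt * ?K')"
    unfolding p_def qs_def qt_def
    by (intro mult_mono reg_loadings_3cycle_le mult_nonneg_nonneg[OF q(1)[unfolded qs_def]])
       (simp_all add: loadings_nonneg)
  hence "((real c + 3) * cycle_weight (c + 3) a b) * ((p * ?L) * (p * ?L')) \<le>
        ((real c + 3) * cycle_weight (c + 3) a b) * ((qs * ?K) * (qt * ?K'))"
    by (rule mult_left_mono) (simp add: less_imp_le[OF cycle_weight_pos])
  moreover have "3 * ((real c + 1) * (real c + 2) * ((real b + 1) * tau a (Suc b))) =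
     ((real c + 3) * cycle_weight (c + 3) a b) * ((p * ?L) * (p * ?L'))"
  proof -
    have "3 * ((real c + 1) * (real c + 2) * ((real b + 1) * tau a (Suc b))) =
        p * (3 * ((real b + 1) * tau a (Suc b)))" by (simp add: p_def)
    thus ?thesis unfolding tau_3cycle[OF c] p_def by (simp only: mult_ac)
  qed
  moreover have "3 * ((real c + 3) * real S * (nu * tau a b)) =
     ((real c + 3) * cycle_weight (c + 3) a b) * ((qs * ?K) * (qt * ?K'))"
    using tau_eq[of "c + 3" a b] c S_pos by (simp add: nu_def qs_def qt_def)
  ultimately show ?thesis by linarith
qed

lemma tau_3cycle_ge:
  assumes c: "c + 3 + 2 * a + 3 * b = S" and large: "2 * real S \<le> 3 * (real c + 3)"
  shows "(3 * (real c + 3) - 2 * real S) ^ 2 * real S * (nu * tau a b) \<le>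
           (real c + 1) * (real c + 2) * (real c + 3) * ((real b + 1) * tau a (Suc b))"
proof -
  let ?L = "reg_loadings m s c a (Suc b)" and ?L' = "reg_loadings n t c a (Suc b)"
  let ?K = "reg_loadings m s (c + 3) a b" and ?K' = "reg_loadings n t (c + 3) a b"
  define p where "p = (real c + 3) * (real c + 2) * (real c + 1)"
  define d where "d = 3 * (real c + 3) - 2 * real S"
  define qs qt where "qs = (real s - 1) * (real s - 2)" and "qt = (real t - 1) * (real t - 2)"
  have q: "0 \<le> qs" "0 \<le> qt" using s_pos t_pos by (simp_all add: qs_def qt_def pred_pred_nonneg)
  have d: "0 \<le> d" using large by (simp add: d_def)
  have "(d * qs * ?K) * (d * qt * ?K') \<le> (p * ?L) * (p * ?L')"
  proof (rule mult_mono)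
    show "d * qs * ?K \<le> p * ?L"
      using reg_loadings_3cycle_ge[of c s m a b] by (simp only: rows p_def d_def qs_def)
    show "d * qt * ?K' \<le> p * ?L'"
      using reg_loadings_3cycle_ge[of c t n a b] by (simp only: cols p_def d_def qt_def)
  qed (simp_all add: p_def d q loadings_nonneg)
  hence "cycle_weight (c + 3) a b * ((d * qs * ?K) * (d * qt * ?K')) \<le> cycle_weight (c + 3) a b * ((p * ?L) * (p * ?L'))"
    by (rule mult_left_mono) (simp add: less_imp_le[OF cycle_weight_pos])
  moreover have "3 * ((real c + 1) * (real c + 2) * (real c + 3) * ((real b + 1) * tau a (Suc b))) =
     cycle_weight (c + 3) a b * ((p * ?L) * (p * ?L'))"
  proof -
    have "3 * ((real c + 1) * (real c + 2) * (real c + 3) * ((real b + 1) * tau a (Suc b))) =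
        p * (3 * ((real b + 1) * tau a (Suc b)))" by (simp add: p_def)
    thus ?thesis unfolding tau_3cycle[OF c] p_def by (simp only: mult_ac)
  qed
  moreover have "3 * (d ^ 2 * real S * (nu * tau a b)) =
     cycle_weight (c + 3) a b * ((d * qs * ?K) * (d * qt * ?K'))"
    using tau_eq[of "c + 3" a b] c S_pos by (simp add: nu_def qs_def qt_def power2_eq_square)
  ultimately show ?thesis unfolding d_def by linarith
qed

text \<open>The slope in \<open>a\<close> of the normalised ratio of neighbouring terms: 4 from the denominator
\<open>(S - 2 a) (S - 2 a - 1)\<close>, and the remainder from the row and the column count.\<close>

definition beta :: real where
  "beta = 4 - (4 * real s - 6) / (real s - 1) - (4 * real t - 6) / (real t - 1)"

definition core_term0 :: "nat \<Rightarrow> real" where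
  "core_term0 a = (if 4 * a \<le> S then tau a 0 else 0)"

text \<open>Terms outside \<open>2 a + 3 b \<le> S / 2\<close> are set to zero.  Inside that region all ratio estimates hold, and at its
boundary the missing successor is an error of relative size one, which the error bounds below already
allow since \<open>a + b\<close> is of order \<open>S\<close> there.\<close>

definition core_term :: "nat \<Rightarrow> nat \<Rightarrow> real" where
  "core_term a b = (if 4 * a + 6 * b \<le> S then tau a b else 0)"

lemma core_term_nonneg: "0 \<le> core_term a b"
  by (simp add: core_term_def tau_nonneg)

lemma core_term_0: "core_term a 0 = core_term0 a"
  by (simp add: core_term0_def core_term_def)

lemma slope_bounds:
  assumes "2 \<le> k"
  shows "2 \<le> (4 * real k - 6) / (real k - 1)" "(4 * real k - 6) / (real k - 1) \<le> 4"
  using assms by (simp_all add: field_simps)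

lemma mu_neq_0: "mu \<noteq> 0 \<Longrightarrow> 2 \<le> s \<and> 2 \<le> t"
proof -
  assume "mu \<noteq> 0"
  hence "s \<noteq> 1" "t \<noteq> 1" by (auto simp: mu_def)
  thus ?thesis using s_pos t_pos by auto
qed

lemma mu_beta_bound: "mu * \<bar>beta\<bar> \<le> mu * 4"
proof (cases "mu = 0")
  case False
  hence "2 \<le> s" "2 \<le> t" by (simp_all add: mu_neq_0)
  hence "\<bar>beta\<bar> \<le> 4" using slope_bounds[of s] slope_bounds[of t] by (simp add: beta_def)
  thus ?thesis using mu_nonneg by (rule mult_left_mono)
qed simp

text \<open>The exact ratio bound carries the factor \<open>u / (u - 1)\<close> with \<open>u = S - 2 a - 3 b\<close>, which is at most 2.\<close>

lemma core_term_transposition_le: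
  assumes S: "8 \<le> S"
  shows "(real a + 1) * core_term (Suc a) b \<le> 2 * mu * core_term a b"
proof (cases "4 * Suc a + 6 * b \<le> S")
  case True
  hence "2 * a + 3 * b + 2 \<le> S" by simp
  then obtain c where c: "c + 2 + 2 * a + 3 * b = S" by (metis add.assoc add.commute le_iff_add)
  have "(real c + 1) * ((real a + 1) * tau (Suc a) b) \<le> (real c + 2) * (mu * tau a b)"
    using c by (rule tau_transposition_le)
  also have "\<dots> \<le> (2 * (real c + 1)) * (mu * tau a b)"
    by (intro mult_right_mono mult_nonneg_nonneg mu_nonneg tau_nonneg) simp
  finally have "(real c + 1) * ((real a + 1) * tau (Suc a) b) \<le> (real c + 1) * (2 * mu * tau a b)"
    by (simp only: mult_ac)
  hence "(real a + 1) * tau (Suc a) b \<le> 2 * mu * tau a b"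
    by (rule mult_left_le_imp_le) simp
  thus ?thesis using True by (simp add: core_term_def)
qed (simp add: core_term_def tau_nonneg mu_nonneg)

lemma core_term0_ratio_small:
  assumes S: "8 \<le> S" and a: "8 * a \<le> S"
  shows "\<bar>(real a + 1) * tau (Suc a) 0 - (mu * (1 + 1 / real S) + mu * beta / real S * real a) * tau a 0\<bar>
           \<le> 320 * mu / real S ^ 2 * (real a + 1) ^ 2 * tau a 0"
proof -
  have "2 * a + 2 \<le> S" using assms by linarith
  then obtain c where c: "c + 2 + 2 * a = S" by (metis add.assoc add.commute le_iff_add)
  show ?thesis
  proof (cases "mu = 0")
    case True
    have "(real c + 1) * ((real a + 1) * tau (Suc a) 0) \<le> 0"
      using tau_transposition_le[of c a 0] c True by simp
    hence "(real a + 1) * tau (Suc a) 0 \<le> 0" by (simp add: mult_le_0_iff)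
    hence "(real a + 1) * tau (Suc a) 0 = 0" using tau_nonneg[of "Suc a" 0] by (simp add: mult_le_0_iff)
    thus ?thesis using True by simp
  next
    case False
    hence st: "2 \<le> s" "2 \<le> t" by (simp_all add: mu_neq_0)
    define v w where "v = real a / real S" and "w = 1 / real S"
    define l1 l2 where "l1 = (4 * real s - 6) / (real s - 1)" and "l2 = (4 * real t - 6) / (real t - 1)"
    have Sp: "0 < real S" using S by simp
    have vw: "0 \<le> v" "v \<le> 1 / 8" "0 \<le> w" "w \<le> 1 / 8"
      using S a by (simp_all add: v_def w_def field_simps)
    obtain p1 where p1: "1 - l1 * v \<le> p1" "p1 \<le> 1 - l1 * v + 16 * v ^ 2"
      and e1: "(real c + 2) * (real c + 1) * reg_loadings m s c (Suc a) 0 =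
                 real S * (real s - 1) * p1 * reg_loadings m s (c + 2) a 0"
      by (rule transposition_ratio[of c a s m, unfolded rows, OF c a st(1), folded v_def l1_def])
    obtain p2 where p2: "1 - l2 * v \<le> p2" "p2 \<le> 1 - l2 * v + 16 * v ^ 2"
      and e2: "(real c + 2) * (real c + 1) * reg_loadings n t c (Suc a) 0 =
                 real S * (real t - 1) * p2 * reg_loadings n t (c + 2) a 0"
      by (rule transposition_ratio[of c a t n, unfolded cols, OF c a st(2), folded v_def l2_def])
    define Q where "Q = (1 - 2 * v) * (1 - 2 * v - w)"
    define x where "x = (real a + 1) * tau (Suc a) 0"
    have cS: "real c + 2 = real S * (1 - 2 * v)" "real c + 1 = real S * (1 - 2 * v - w)"
      using c Sp by (auto simp: v_def w_def field_simps)
    hence SQ: "(real c + 2) * (real c + 1) = real S ^ 2 * Q"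
      by (simp add: Q_def power2_eq_square)
    have "2 * x * ((real c + 2) * (real c + 1)) =
       ((real c + 2) * (real c + 1) * reg_loadings m s c (Suc a) 0) *
       ((real c + 2) * (real c + 1) * reg_loadings n t c (Suc a) 0) * cycle_weight (c + 2) a 0"
      unfolding x_def using tau_transposition[of c a 0] c by (simp add: mult_ac)
    also have "\<dots> = 2 * mu * real S ^ 2 * (p1 * p2) * tau a 0"
      unfolding e1 e2 using tau_eq[of "c + 2" a 0] c by (simp add: mu_def power2_eq_square)
    finally have x: "x * Q = mu * (p1 * p2) * tau a 0"
      unfolding SQ using Sp by simp
    define y where "y = 1 + w + beta * v"
    have "\<bar>p1 * p2 - Q * y\<bar> \<le> 80 * (v + w) ^ 2"
      using ratio_expansion[OF vw _ _ _ _ p1 p2] slope_bounds[OF st(1)] slope_bounds[OF st(2)]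
      unfolding Q_def y_def beta_def l1_def l2_def by simp
    have "(x - mu * y * tau a 0) * Q = mu * tau a 0 * (p1 * p2 - Q * y)"
      using x by (simp add: algebra_simps)
    hence "\<bar>x - mu * y * tau a 0\<bar> * \<bar>Q\<bar> = mu * tau a 0 * \<bar>p1 * p2 - Q * y\<bar>"
      by (metis abs_mult abs_of_nonneg mu_nonneg mult_nonneg_nonneg tau_nonneg)
    also have "\<dots> \<le> mu * tau a 0 * (80 * (v + w) ^ 2)"
      using \<open>\<bar>p1 * p2 - Q * y\<bar> \<le> _\<close> by (intro mult_left_mono mult_nonneg_nonneg mu_nonneg tau_nonneg)
    finally have 1: "\<bar>x - mu * y * tau a 0\<bar> * \<bar>Q\<bar> \<le> mu * tau a 0 * (80 * (v + w) ^ 2)" .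
    have "(3 / 4) * (5 / 8) \<le> Q" unfolding Q_def using vw by (intro mult_mono) auto
    hence "15 / 32 \<le> \<bar>Q\<bar>" by simp
    hence "\<bar>x - mu * y * tau a 0\<bar> * (15 / 32) \<le> \<bar>x - mu * y * tau a 0\<bar> * \<bar>Q\<bar>"
      by (rule mult_left_mono) simp
    also note 1
    also have "mu * tau a 0 * (80 * (v + w) ^ 2) \<le> mu * tau a 0 * (150 * (v + w) ^ 2)"
      by (intro mult_left_mono mult_nonneg_nonneg mu_nonneg tau_nonneg mult_right_mono) simp_all
    finally have "\<bar>x - mu * y * tau a 0\<bar> \<le> 320 * (mu * tau a 0 * (v + w) ^ 2)" by (simp add: mult_ac)
    also have "(v + w) ^ 2 = (real a + 1) ^ 2 / real S ^ 2"
      by (simp add: v_def w_def add_divide_distrib[symmetric] power_divide)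
    also have "mu * y = mu * (1 + 1 / real S) + mu * beta / real S * real a"
      by (simp add: y_def v_def w_def algebra_simps)
    finally show ?thesis unfolding x_def by (simp add: mult_ac)
  qed
qed

text \<open>For \<open>8 a > S\<close> the allowed error is at least \<open>5 \<mu>\<close> times the term, while the two quantities compared are at
most \<open>2 \<mu>\<close> and \<open>3 \<mu>\<close> times the term.  An expansion is needed only for \<open>8 a \<le> S\<close>.\<close>

lemma core_term0_ratio:
  assumes S: "8 \<le> S"
  shows "\<bar>(real a + 1) * core_term0 (Suc a) - (mu * (1 + 1 / real S) + mu * beta / real S * real a) * core_term0 a\<bar>
           \<le> 320 * mu / real S ^ 2 * (real a + 1) ^ 2 * core_term0 a"
proof (cases "8 * a \<le> S")
  case True
  hence "4 * Suc a \<le> S" "4 * a \<le> S" using S by simp_all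
  thus ?thesis using core_term0_ratio_small[OF S True] by (simp add: core_term0_def)
next
  case False
  show ?thesis
  proof (cases "4 * a \<le> S")
    case True
    define x where "x = (real a + 1) * core_term0 (Suc a)"
    define y where "y = (mu * (1 + 1 / real S) + mu * beta / real S * real a) * core_term0 a"
    have nn: "0 \<le> core_term0 a" by (simp add: core_term0_def tau_nonneg)
    have Sp: "0 < real S" using S by simp
    have "0 \<le> x" by (simp add: x_def core_term0_def tau_nonneg)
    moreover have "x \<le> 2 * mu * core_term0 a"
      using core_term_transposition_le[OF S, of a 0] by (simp add: x_def core_term_0)
    moreover have "\<bar>y\<bar> \<le> 3 * mu * core_term0 a"
    proof -
      have "\<bar>mu * beta / real S * real a\<bar> = mu * \<bar>beta\<bar> * (real a / real S)"
        using mu_nonneg by (simp add: abs_mult)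
      also have "\<dots> \<le> (mu * 4) * (1 / 4)"
        by (rule mult_mono[OF mu_beta_bound]) (use True Sp mu_nonneg in \<open>simp_all add: field_simps\<close>)
      finally have "\<bar>mu * beta / real S * real a\<bar> \<le> mu" by simp
      moreover have "0 \<le> mu * (1 + 1 / real S)" "mu * (1 + 1 / real S) \<le> mu * 2"
        using mu_nonneg S by (simp_all add: mult_left_mono)
      ultimately have "\<bar>mu * (1 + 1 / real S) + mu * beta / real S * real a\<bar> \<le> 3 * mu"
        by linarith
      thus ?thesis unfolding y_def abs_mult using nn by (simp add: mult_right_mono)
    qed
    ultimately have "\<bar>x - y\<bar> \<le> 5 * mu * core_term0 a" by linarith
    also have "\<dots> \<le> 5 * mu * core_term0 a * (64 * ((real a + 1) ^ 2 / real S ^ 2))"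
    proof -
      have "S \<le> 8 * (a + 1)" using False by simp
      hence "real S \<le> real (8 * (a + 1))" by (simp only: of_nat_le_iff)
      hence "real S \<le> 8 * (real a + 1)" by simp
      hence "real S ^ 2 \<le> (8 * (real a + 1)) ^ 2" by (intro power_mono) auto
      hence "1 \<le> 64 * ((real a + 1) ^ 2 / real S ^ 2)"
        using Sp by (simp add: field_simps power2_eq_square)
      from mult_left_mono[OF this, of "5 * mu * core_term0 a"] show ?thesis using nn mu_nonneg by simp
    qed
    finally show ?thesis unfolding x_def y_def by (simp add: mult_ac)
  qed (simp add: core_term0_def)
qed

text \<open>A first order expansion suffices here, because \<open>\<nu>\<close> itself is only of order \<open>\<mu>\<^sup>2 / S\<close>.\<close>

lemma core_term_ratio:
  assumes S: "24 \<le> S"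
  shows "\<bar>(real b + 1) * core_term a (Suc b) - nu * core_term a b\<bar> \<le>
           18 * nu / real S * (real a + real b + 1) * core_term a b"
proof -
  define N where "N = real a + real b + 1"
  have Sp: "0 < real S" using S by simp
  have nn: "0 \<le> nu * core_term a b" by (simp add: nu_nonneg core_term_nonneg)
  have N: "1 \<le> N" by (simp add: N_def)
  \<comment> \<open>Outside the core, at its boundary, and inside.\<close>
  consider "S < 4 * a + 6 * b" | "4 * a + 6 * b \<le> S" "S < 4 * a + 6 * Suc b" | "4 * a + 6 * Suc b \<le> S"
    by linarith
  hence "\<bar>(real b + 1) * core_term a (Suc b) - nu * core_term a b\<bar> \<le> 18 * N / real S * (nu * core_term a b)"
  proof cases
    case 1
    thus ?thesis by (simp add: core_term_def)
  next
    case 2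
    have "S \<le> 6 * (a + b + 1)" using 2 by simp
    hence "real S \<le> real (6 * (a + b + 1))" by (simp only: of_nat_le_iff)
    hence "real S \<le> 6 * N" by (simp add: N_def)
    hence "1 \<le> 18 * N / real S" using Sp N by (simp add: field_simps)
    hence "1 * (nu * core_term a b) \<le> 18 * N / real S * (nu * core_term a b)"
      using nn by (rule mult_right_mono)
    thus ?thesis using 2 nn by (simp add: core_term_def)
  next
    case 3
    have "2 * a + 3 * b + 3 \<le> S" using 3 by simp
    then obtain c where c: "c + 3 + 2 * a + 3 * b = S" by (metis add.assoc add.commute le_iff_add)
    define x where "x = (real b + 1) * tau a (Suc b)"
    define y where "y = nu * tau a b"
    define u where "u = real c + 3"
    have y: "0 \<le> y" by (simp add: y_def nu_nonneg tau_nonneg)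
    have x: "0 \<le> x" by (simp add: x_def tau_nonneg)
    have u: "real S = u + (2 * real a + 3 * real b)" using c unfolding u_def by linarith
    have u2: "real S + 6 \<le> 2 * u" using 3 u by simp
    have u12: "12 \<le> u" using u2 S by simp
    have upper: "x - y \<le> 18 * N / real S * y"
    proof -
      have "(u - 2) * (u - 1) * x \<le> u * real S * y"
        using tau_3cycle_le[OF c] by (simp add: u_def x_def y_def algebra_simps)
      hence "(u - 2) * (u - 1) * (x - y) \<le> (u * real S - (u - 2) * (u - 1)) * y"
        by (simp add: algebra_simps)
      also have "\<dots> \<le> (3 * N * u) * y"
        using u u12 y by (intro mult_right_mono) (simp_all add: N_def algebra_simps)
      also have "\<dots> \<le> ((u - 2) * (u - 1) * (18 * N / real S)) * y"
      proof (rule mult_right_mono[OF _ y])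
        have "u * real S \<le> u * (2 * u)" using u2 u12 by (intro mult_left_mono) auto
        also have "\<dots> \<le> 6 * ((u - 2) * (u - 1))"
        proof -
          have "12 * (4 * u) \<le> u * (4 * u)" using u12 by (intro mult_right_mono) auto
          moreover have "6 * ((u - 2) * (u - 1)) - u * (2 * u) = u * (4 * u) - 18 * u + 12"
            by (simp add: algebra_simps)
          ultimately show ?thesis using u12 by linarith
        qed
        finally have "(3 * N) * (u * real S) \<le> (3 * N) * (6 * ((u - 2) * (u - 1)))"
          using N by (intro mult_left_mono) auto
        thus "3 * N * u \<le> (u - 2) * (u - 1) * (18 * N / real S)"
          using Sp by (simp add: field_simps)
      qed
      finally have "((u - 2) * (u - 1)) * (x - y) \<le> ((u - 2) * (u - 1)) * (18 * N / real S * y)"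
        by (simp only: mult_ac)
      thus ?thesis by (rule mult_left_le_imp_le) (use u12 in simp)
    qed
    have lower: "y - x \<le> 18 * N / real S * y"
    proof -
      define D where "D = 2 * real a + 3 * real b"
      have D: "0 \<le> D" "D \<le> 3 * N" by (simp_all add: D_def N_def)
      have "(1 - 6 * D / real S) * y \<le> x"
      proof (cases "2 * real S \<le> 3 * u")
        case True
        have uS: "u \<le> real S" using u by simp
        have "(3 * u - 2 * real S) ^ 2 * real S * y \<le> (u - 2) * (u - 1) * u * x"
          using tau_3cycle_ge[OF c] True by (simp add: u_def x_def y_def algebra_simps)
        also have "\<dots> \<le> real S * real S * real S * x"
          using u12 uS x by (intro mult_right_mono mult_mono mult_nonneg_nonneg) auto
        finally have "real S * ((3 * u - 2 * real S) ^ 2 * y) \<le> real S * (real S ^ 2 * x)"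
          by (simp add: power2_eq_square mult_ac)
        hence le: "(3 * u - 2 * real S) ^ 2 * y \<le> real S ^ 2 * x"
          by (rule mult_left_le_imp_le) (rule Sp)
        have "real S ^ 2 * ((1 - 6 * D / real S) * y) = (real S ^ 2 - 6 * D * real S) * y"
          using Sp by (simp add: power2_eq_square field_simps)
        also have "\<dots> \<le> (3 * u - 2 * real S) ^ 2 * y"
        proof (rule mult_right_mono[OF _ y])
          have eq: "3 * u - 2 * real S = real S - 3 * D" using u by (simp add: D_def)
          show "real S ^ 2 - 6 * D * real S \<le> (3 * u - 2 * real S) ^ 2"
            unfolding eq by (simp add: power2_eq_square algebra_simps)
        qed
        also note le
        finally show ?thesis by (rule mult_left_le_imp_le) (use Sp in simp)
      next
        case False
        hence "real S \<le> 6 * D" using u D by (simp add: D_def)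
        hence "1 - 6 * D / real S \<le> 0" using Sp by simp
        hence "(1 - 6 * D / real S) * y \<le> 0" using y by (rule mult_nonpos_nonneg)
        thus ?thesis using x by linarith
      qed
      hence "y - x \<le> 6 * D / real S * y" by (simp add: algebra_simps)
      also have "\<dots> \<le> 18 * N / real S * y"
        using D y Sp by (intro mult_right_mono divide_right_mono) auto
      finally show ?thesis .
    qed
    have "\<bar>x - y\<bar> \<le> 18 * N / real S * y" using upper lower by linarith
    thus ?thesis using 3 by (simp add: core_term_def x_def y_def)
  qed
  thus ?thesis by (simp add: N_def mult_ac)
qed

lemma core_term_3cycle_le:
  assumes S: "24 \<le> S"
  shows "(real b + 1) * core_term a (Suc b) \<le> 7 * nu * core_term a b"
proof (cases "4 * a + 6 * b \<le> S")
  case True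
  have nn: "0 \<le> nu * core_term a b" by (simp add: nu_nonneg core_term_nonneg)
  have "18 * (a + b + 1) \<le> 6 * S" using True S by simp
  hence "real (18 * (a + b + 1)) \<le> real (6 * S)" by (simp only: of_nat_le_iff)
  hence "18 * (real a + real b + 1) \<le> 6 * real S" by simp
  hence "18 * (real a + real b + 1) / real S \<le> 6" using S by (simp add: field_simps)
  hence "18 * (real a + real b + 1) / real S * (nu * core_term a b) \<le> 6 * (nu * core_term a b)"
    using nn by (rule mult_right_mono)
  moreover have "18 * nu / real S * (real a + real b + 1) * core_term a b =
      18 * (real a + real b + 1) / real S * (nu * core_term a b)" by simp
  ultimately show ?thesis using core_term_ratio[OF S, of b a] by linarith
qed (simp add: core_term_def)

section \<open>The tail of the double sum\<close>

text \<open>Multiplication by \<open>S (S-1) \<dots>\<close> removes the denominators of the ratio bounds, so that this holds up to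
the last term, where the denominators are small.\<close>

lemma tau_bound_transposition:
  "tau (Suc a) b * falling (real S) (2 * Suc a + 3 * b) * (real a + 1) \<le>
     mu * real S ^ 2 * (tau a b * falling (real S) (2 * a + 3 * b))"
proof (cases "2 * Suc a + 3 * b \<le> S")
  case True
  hence "2 * a + 3 * b + 2 \<le> S" by simp
  then obtain c where c: "c + 2 + 2 * a + 3 * b = S" by (metis add.assoc add.commute le_iff_add)
  let ?f = "falling (real S) (2 * a + 3 * b)"
  have f: "0 \<le> ?f" by (rule falling_nonneg)
  have "2 * Suc a + 3 * b = (2 * a + 3 * b) + 2" by simp
  moreover have "real S - real (2 * a + 3 * b) = real c + 2" using c by linarith
  ultimately have e: "falling (real S) (2 * Suc a + 3 * b) = ?f * ((real c + 2) * (real c + 1))"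
    by (simp only: falling_add falling_2) simp
  have "tau (Suc a) b * falling (real S) (2 * Suc a + 3 * b) * (real a + 1) =
      (?f * (real c + 2)) * ((real c + 1) * ((real a + 1) * tau (Suc a) b))"
    unfolding e by (simp only: mult_ac)
  also have "\<dots> \<le> (?f * (real c + 2)) * ((real c + 2) * (mu * tau a b))"
    using tau_transposition_le[OF c] f by (intro mult_left_mono) auto
  also have "\<dots> = (real c + 2) ^ 2 * (mu * tau a b * ?f)"
    by (simp add: power2_eq_square mult_ac)
  also have "\<dots> \<le> real S ^ 2 * (mu * tau a b * ?f)"
    using c f mu_nonneg tau_nonneg by (intro mult_right_mono power_mono mult_nonneg_nonneg) auto
  finally show ?thesis by (simp only: mult_ac)
next
  case False
  have "tau (Suc a) b = 0" using False by (simp add: tau_def)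
  thus ?thesis using mu_nonneg tau_nonneg falling_nonneg by (simp del: of_nat_Suc)
qed

lemma tau_bound_3cycle:
  "tau a (Suc b) * falling (real S) (2 * a + 3 * Suc b) * (real b + 1) \<le>
     nu * real S ^ 3 * (tau a b * falling (real S) (2 * a + 3 * b))"
proof (cases "2 * a + 3 * Suc b \<le> S")
  case True
  hence "2 * a + 3 * b + 3 \<le> S" by simp
  then obtain c where c: "c + 3 + 2 * a + 3 * b = S" by (metis add.assoc add.commute le_iff_add)
  let ?f = "falling (real S) (2 * a + 3 * b)"
  have f: "0 \<le> ?f" by (rule falling_nonneg)
  have "2 * a + 3 * Suc b = (2 * a + 3 * b) + 3" by simp
  moreover have "real S - real (2 * a + 3 * b) = real c + 3" using c by linarith
  ultimately have e: "falling (real S) (2 * a + 3 * Suc b) = ?f * ((real c + 3) * (real c + 2) * (real c + 1))"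
    by (simp only: falling_add falling_3) (simp add: add_ac)
  have "tau a (Suc b) * falling (real S) (2 * a + 3 * Suc b) * (real b + 1) =
      (?f * (real c + 3)) * ((real c + 1) * (real c + 2) * ((real b + 1) * tau a (Suc b)))"
    unfolding e by (simp only: mult_ac)
  also have "\<dots> \<le> (?f * (real c + 3)) * ((real c + 3) * real S * (nu * tau a b))"
    using tau_3cycle_le[OF c] f by (intro mult_left_mono) auto
  also have "\<dots> = (real c + 3) ^ 2 * (real S * (nu * tau a b * ?f))"
    by (simp add: power2_eq_square mult_ac)
  also have "\<dots> \<le> real S ^ 2 * (real S * (nu * tau a b * ?f))"
    using c f nu_nonneg tau_nonneg by (intro mult_right_mono power_mono mult_nonneg_nonneg) auto
  finally show ?thesis by (simp add: power2_eq_square power3_eq_cube mult_ac)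
next
  case False
  have "tau a (Suc b) = 0" using False by (simp add: tau_def)
  thus ?thesis using nu_nonneg tau_nonneg falling_nonneg by (simp del: of_nat_Suc)
qed

lemma tau_falling_le:
  "tau a b * falling (real S) (2 * a + 3 * b) \<le>
     tau 0 0 * ((mu * real S ^ 2) ^ a / fact a) * ((nu * real S ^ 3) ^ b / fact b)"
proof (induction b arbitrary: a)
  case 0
  show ?case
  proof (induction a)
    case (Suc a)
    have "tau (Suc a) 0 * falling (real S) (2 * Suc a + 3 * 0) * (real a + 1) \<le>
       mu * real S ^ 2 * (tau a 0 * falling (real S) (2 * a + 3 * 0))"
      by (rule tau_bound_transposition)
    also have "\<dots> \<le> mu * real S ^ 2 * (tau 0 0 * ((mu * real S ^ 2) ^ a / fact a) * ((nu * real S ^ 3) ^ 0 / fact 0))"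
      using Suc mu_nonneg by (intro mult_left_mono) auto
    also have "\<dots> = tau 0 0 * ((nu * real S ^ 3) ^ 0 / fact 0) * (mu * real S ^ 2 * ((mu * real S ^ 2) ^ a / fact a))"
      by (simp only: mult_ac)
    also have "\<dots> = (tau 0 0 * ((mu * real S ^ 2) ^ Suc a / fact (Suc a)) * ((nu * real S ^ 3) ^ 0 / fact 0)) * (real a + 1)"
      unfolding power_over_fact_Suc[symmetric] by (simp only: mult_ac)
    finally show ?case by (rule mult_right_le_imp_le) simp
  qed simp
next
  case (Suc b)
  have "tau a (Suc b) * falling (real S) (2 * a + 3 * Suc b) * (real b + 1) \<le>
     nu * real S ^ 3 * (tau a b * falling (real S) (2 * a + 3 * b))"
    by (rule tau_bound_3cycle)
  also have "\<dots> \<le> nu * real S ^ 3 * (tau 0 0 * ((mu * real S ^ 2) ^ a / fact a) * ((nu * real S ^ 3) ^ b / fact b))"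
    using Suc nu_nonneg by (intro mult_left_mono) auto
  also have "\<dots> = tau 0 0 * ((mu * real S ^ 2) ^ a / fact a) * (nu * real S ^ 3 * ((nu * real S ^ 3) ^ b / fact b))"
    by (simp only: mult_ac)
  also have "\<dots> = (tau 0 0 * ((mu * real S ^ 2) ^ a / fact a) * ((nu * real S ^ 3) ^ Suc b / fact (Suc b))) * (real b + 1)"
    unfolding power_over_fact_Suc[symmetric] by (simp only: mult_ac)
  finally show ?case by (rule mult_right_le_imp_le) simp
qed

text \<open>The bounds on the ratios lose only the factor \<open>S\<^sup>k / (S (S-1) \<dots>) \<le> exp k\<close>.\<close>

lemma tau_le:
  "tau a b \<le> tau 0 0 * ((exp 2 * mu) ^ a / fact a) * ((exp 3 * nu) ^ b / fact b)"
proof (cases "2 * a + 3 * b \<le> S")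
  case True
  define D where "D = 2 * a + 3 * b"
  have "tau a b * real S ^ D \<le> tau a b * (exp (real D) * falling (real S) D)"
    using True by (intro mult_left_mono power_le_exp_falling tau_nonneg) (simp add: D_def)
  also have "\<dots> = exp (real D) * (tau a b * falling (real S) D)" by simp
  also have "\<dots> \<le> exp (real D) * (tau 0 0 * ((mu * real S ^ 2) ^ a / fact a) * ((nu * real S ^ 3) ^ b / fact b))"
    unfolding D_def by (intro mult_left_mono tau_falling_le) simp
  also have "\<dots> = (tau 0 0 * ((exp 2 * mu) ^ a / fact a) * ((exp 3 * nu) ^ b / fact b)) * real S ^ D"
  proof -
    have "exp (real D) = exp 2 ^ a * exp 3 ^ b"
      by (simp add: D_def exp_add exp_of_nat_mult[symmetric] mult.commute)
    moreover have "real S ^ D = (real S ^ 2) ^ a * (real S ^ 3) ^ b"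
      by (simp add: D_def power_add power_mult)
    ultimately show ?thesis by (simp add: power_mult_distrib mult_ac)
  qed
  finally show ?thesis by (rule mult_right_le_imp_le) (use S_pos in simp)
next
  case False
  hence "tau a b = 0" by (simp add: tau_def)
  thus ?thesis using tau_nonneg[of 0 0] mu_nonneg nu_nonneg by simp
qed

definition total :: real where "total = (\<Sum>a\<le>S. \<Sum>b\<le>S. tau a b)"

definition core :: real where "core = (\<Sum>a\<le>S. \<Sum>b\<le>S. core_term a b)"

lemma core_le_total: "core \<le> total"
  unfolding core_def total_def by (intro sum_mono) (simp add: core_term_def tau_nonneg)

text \<open>Outside the core \<open>8 a + 12 b \<ge> 2 S\<close>, so each term may be multiplied by \<open>exp (8 a + 12 b - 2 S) \<ge> 1\<close>.
The resulting sum is dominated by the product of two exponential series.\<close>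

lemma total_le_core:
  assumes small: "exp 10 * mu + exp 15 * nu \<le> real S"
  shows "total \<le> core + tau 0 0 * exp (- real S)"
proof -
  have "total - core = (\<Sum>a\<le>S. \<Sum>b\<le>S. tau a b - core_term a b)"
    by (simp add: total_def core_def sum_subtractf)
  also have "\<dots> \<le> (\<Sum>a\<le>S. \<Sum>b\<le>S. (tau 0 0 * exp (- 2 * real S)) *
      (((exp 10 * mu) ^ a / fact a) * ((exp 15 * nu) ^ b / fact b)))"
  proof (intro sum_mono)
    fix a b
    let ?y = "(exp 2 * mu) ^ a / fact a * ((exp 3 * nu) ^ b / fact b)"
    have rhs: "(tau 0 0 * exp (- 2 * real S)) * (((exp 10 * mu) ^ a / fact a) * ((exp 15 * nu) ^ b / fact b))
       = tau 0 0 * exp (8 * real a + 12 * real b - 2 * real S) * ?y"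
    proof -
      have "exp (10::real) = exp 8 * exp 2" "exp (15::real) = exp 12 * exp 3"
        by (simp_all flip: exp_add)
      moreover have "exp (8 * real a + 12 * real b - 2 * real S) = exp 8 ^ a * exp 12 ^ b * exp (- 2 * real S)"
        by (simp add: exp_add exp_diff exp_minus exp_of_nat_mult[symmetric] mult.commute divide_inverse)
      ultimately show ?thesis by (simp add: power_mult_distrib mult_ac)
    qed
    have y: "0 \<le> ?y" using mu_nonneg nu_nonneg by simp
    show "tau a b - core_term a b \<le> (tau 0 0 * exp (- 2 * real S)) * (((exp 10 * mu) ^ a / fact a) * ((exp 15 * nu) ^ b / fact b))"
    proof (cases "4 * a + 6 * b \<le> S")
      case True
      have "0 \<le> tau 0 0 * exp (8 * real a + 12 * real b - 2 * real S) * ?y"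
        by (rule mult_nonneg_nonneg[OF mult_nonneg_nonneg[OF tau_nonneg exp_ge_zero] y])
      thus ?thesis unfolding rhs using True by (simp only: core_term_def if_True diff_self)
    next
      case False
      hence "2 * S \<le> 8 * a + 12 * b" by simp
      hence "real (2 * S) \<le> real (8 * a + 12 * b)" by (simp only: of_nat_le_iff)
      hence 1: "1 \<le> exp (8 * real a + 12 * real b - 2 * real S)" by simp
      have "tau a b \<le> tau 0 0 * 1 * ?y" using tau_le[of a b] by simp
      also have "\<dots> \<le> tau 0 0 * exp (8 * real a + 12 * real b - 2 * real S) * ?y"
        using 1 y tau_nonneg[of 0 0] by (intro mult_right_mono mult_left_mono) auto
      finally show ?thesis unfolding rhs using False by (simp add: core_term_def)
    qed
  qed
  also have "\<dots> = (tau 0 0 * exp (- 2 * real S)) *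
      ((\<Sum>a\<le>S. (exp 10 * mu) ^ a / fact a) * (\<Sum>b\<le>S. (exp 15 * nu) ^ b / fact b))"
    by (subst sum_product) (simp only: sum_distrib_left)
  also have "\<dots> \<le> (tau 0 0 * exp (- 2 * real S)) * (exp (exp 10 * mu) * exp (exp 15 * nu))"
    using mu_nonneg nu_nonneg tau_nonneg[of 0 0]
    by (intro mult_left_mono mult_mono partial_exp_sum_le sum_nonneg) auto
  also have "\<dots> \<le> (tau 0 0 * exp (- 2 * real S)) * exp (real S)"
    using small tau_nonneg[of 0 0] by (intro mult_left_mono) (auto simp flip: exp_add)
  also have "\<dots> = tau 0 0 * exp (- real S)"
    by (simp add: mult.assoc flip: exp_add)
  finally show ?thesis by simp
qed

lemma reg_loadings_full: "s' * m' = S \<Longrightarrow> reg_loadings m' s' S 0 0 = fact S / fact s' ^ m'"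
proof -
  assume S: "s' * m' = S"
  have "reg_loadings m' s' S 0 0 = real (card {x \<in> words {..<m'} S. mset x = regular m' s'})"
    by (simp add: loadings_def load_sum_def load_def Int_def)
  also have "{x \<in> words {..<m'} S. mset x = regular m' s'} = permutations_of_multiset (regular m' s')"
  proof -
    have "set x \<subseteq> {..<m'} \<and> length x = S" if "mset x = regular m' s'" for x
      using that set_regular[of m' s'] S by (metis set_mset_mset size_mset size_regular)
    thus ?thesis by (auto simp: words_def permutations_of_multiset_def)
  qed
  also have "real (card \<dots>) = fact S / fact s' ^ m'"
  proof -
    have "(\<Prod>x\<in>set_mset (regular m' s'). fact (count (regular m' s') x)) = (\<Prod>x<m'. fact s' :: nat)"
      by (intro prod.mono_neutral_cong_left set_regular)
         (auto dest: subsetD[OF set_regular] simp flip: count_eq_zero_iff)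
    hence p: "(\<Prod>x\<in>set_mset (regular m' s'). fact (count (regular m' s') x)) = (fact s' ^ m' :: nat)"
      by simp
    have "card (permutations_of_multiset (regular m' s')) * fact s' ^ m' = fact S"
      using card_permutations_of_multiset_aux[of "regular m' s'"] S unfolding p by simp
    hence "real (card (permutations_of_multiset (regular m' s'))) * fact s' ^ m' = fact S"
      by (metis of_nat_fact of_nat_mult of_nat_power)
    thus ?thesis by (simp add: field_simps)
  qed
  finally show ?thesis .
qed

lemma tau_0_0: "tau 0 0 = fact S / (fact s ^ m * fact t ^ n)"
  using tau_eq[of S 0 0] by (simp add: reg_loadings_full rows cols cycle_weight_def)

lemma tau_0_0_pos: "0 < tau 0 0"
  by (simp add: tau_0_0)

lemma tau_0_0_le_core: "tau 0 0 \<le> core"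
proof -
  have "tau 0 0 = (\<Sum>a\<in>{0}. \<Sum>b\<in>{0}. core_term a b)" by (simp add: core_term_def)
  also have "\<dots> \<le> (\<Sum>a\<in>{0}. \<Sum>b\<le>S. core_term a b)"
    by (intro sum_mono sum_mono2) (auto simp: core_term_nonneg)
  also have "\<dots> \<le> core"
    unfolding core_def by (intro sum_mono2) (auto simp: core_term_nonneg sum_nonneg)
  finally show ?thesis .
qed

definition exponent :: real where
  "exponent = (real s - 1) * (real t - 1) / 2 - (real s - 1) * (real t - 1)
     * (2 * real s * real t - real s - real t - 10) / (12 * real S)"

text \<open>The four contributions are the mean of the number of transpositions, its correction and that of the
number of pairs of them at order \<open>1 / S\<close>, and the mean of the number of 3-cycles.\<close>

lemma exponent_eq: "exponent = mu + mu / real S + mu ^ 2 * beta / (2 * real S) + nu"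
proof (cases "mu = 0")
  case True
  hence "s = 1 \<or> t = 1" by (auto simp: mu_def)
  thus ?thesis using True by (auto simp: exponent_def nu_def)
next
  case False
  hence st: "real s - 1 \<noteq> 0" "real t - 1 \<noteq> 0" by (auto simp: mu_def)
  define l1 l2 where "l1 = (4 * real s - 6) / (real s - 1)" and "l2 = (4 * real t - 6) / (real t - 1)"
  have l: "(real s - 1) * l1 = 4 * real s - 6" "(real t - 1) * l2 = 4 * real t - 6"
    using st by (simp_all add: l1_def l2_def)
  have "mu * beta = (4 * (real s - 1) * (real t - 1) - ((real s - 1) * l1) * (real t - 1)
      - ((real t - 1) * l2) * (real s - 1)) / 2"
    unfolding mu_def beta_def l1_def[symmetric] l2_def[symmetric] by (simp add: algebra_simps)
  hence "mu * beta = ((4 * (real s - 1) * (real t - 1)) - (4 * real s - 6) * (real t - 1)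
      - (4 * real t - 6) * (real s - 1)) / 2"
    unfolding l .
  hence h: "mu ^ 2 * beta = mu * (((4 * (real s - 1) * (real t - 1)) - (4 * real s - 6) * (real t - 1)
      - (4 * real t - 6) * (real s - 1)) / 2)"
    by (simp add: power2_eq_square mult.assoc)
  show ?thesis
    unfolding h unfolding exponent_def nu_def mu_def using S_pos by (simp add: field_simps)
qed

section \<open>Assembling the asymptotics\<close>

definition error_scale :: real where "error_scale = real s ^ 3 * real t ^ 3 / real S ^ 2"

text \<open>Summation over \<open>a\<close> and \<open>b\<close> alone, the number of remaining letters being determined.\<close>

lemma total_eq_weight: "(\<Sum>A\<in>tables m s n t. short_cycle_weight ({..<m} \<times> {..<n}) A) = total"
proof -
  have "total = (\<Sum>(a, b)\<in>{..S} \<times> {..S}. tau a b)"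
    by (simp add: total_def sum.cartesian_product)
  also have "\<dots> = (\<Sum>(a, b)\<in>{(a, b). 2 * a + 3 * b \<le> S}. tau a b)"
    by (rule sum.mono_neutral_right) (auto simp: tau_def split: if_split_asm)
  also have "\<dots> = (\<Sum>(c, a, b)\<in>cycle_types S. reg_loadings m s c a b * reg_loadings n t c a b * cycle_weight c a b)"
    by (rule sum.reindex_bij_witness[where i = "\<lambda>(c, a, b). (a, b)" and j = "\<lambda>(a, b). (S - 2 * a - 3 * b, a, b)"])
       (auto simp: cycle_types_def tau_def)
  finally show ?thesis by (simp add: sum_tables_short_cycle_weight rows)
qed

lemma total_le_M: "total \<le> real (M m s n t)"
proof -
  have "total \<le> (\<Sum>A\<in>tables m s n t. 1)"
    unfolding total_eq_weight[symmetric]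
    by (intro sum_mono short_cycle_weight_le_1) (auto dest: set_table)
  thus ?thesis by (simp add: M_eq_card_tables)
qed

lemma M_le_total:
  assumes "2 * (s + t) \<le> S"
  shows "(1 - 256 * error_scale) * real (M m s n t) \<le> total"
proof -
  have "(1 - 256 * error_scale) * real (M m s n t) \<le> real (card {A \<in> tables m s n t. \<forall>p. count A p \<le> 3})"
    unfolding M_eq_card_tables error_scale_def
    using rows cols S_pos assms by (rule tables_small_entries_ge)
  also have "\<dots> = (\<Sum>A\<in>{A \<in> tables m s n t. \<forall>p. count A p \<le> 3}. short_cycle_weight ({..<m} \<times> {..<n}) A)"
    by (subst sum.cong[OF refl short_cycle_weight_eq_1]) (auto dest: set_table)
  also have "\<dots> \<le> total"
    unfolding total_eq_weight[symmetric] by (intro sum_mono2) (auto simp: short_cycle_weight_nonneg)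
  finally show ?thesis .
qed

lemma M_pos: "0 < real (M m s n t)"
  using tau_0_0_pos tau_0_0_le_core core_le_total total_le_M by linarith

lemma mu_le: "mu \<le> real (s * t) / 2"
  using s_pos t_pos by (simp add: mu_def algebra_simps)

lemma nu_le: "nu \<le> real (s * t) ^ 2 / (3 * real S)"
proof -
  have "(real k - 1) * (real k - 2) \<le> real k ^ 2" if "1 \<le> k" for k
    using that by (simp add: power2_eq_square algebra_simps)
  hence "((real s - 1) * (real s - 2)) * ((real t - 1) * (real t - 2)) \<le> real s ^ 2 * real t ^ 2"
    using s_pos t_pos by (intro mult_mono pred_pred_nonneg) auto
  thus ?thesis unfolding nu_def using S_pos by (simp add: divide_right_mono power_mult_distrib)
qed

lemma error_scale_eq: "error_scale = real (s * t) ^ 3 / real S ^ 2"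
  by (simp add: error_scale_def power_mult_distrib)

lemma error_scale_ge: "j \<le> 3 \<Longrightarrow> real (s * t) ^ j / real S ^ 2 \<le> error_scale"
  unfolding error_scale_eq using s_pos t_pos
  by (intro divide_right_mono power_increasing) (auto simp: Suc_le_eq simp flip: of_nat_mult)

text \<open>\<open>ln_sum_of_ratio\<close> gives the sum over \<open>a\<close> with \<open>b = 0\<close>, and \<open>ln_double_sum_of_ratio\<close> passes to the double
sum.  Every error is a product of powers of \<open>\<mu>\<close>, \<open>\<nu>\<close> and \<open>1 / S\<close>, to be compared with
\<open>(s t)\<^sup>3 / S\<^sup>2\<close> by means of \<open>\<mu> \<le> s t / 2\<close> and \<open>\<nu> \<le> (s t)\<^sup>2 / (3 S)\<close>.\<close>

lemma ln_core:
  assumes S: "24 \<le> S" and st: "s * t \<le> S"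
  shows "\<bar>ln core - ln (tau 0 0) - exponent\<bar> \<le> 2500 * error_scale"
proof -
  define X where "X = real (s * t)"
  define r where "r = real S"
  define g where "g = mu * beta / r"
  define e where "e = 320 * mu / r ^ 2"
  have Xr: "X \<le> r" using st unfolding X_def r_def by (simp only: of_nat_le_iff)
  have r: "24 \<le> r" using S by (simp add: r_def)
  have X1: "1 \<le> X" using s_pos t_pos unfolding X_def by (simp add: Suc_le_eq flip: of_nat_mult)
  have mu: "0 \<le> mu" "mu \<le> X / 2" using mu_nonneg mu_le by (simp_all add: X_def)
  have nu: "0 \<le> nu" "nu \<le> X ^ 2 / (3 * r)" using nu_nonneg nu_le by (simp_all add: X_def r_def)
  have er: "error_scale = X ^ 3 / r ^ 2" by (simp add: error_scale_eq X_def r_def)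
  have X2: "X ^ 2 / r ^ 2 \<le> error_scale" using error_scale_ge[of 2] by (simp add: X_def r_def)
  have powers: "mu ^ 2 \<le> X ^ 2 / 4" "mu ^ 3 \<le> X ^ 3 / 8"
    using power_mono[OF mu(2) mu(1), of 2] power_mono[OF mu(2) mu(1), of 3] by (simp_all add: power_divide)
  have gb: "\<bar>g\<bar> \<le> 4 * mu / r"
    using mu_beta_bound mu r by (simp add: g_def abs_mult divide_right_mono mult.commute)
  define P where "P = mu * (1 + 1 / r) + g * (mu * (1 + 1 / r)) / 2"
  define G1 where "G1 = g ^ 2 * (2 * mu)"
  define G2 where "G2 = (1 + \<bar>g\<bar>) * (e * (1 + 3 * (2 * mu) + (2 * mu) ^ 2))"
  define G3 where "G3 = 18 * nu / r * (1 + 2 * mu + 7 * nu)"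
  have "\<bar>ln (\<Sum>a\<le>S. core_term0 a) - ln (core_term0 0) - P\<bar> \<le> G1 + G2"
    unfolding P_def G1_def G2_def
  proof (rule ln_sum_of_ratio)
    show "0 < core_term0 0" using tau_0_0_pos by (simp add: core_term0_def)
    show "0 \<le> core_term0 a" for a by (simp add: core_term0_def tau_nonneg)
    show "S < a \<Longrightarrow> core_term0 a = 0" for a by (simp add: core_term0_def)
    show "(real a + 1) * core_term0 (Suc a) \<le> 2 * mu * core_term0 a" for a
      using core_term_transposition_le[of a 0] S by (simp add: core_term_0)
    show "\<bar>(real a + 1) * core_term0 (Suc a) - (mu * (1 + 1 / r) + g * real a) * core_term0 a\<bar>
          \<le> e * (real a + 1) ^ 2 * core_term0 a" for a
      using core_term0_ratio[of a] S by (simp add: g_def e_def r_def)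
  qed (use mu r in \<open>simp_all add: e_def\<close>)
  moreover have "G1 \<le> 4 * error_scale"
  proof -
    have "g ^ 2 \<le> (4 * mu / r) ^ 2" using gb by (metis abs_ge_zero power2_abs power_mono)
    hence "g ^ 2 * (2 * mu) \<le> (4 * mu / r) ^ 2 * (2 * mu)" using mu by (intro mult_right_mono) auto
    also have "\<dots> = 32 * mu ^ 3 / r ^ 2" by (simp add: power_divide power2_eq_square power3_eq_cube)
    also have "\<dots> \<le> 32 * (X ^ 3 / 8) / r ^ 2" using powers by (intro divide_right_mono) auto
    finally show ?thesis by (simp add: er G1_def)
  qed
  moreover have "G2 \<le> 2400 * error_scale"
  proof -
    have "4 * mu / r \<le> 2" using mu Xr r by (simp add: field_simps)
    hence "1 + \<bar>g\<bar> \<le> 3" using gb by linarith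
    moreover have "e * (1 + 3 * (2 * mu) + (2 * mu) ^ 2) \<le> 800 * error_scale"
    proof -
      have XX: "X \<le> X ^ 2" using X1 power_increasing[of 1 2 X] by simp
      have "1 + 3 * (2 * mu) + (2 * mu) ^ 2 \<le> 5 * X ^ 2"
        using mu X1 powers XX by (simp add: power_mult_distrib)
      hence "mu * (1 + 3 * (2 * mu) + (2 * mu) ^ 2) \<le> X / 2 * (5 * X ^ 2)"
        using mu X1 by (intro mult_mono) auto
      hence "320 / r ^ 2 * (mu * (1 + 3 * (2 * mu) + (2 * mu) ^ 2)) \<le> 320 / r ^ 2 * (X / 2 * (5 * X ^ 2))"
        by (rule mult_left_mono) simp
      thus ?thesis by (simp add: e_def er power2_eq_square power3_eq_cube)
    qed
    ultimately have "(1 + \<bar>g\<bar>) * (e * (1 + 3 * (2 * mu) + (2 * mu) ^ 2)) \<le> 3 * (800 * error_scale)"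
      by (rule mult_mono) (use mu r in \<open>auto simp: e_def intro!: mult_nonneg_nonneg add_nonneg_nonneg\<close>)
    thus ?thesis by (simp add: G2_def)
  qed
  moreover have "\<bar>P - (exponent - nu)\<bar> \<le> error_scale"
  proof -
    have "P - (exponent - nu) = mu / (2 * r) * g"
      unfolding P_def exponent_eq g_def r_def[symmetric] using r by (simp add: field_simps power2_eq_square)
    also have "\<bar>\<dots>\<bar> \<le> mu / (2 * r) * (4 * mu / r)"
      unfolding abs_mult using gb mu r by (intro mult_mono) auto
    also have "\<dots> = 2 * mu ^ 2 / r ^ 2" by (simp add: power2_eq_square)
    also have "\<dots> \<le> 2 * (X ^ 2 / 4) / r ^ 2" using powers by (intro divide_right_mono) auto
    also have "\<dots> \<le> X ^ 2 / r ^ 2" by (rule divide_right_mono) simp_all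
    also note X2
    finally show ?thesis .
  qed
  moreover have "\<bar>ln (\<Sum>a\<le>S. \<Sum>b\<le>S. core_term a b) - ln (\<Sum>a\<le>S. core_term a 0) - nu\<bar> \<le> G3"
    unfolding G3_def
  proof (rule ln_double_sum_of_ratio)
    show "0 < core_term 0 0" using tau_0_0_pos by (simp add: core_term_def)
    show "S < a \<Longrightarrow> core_term a b = 0" for a b by (simp add: core_term_def)
    show "S < b \<Longrightarrow> core_term a b = 0" for a b by (simp add: core_term_def)
    show "(real a + 1) * core_term (Suc a) b \<le> 2 * mu * core_term a b" for a b
      using S by (intro core_term_transposition_le) simp
    show "(real b + 1) * core_term a (Suc b) \<le> 7 * nu * core_term a b" for a b
      using S by (rule core_term_3cycle_le)
    show "\<bar>(real b + 1) * core_term a (Suc b) - nu * core_term a b\<bar> \<le> 18 * nu / r * (real a + real b + 1) * core_term a b" for a b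
      unfolding r_def using S by (rule core_term_ratio)
  qed (use mu nu r in \<open>simp_all add: core_term_nonneg\<close>)
  moreover have "G3 \<le> 26 * error_scale"
  proof -
    have "nu \<le> X / 3"
    proof -
      have "X ^ 2 / (3 * r) = X / 3 * (X / r)" by (simp add: power2_eq_square)
      also have "\<dots> \<le> X / 3 * 1" using Xr X1 r by (intro mult_left_mono) auto
      finally show ?thesis using nu by simp
    qed
    hence "1 + 2 * mu + 7 * nu \<le> 13 / 3 * X" using mu X1 by linarith
    moreover have "18 * nu / r \<le> 6 * X ^ 2 / r ^ 2"
      using mult_left_mono[OF nu(2), of "18 / r"] r by (simp add: power2_eq_square)
    ultimately have "18 * nu / r * (1 + 2 * mu + 7 * nu) \<le> 6 * X ^ 2 / r ^ 2 * (13 / 3 * X)"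
      using nu mu r by (intro mult_mono) auto
    thus ?thesis by (simp add: G3_def er power2_eq_square power3_eq_cube)
  qed
  moreover have "ln (core_term0 0) = ln (tau 0 0)" by (simp add: core_term0_def)
  moreover have "0 \<le> error_scale" by (simp add: error_scale_def)
  ultimately show ?thesis unfolding core_def core_term_0 by linarith
qed

text \<open>The tail is at most \<open>exp (-S) \<le> 2 / S\<^sup>2\<close> relative to the core.\<close>

lemma ln_total:
  assumes S: "24 \<le> S" and st: "s * t \<le> S" and small: "exp 10 * mu + exp 15 * nu \<le> real S"
  shows "\<bar>ln total - ln (tau 0 0) - exponent\<bar> \<le> 2502 * error_scale"
proof -
  have core: "0 < core" "tau 0 0 \<le> core" using tau_0_0_pos tau_0_0_le_core by simp_all
  have "exp (- real S) \<le> 2 * error_scale"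
  proof -
    have "real S ^ 2 / 2 \<le> exp (real S)"
      using exp_lower_Taylor_quadratic[of "real S"] by simp
    hence "exp (- real S) \<le> 2 / real S ^ 2"
      using S by (simp add: exp_minus field_simps)
    also have "\<dots> \<le> 2 * error_scale" using error_scale_ge[of 0] by simp
    finally show ?thesis .
  qed
  have "total \<le> core + core * exp (- real S)"
  proof -
    have "tau 0 0 * exp (- real S) \<le> core * exp (- real S)"
      by (rule mult_right_mono[OF core(2)]) simp
    thus ?thesis using total_le_core[OF small] by linarith
  qed
  also have "\<dots> \<le> core * (1 + 2 * error_scale)"
    using mult_left_mono[OF \<open>exp (- real S) \<le> 2 * error_scale\<close>, of core] core by (simp add: algebra_simps)
  finally have "total \<le> core * (1 + 2 * error_scale)" .
  hence "ln total \<le> ln (core * (1 + 2 * error_scale))"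
    using core core_le_total by (intro ln_mono) auto
  also have "\<dots> = ln core + ln (1 + 2 * error_scale)"
    using core by (intro ln_mult_pos) (auto simp: error_scale_def intro!: add_pos_nonneg)
  also have "\<dots> \<le> ln core + 2 * error_scale"
    by (intro add_left_mono ln_add_one_self_le_self) (simp add: error_scale_def)
  finally have "ln total \<le> ln core + 2 * error_scale" .
  moreover have "ln core \<le> ln total" using core core_le_total by (intro ln_mono) auto
  ultimately show ?thesis using ln_core[OF S st] by linarith
qed

text \<open>For \<open>x \<le> 1 / 512\<close> the bound \<open>(1 - 256 x) M \<le> total\<close> inverts to \<open>M \<le> (1 + 512 x) total\<close>.\<close>

lemma ln_M:
  assumes S: "24 \<le> S" and small: "exp 20 * real (s * t) \<le> real S" and error_scale: "512 * error_scale \<le> 1"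
  shows "\<bar>ln (real (M m s n t)) - ln (tau 0 0) - exponent\<bar> \<le> 3014 * error_scale"
proof -
  define X where "X = real (s * t)"
  define r where "r = real S"
  have r: "0 < r" using S by (simp add: r_def)
  have X1: "1 \<le> X" using s_pos t_pos unfolding X_def by (simp add: Suc_le_eq flip: of_nat_mult)
  have e20: "8 \<le> exp (20::real)" using exp_ge_add_one_self[of 20] by simp
  have "8 * X \<le> exp 20 * X" using e20 X1 by (intro mult_right_mono) auto
  hence X8: "8 * X \<le> r" using small by (simp add: X_def r_def)
  have st: "s * t \<le> S"
  proof -
    have "real (s * t) \<le> real S" using X8 X1 unfolding X_def r_def by linarith
    thus ?thesis by (simp only: of_nat_le_iff)
  qed
  have "2 * (s + t) \<le> S"
  proof -
    have "s \<le> s * t" "t \<le> s * t" using s_pos t_pos by simp_all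
    hence "2 * (s + t) \<le> 4 * (s * t)"
      using mult_le_mono2[OF add_mono[of s "s * t" t "s * t"], of 2] by (simp add: algebra_simps)
    hence "real (2 * (s + t)) \<le> real (4 * (s * t))" by (simp only: of_nat_le_iff)
    hence "real (2 * (s + t)) \<le> real S" using X8 X1 unfolding X_def r_def by simp
    thus ?thesis by (simp only: of_nat_le_iff)
  qed
  have le: "exp 10 * mu + exp 15 * nu \<le> real S"
  proof -
    have "exp 10 * mu \<le> exp 20 * (X / 2)"
      using mu_le mu_nonneg by (intro mult_mono) (simp_all add: X_def)
    moreover have "exp 15 * nu \<le> exp 20 * (X / 2)"
    proof (intro mult_mono)
      have "X ^ 2 / (3 * r) = X / 3 * (X / r)" by (simp add: power2_eq_square)
      also have "\<dots> \<le> X / 3 * 1" using X8 X1 r by (intro mult_left_mono) auto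
      finally show "nu \<le> X / 2" using nu_le X1 unfolding X_def[symmetric] r_def[symmetric] by linarith
    qed (use nu_nonneg in auto)
    ultimately show ?thesis using small unfolding X_def by linarith
  qed
  have M: "0 < real (M m s n t)" by (rule M_pos)
  have pos: "0 < total" using tau_0_0_pos tau_0_0_le_core core_le_total by linarith
  have e0: "0 \<le> error_scale" by (simp add: error_scale_def)
  have "1 \<le> (1 - 256 * error_scale) * (1 + 512 * error_scale)"
    using mult_left_mono[OF error_scale, of "256 * error_scale"] e0 by (simp add: algebra_simps)
  hence "real (M m s n t) \<le> ((1 - 256 * error_scale) * (1 + 512 * error_scale)) * real (M m s n t)"
    using M by simp
  also have "\<dots> = (1 + 512 * error_scale) * ((1 - 256 * error_scale) * real (M m s n t))" by simp
  also have "\<dots> \<le> (1 + 512 * error_scale) * total"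
    using M_le_total[OF \<open>2 * (s + t) \<le> S\<close>] e0 by (intro mult_left_mono) auto
  finally have "ln (real (M m s n t)) \<le> ln ((1 + 512 * error_scale) * total)"
    using M by (intro ln_mono) auto
  also have "\<dots> = ln (1 + 512 * error_scale) + ln total"
    using pos e0 by (intro ln_mult_pos) auto
  also have "\<dots> \<le> 512 * error_scale + ln total"
    by (intro add_right_mono ln_add_one_self_le_self) (use e0 in simp)
  finally have "ln (real (M m s n t)) \<le> ln total + 512 * error_scale" by simp
  moreover have "ln total \<le> ln (real (M m s n t))"
    using pos total_le_M by (intro ln_mono) auto
  ultimately show ?thesis using ln_total[OF S st le] by linarith
qed

end

theorem corollary1p4:
  fixes f :: "nat \<Rightarrow> real"
  assumes "f \<in> o(\<lambda>S. real S powr (2/3))"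
  shows "\<exists>c::real. \<forall>m n s t S :: nat.
           1 \<le> m \<and> 1 \<le> n \<and> s * m = S \<and> t * n = S \<and>
           1 \<le> s * t \<and> real (s * t) \<le> f S \<longrightarrow>
           (\<exists>E::real.
              \<bar>E\<bar> \<le> \<bar>c * (real s ^ 3 * real t ^ 3 / real S ^ 2)\<bar> \<and>
              real (M m s n t) =
                fact S / (fact s ^ m * fact t ^ n) *
                exp ((real s - 1) * (real t - 1) / 2
                     - (real s - 1) * (real t - 1)
                         * (2 * real s * real t - real s - real t - 10) / (12 * real S)
                     + E))"
proof -
  \<comment> \<open>Small enough for the hypotheses of \<open>ln_M\<close>: it bounds both \<open>s t / S\<close> and \<open>(s t)\<^sup>3 / S\<^sup>2\<close>.\<close>
  define \<epsilon> :: real where "\<epsilon> = exp (-20)"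
  have \<epsilon>: "0 < \<epsilon>" by (simp add: \<epsilon>_def)
  have \<epsilon>8: "\<epsilon> \<le> 1 / 8"
    using exp_ge_add_one_self[of 20] by (simp add: \<epsilon>_def exp_minus field_simps)
  have "\<forall>\<^sub>F S in sequentially. norm (f S) \<le> \<epsilon> * norm (real S powr (2 / 3))"
    using landau_o.smallD[OF assms \<epsilon>] .
  then obtain S0 where S0: "\<And>S. S0 \<le> S \<Longrightarrow> norm (f S) \<le> \<epsilon> * norm (real S powr (2 / 3))"
    unfolding eventually_sequentially by blast
  define S1 where "S1 = max S0 24"
  define D where "D s m t n = (let S = s * m in
      ln (real (M m s n t)) - ln (fact S / (fact s ^ m * fact t ^ n)) -
      ((real s - 1) * (real t - 1) / 2 - (real s - 1) * (real t - 1)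
        * (2 * real s * real t - real s - real t - 10) / (12 * real S)))" for s m t n
  define R where "R s m t n = \<bar>D s m t n\<bar> / (real s ^ 3 * real t ^ 3 / real (s * m) ^ 2)" for s m t n
  \<comment> \<open>The sum dominates the ratio of the actual to the allowed error in each of the finitely many cases below \<open>S1\<close>.\<close>
  define c0 where "c0 = (\<Sum>(s, m, t, n)\<in>{..S1} \<times> {..S1} \<times> {..S1} \<times> {..S1}. R s m t n)"
  have R0: "0 \<le> R s m t n" for s m t n by (simp add: R_def)
  have c0: "0 \<le> c0" unfolding c0_def by (intro sum_nonneg) (auto simp: R0)
  show ?thesis
  proof (rule exI[of _ "c0 + 3014"], intro allI impI, elim conjE)
    fix m n s t S :: nat
    assume mn: "1 \<le> m" "1 \<le> n" and sm: "s * m = S" and tn: "t * n = S"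
      and st: "1 \<le> s * t" and stf: "real (s * t) \<le> f S"
    have s: "1 \<le> s" "1 \<le> t" using st by (auto simp: Suc_le_eq)
    have S: "1 \<le> S" using sm mn s by (metis mult_le_mono nat_mult_1)
    interpret margins m s n t S by standard (use sm tn S in auto)
    let ?q = "real s ^ 3 * real t ^ 3 / real S ^ 2"
    have q: "0 < ?q" using s S by simp
    have D: "D s m t n = ln (real (M m s n t)) - ln (tau 0 0) - exponent"
      by (simp add: D_def Let_def sm tau_0_0 exponent_def)
    have bound: "\<bar>D s m t n\<bar> \<le> (c0 + 3014) * ?q"
    proof (cases "S1 \<le> S")
      case True
      hence S24: "24 \<le> S" and "S0 \<le> S" by (simp_all add: S1_def)
      have "real (s * t) \<le> \<epsilon> * real S powr (2 / 3)"
        using stf S0[OF \<open>S0 \<le> S\<close>] by simp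
      hence le: "real (s * t) \<le> \<epsilon> * real S powr (2 / 3)" .
      have "real S powr (2 / 3) \<le> real S powr 1" using S by (intro powr_mono) auto
      hence "\<epsilon> * real S powr (2 / 3) \<le> \<epsilon> * real S" using S \<epsilon> by (intro mult_left_mono) auto
      with le have "real (s * t) \<le> \<epsilon> * real S" by linarith
      hence "exp 20 * real (s * t) \<le> real S"
        by (simp add: \<epsilon>_def exp_minus field_simps)
      moreover have "512 * error_scale \<le> 1"
      proof -
        have "real (s * t) ^ 3 \<le> (\<epsilon> * real S powr (2 / 3)) ^ 3"
          using le by (intro power_mono) auto
        also have "\<dots> = \<epsilon> ^ 3 * real S ^ 2"
          using S by (simp add: power_mult_distrib powr_power powr_numeral)
        also have "\<dots> \<le> (1 / 8) ^ 3 * real S ^ 2"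
          using \<epsilon> \<epsilon>8 by (intro mult_right_mono power_mono) auto
        finally show ?thesis using S by (simp add: error_scale_eq power3_eq_cube field_simps)
      qed
      ultimately have "\<bar>D s m t n\<bar> \<le> 3014 * error_scale"
        unfolding D using S24 by (intro ln_M)
      also have "\<dots> \<le> (c0 + 3014) * error_scale" using c0 q by (intro mult_right_mono) (auto simp: error_scale_def)
      finally show ?thesis by (simp add: error_scale_def)
    next
      case False
      have "s \<le> S" "m \<le> S" unfolding sm[symmetric] using mn s by simp_all
      moreover have "t \<le> S" "n \<le> S" unfolding tn[symmetric] using mn s by simp_all
      ultimately have "R s m t n \<le> c0"
        unfolding c0_def
        using False member_le_sum[of "(s, m, t, n)" "{..S1} \<times> {..S1} \<times> {..S1} \<times> {..S1}" "\<lambda>(s, m, t, n). R s m t n"]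
        by (auto simp: R0)
      hence "\<bar>D s m t n\<bar> / ?q \<le> c0" by (simp only: R_def sm)
      hence "\<bar>D s m t n\<bar> \<le> c0 * ?q" by (simp only: pos_divide_le_eq[OF q])
      also have "\<dots> \<le> (c0 + 3014) * ?q" using q by (intro mult_right_mono) auto
      finally show ?thesis .
    qed
    have "real (M m s n t) = tau 0 0 * exp (exponent + D s m t n)"
      unfolding D using M_pos tau_0_0_pos by (simp add: exp_diff exp_add)
    moreover have "\<bar>D s m t n\<bar> \<le> \<bar>(c0 + 3014) * ?q\<bar>" using bound by linarith
    ultimately show "\<exists>E::real.
              \<bar>E\<bar> \<le> \<bar>(c0 + 3014) * ?q\<bar> \<and>
              real (M m s n t) =
                fact S / (fact s ^ m * fact t ^ n) *
                exp ((real s - 1) * (real t - 1) / 2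
                     - (real s - 1) * (real t - 1)
                         * (2 * real s * real t - real s - real t - 10) / (12 * real S)
                     + E)"
      unfolding tau_0_0 exponent_def by blast
  qed
qed

end
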